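(* Let $p$ be a prime number, let $R$ be a ring with $R_p=0$, and let $M$ be a left $R$-module of type $FP$ such that there is an integer $n_0\ge 0$ with $p^iM=p^{n_0}M$ for all $i\ge n_0$. a) Then $\varprojlim^1_i M_{p^i}=0$ and $\hat R\otimes_R M=\hat M=M/p^{n_0}M$ (via the natural maps). Now assume in addition that $R$ is augmented by a ring homomorphism $\varepsilon:R\to\mathbb Z$ and that $\varprojlim_i M_{p^i}=0$. Then: b) For each $i\ge 0$ the abelian group $\mathrm{Tor}^R_i(\mathbb Z,M)$ is finite and its $p$-primary part is annihilated by $p^{n_0}$. If $0\to P_d\to\cdots\to P_0\to M\to 0$ is a resolution of $M$ by finitely generated projective $R$-modules, then $\mathrm{Tor}^R_i(\mathbb Z,M)=0$ for $i>d$. In particular the multiplicative Euler characteristic $$\chi_R(M)=\prod_i|\mathrm{Tor}^R_i(\mathbb Z,M)|^{(-1)^i}\in\mathbb Q$$ is well defined. c) For any resolution $0\to P_d\to\cdots\to P_0\to M\to 0$ of $M$ by finitely generated projective $R$-modules, the sequence $$0\to \hat R_{\mathbb Q}\otimes_R P_d\to\cdots\to\hat R_{\mathbb Q}\otimes_R P_0\to 0$$ is exact. If $n_0=0$, i.e. if $p:M\to M$ is surjective, then even the sequence $$0\to \hat R\otimes_R P_d\to\cdots\to\hat R\otimes_R P_0\to 0$$ is exact.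
   Context: Rings are associative and unital, modules are left modules. An $R$-module $M$ is of type $FP$ if there is an exact sequence $0\to P_d\to\cdots\to P_0\to M\to 0$ of $R$-modules with all $P_\nu$ finitely generated projective. For an abelian group $A$ and $n\ge 0$ put $A_{p^n}=\ker(p^n:A\to A)$; $(A_{p^i})_i$ is regarded as a projective system with transition maps multiplication by $p$, $A_{p^i}\to A_{p^{i-1}}$, and $\varprojlim$, $\varprojlim^1$ refer to this system. $R_p=0$ means that multiplication by $p$ on $R$ is injective. $\hat A=\varprojlim_n A/p^nA$ is the $p$-adic completion; $\hat R$ is a ring, and $\hat R_{\mathbb Q}=\hat R\otimes_{\mathbb Z}\mathbb Q$. The natural map $\hat R\otimes_R M\to\hat M$ is $(e_i)\otimes a\mapsto(e_ia)$. An augmentation $\varepsilon:R\to\mathbb Z$ makes $\mathbb Z$ a right $R$-module, which is used in $\mathrm{Tor}^R_i(\mathbb Z,M)$. *)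

theory Defs
  imports
    "HOL-Algebra.Module"
    "HOL-Algebra.IntRing"
    "HOL-Algebra.Free_Abelian_Groups"
begin

section \<open>Left modules over a not necessarily commutative ring\<close>

text \<open>The axioms of the library locale \<^locale>\<open>module\<close>, with the commutativity of the ring dropped.
  The record \<^typ>\<open>('r, 'm) module\<close> also has fields for a multiplication and a unit; they play no role.\<close>

locale left_module = R?: ring R + M?: abelian_group M
  for R (structure) and M (structure) +
  assumes smult_closed:
      "\<lbrakk>a \<in> carrier R; x \<in> carrier M\<rbrakk> \<Longrightarrow> a \<odot>\<^bsub>M\<^esub> x \<in> carrier M"
    and smult_l_distr:
      "\<lbrakk>a \<in> carrier R; b \<in> carrier R; x \<in> carrier M\<rbrakk> \<Longrightarrow>
        (a \<oplus> b) \<odot>\<^bsub>M\<^esub> x = a \<odot>\<^bsub>M\<^esub> x \<oplus>\<^bsub>M\<^esub> b \<odot>\<^bsub>M\<^esub> x"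
    and smult_r_distr:
      "\<lbrakk>a \<in> carrier R; x \<in> carrier M; y \<in> carrier M\<rbrakk> \<Longrightarrow>
        a \<odot>\<^bsub>M\<^esub> (x \<oplus>\<^bsub>M\<^esub> y) = a \<odot>\<^bsub>M\<^esub> x \<oplus>\<^bsub>M\<^esub> a \<odot>\<^bsub>M\<^esub> y"
    and smult_assoc1:
      "\<lbrakk>a \<in> carrier R; b \<in> carrier R; x \<in> carrier M\<rbrakk> \<Longrightarrow>
        (a \<otimes> b) \<odot>\<^bsub>M\<^esub> x = a \<odot>\<^bsub>M\<^esub> (b \<odot>\<^bsub>M\<^esub> x)"
    and smult_one:
      "x \<in> carrier M \<Longrightarrow> \<one> \<odot>\<^bsub>M\<^esub> x = x"

definition linear_maps ::
  "('r, 'k) ring_scheme \<Rightarrow> ('r, 'm) module \<Rightarrow> ('r, 'n) module \<Rightarrow> ('m \<Rightarrow> 'n) set" where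
  "linear_maps R M N =
    {f \<in> hom (add_monoid M) (add_monoid N).
      \<forall>r\<in>carrier R. \<forall>x\<in>carrier M. f (r \<odot>\<^bsub>M\<^esub> x) = r \<odot>\<^bsub>N\<^esub> f x}"

definition fin_generated :: "('r, 'k) ring_scheme \<Rightarrow> ('r, 'm) module \<Rightarrow> bool" where
  "fin_generated R M \<longleftrightarrow>
    (\<exists>S. finite S \<and> S \<subseteq> carrier M \<and>
      (\<forall>x\<in>carrier M. \<exists>c\<in>S \<rightarrow> carrier R. x = (\<Oplus>\<^bsub>M\<^esub>s\<in>S. c s \<odot>\<^bsub>M\<^esub> s)))"

text \<open>The lifting property of a projective module. The test modules must live in fixed types;
  those chosen here suffice, because they include the identity of \<open>P\<close> and the surjection onto \<open>P\<close>
  from the free module on the set \<open>carrier P\<close>, and \<open>P\<close> lifts against every surjection as soon as this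
  one splits.\<close>

definition projective :: "('r, 'k) ring_scheme \<Rightarrow> ('r, 'q) module \<Rightarrow> bool" where
  "projective R P \<longleftrightarrow>
    (\<forall>(B :: ('r, 'q \<Rightarrow> 'r) module) (C :: ('r, 'q) module) g f.
      left_module R B \<and> left_module R C \<and> g \<in> linear_maps R B C \<and> g ` carrier B = carrier C \<and>
      f \<in> linear_maps R P C \<longrightarrow>
      (\<exists>h\<in>linear_maps R P B. \<forall>x\<in>carrier P. g (h x) = f x))"


section \<open>Chain complexes and modules of type FP\<close>

text \<open>Abelian groups are written multiplicatively, as in \<^theory>\<open>HOL-Algebra.Group\<close>; the additive group of
  a module is its \<^term>\<open>add_monoid\<close>. A complex consists of groups \<open>C i\<close> and maps
  \<open>\<delta> i\<close> from \<open>C (i + 1)\<close> to \<open>C i\<close>.\<close>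

definition cycles :: "(nat \<Rightarrow> ('a, 'e) monoid_scheme) \<Rightarrow> (nat \<Rightarrow> 'a \<Rightarrow> 'a) \<Rightarrow> nat \<Rightarrow> 'a set" where
  "cycles C \<delta> i =
    (case i of 0 \<Rightarrow> carrier (C 0) | Suc j \<Rightarrow> kernel (C (Suc j)) (C j) (\<delta> j))"

definition homology_group :: "(nat \<Rightarrow> ('a, 'e) monoid_scheme) \<Rightarrow> (nat \<Rightarrow> 'a \<Rightarrow> 'a) \<Rightarrow> nat \<Rightarrow> 'a set monoid" where
  "homology_group C \<delta> i = (C i)\<lparr>carrier := cycles C \<delta> i\<rparr> Mod (\<delta> i ` carrier (C (Suc i)))"

text \<open>The image of the map arriving at position \<open>i\<close> in \<open>0 \<rightarrow> C d \<rightarrow> \<dots> \<rightarrow> C 0\<close>.\<close>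

definition incoming_image ::
  "nat \<Rightarrow> (nat \<Rightarrow> ('a, 'e) monoid_scheme) \<Rightarrow> (nat \<Rightarrow> 'a \<Rightarrow> 'a) \<Rightarrow> nat \<Rightarrow> 'a set" where
  "incoming_image d C \<delta> i = (if i < d then \<delta> i ` carrier (C (Suc i)) else {\<one>\<^bsub>C i\<^esub>})"

text \<open>Exactness of \<open>0 \<rightarrow> C d \<rightarrow> \<dots> \<rightarrow> C 0 \<rightarrow> 0\<close>.\<close>

definition exact_complex ::
  "nat \<Rightarrow> (nat \<Rightarrow> ('a, 'e) monoid_scheme) \<Rightarrow> (nat \<Rightarrow> 'a \<Rightarrow> 'a) \<Rightarrow> bool" where
  "exact_complex d C \<delta> \<longleftrightarrow>
    (\<forall>i\<le>d. comm_group (C i)) \<and> (\<forall>i<d. \<delta> i \<in> hom (C (Suc i)) (C i)) \<and>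
    (\<forall>i\<le>d. cycles C \<delta> i = incoming_image d C \<delta> i)"

text \<open>\<open>0 \<rightarrow> P d \<rightarrow> \<dots> \<rightarrow> P 0 \<rightarrow> M \<rightarrow> 0\<close> is exact, the last map being \<open>\<eta>\<close>, with all \<open>P i\<close> finitely
  generated projective. The values of \<open>P\<close> beyond \<open>d\<close> are irrelevant.\<close>

definition fg_projective_resolution ::
  "('r, 'k) ring_scheme \<Rightarrow> ('r, 'm) module \<Rightarrow> nat \<Rightarrow> (nat \<Rightarrow> ('r, 'q) module) \<Rightarrow>
    (nat \<Rightarrow> 'q \<Rightarrow> 'q) \<Rightarrow> ('q \<Rightarrow> 'm) \<Rightarrow> bool" where
  "fg_projective_resolution R M d P \<delta> \<eta> \<longleftrightarrow>
    (\<forall>i\<le>d. left_module R (P i) \<and> fin_generated R (P i) \<and> projective R (P i)) \<and>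
    (\<forall>i<d. \<delta> i \<in> linear_maps R (P (Suc i)) (P i)) \<and>
    \<eta> \<in> linear_maps R (P 0) M \<and>
    \<eta> ` carrier (P 0) = carrier M \<and>
    kernel (add_monoid (P 0)) (add_monoid M) \<eta> = incoming_image d (\<lambda>i. add_monoid (P i)) \<delta> 0 \<and>
    (\<forall>i. 0 < i \<and> i \<le> d \<longrightarrow>
      cycles (\<lambda>i. add_monoid (P i)) \<delta> i = incoming_image d (\<lambda>i. add_monoid (P i)) \<delta> i)"

text \<open>The type argument names the type in which the resolution lives, since one cannot quantify over
  types inside a formula.\<close>

definition type_FP :: "'q itself \<Rightarrow> ('r, 'k) ring_scheme \<Rightarrow> ('r, 'm) module \<Rightarrow> bool" where
  "type_FP T R M \<longleftrightarrow>
    (\<exists>d (P :: nat \<Rightarrow> ('r, 'q) module) \<delta> \<eta>. fg_projective_resolution R M d P \<delta> \<eta>)"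


section \<open>Tensor products\<close>

text \<open>A right \<open>R\<close>-module \<open>A\<close> is also given by a record of type \<^typ>\<open>('r, 'a) module\<close>, where
  \<open>r \<odot>\<^bsub>A\<^esub> a\<close> stands for \<open>a \<cdot> r\<close>. The tensor product of \<open>A\<close> with a left \<open>R\<close>-module is the free abelian
  group on pairs modulo the bilinearity and balancing relations.\<close>

definition tensor_relations ::
  "('r, 'k) ring_scheme \<Rightarrow> ('r, 'a) module \<Rightarrow> ('r, 'm) module \<Rightarrow> ('a \<times> 'm \<Rightarrow>\<^sub>0 int) set" where
  "tensor_relations R A M =
    {frag_of (a \<oplus>\<^bsub>A\<^esub> a', x) - frag_of (a, x) - frag_of (a', x) | a a' x.
      a \<in> carrier A \<and> a' \<in> carrier A \<and> x \<in> carrier M} \<union>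
    {frag_of (a, x \<oplus>\<^bsub>M\<^esub> x') - frag_of (a, x) - frag_of (a, x') | a x x'.
      a \<in> carrier A \<and> x \<in> carrier M \<and> x' \<in> carrier M} \<union>
    {frag_of (r \<odot>\<^bsub>A\<^esub> a, x) - frag_of (a, r \<odot>\<^bsub>M\<^esub> x) | r a x.
      r \<in> carrier R \<and> a \<in> carrier A \<and> x \<in> carrier M}"

definition tensor_kernel ::
  "('r, 'k) ring_scheme \<Rightarrow> ('r, 'a) module \<Rightarrow> ('r, 'm) module \<Rightarrow> ('a \<times> 'm \<Rightarrow>\<^sub>0 int) set" where
  "tensor_kernel R A M =
    generate (free_Abelian_group (carrier A \<times> carrier M)) (tensor_relations R A M)"

definition tensor ::
  "('r, 'k) ring_scheme \<Rightarrow> ('r, 'a) module \<Rightarrow> ('r, 'm) module \<Rightarrow> ('a \<times> 'm \<Rightarrow>\<^sub>0 int) set monoid" where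
  "tensor R A M = free_Abelian_group (carrier A \<times> carrier M) Mod tensor_kernel R A M"

definition pure_tensor ::
  "('r, 'k) ring_scheme \<Rightarrow> ('r, 'a) module \<Rightarrow> ('r, 'm) module \<Rightarrow> 'a \<Rightarrow> 'm \<Rightarrow> ('a \<times> 'm \<Rightarrow>\<^sub>0 int) set" where
  "pure_tensor R A M a x =
    tensor_kernel R A M #>\<^bsub>free_Abelian_group (carrier A \<times> carrier M)\<^esub> frag_of (a, x)"

text \<open>The homomorphism from a tensor product to the abelian group \<open>G\<close> that is induced by a balanced
  biadditive map \<open>\<phi>\<close>: its value on a coset is the common value of the linear extension of \<open>\<phi>\<close> on the
  elements of the coset.\<close>

definition tensor_lift ::
  "('g, 'e) monoid_scheme \<Rightarrow> ('a \<Rightarrow> 'm \<Rightarrow> 'g) \<Rightarrow> ('a \<times> 'm \<Rightarrow>\<^sub>0 int) set \<Rightarrow> 'g" where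
  "tensor_lift G \<phi> X =
    the_elem ((\<lambda>c. \<Otimes>\<^bsub>G\<^esub>k\<in>Poly_Mapping.keys c.
      \<phi> (fst k) (snd k) [^]\<^bsub>G\<^esub> Poly_Mapping.lookup c k) ` X)"

text \<open>The homomorphism \<open>id \<otimes> f\<close> for \<open>f\<close> from a left module \<open>M\<close> to \<open>N\<close>; the module \<open>M\<close> is not needed as an
  argument.\<close>

definition tensor_map ::
  "('r, 'k) ring_scheme \<Rightarrow> ('r, 'a) module \<Rightarrow> ('r, 'n) module \<Rightarrow> ('m \<Rightarrow> 'n) \<Rightarrow>
    ('a \<times> 'm \<Rightarrow>\<^sub>0 int) set \<Rightarrow> ('a \<times> 'n \<Rightarrow>\<^sub>0 int) set" where
  "tensor_map R A N f = tensor_lift (tensor R A N) (\<lambda>a x. pure_tensor R A N a (f x))"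

definition right_module_via ::
  "('s, 'l) ring_scheme \<Rightarrow> ('r \<Rightarrow> 's) \<Rightarrow> ('r, 's) module" where
  "right_module_via S \<phi> =
    \<lparr>carrier = carrier S, monoid.mult = monoid.mult S, one = \<one>\<^bsub>S\<^esub>, ring.zero = \<zero>\<^bsub>S\<^esub>,
     add = add S,
     smult = (\<lambda>r s. s \<otimes>\<^bsub>S\<^esub> \<phi> r)\<rparr>"

definition int_module :: "('a, 'l) ring_scheme \<Rightarrow> (int, 'a) module" where
  "int_module S =
    \<lparr>carrier = carrier S, monoid.mult = monoid.mult S, one = \<one>\<^bsub>S\<^esub>, ring.zero = \<zero>\<^bsub>S\<^esub>,
     add = add S,
     smult = (\<lambda>k x. [k] \<cdot>\<^bsub>S\<^esub> x)\<rparr>"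


section \<open>Tor\<close>

definition free_left_module :: "('r, 'k) ring_scheme \<Rightarrow> 'b set \<Rightarrow> ('r, 'b \<Rightarrow> 'r) module" where
  "free_left_module R B =
    \<lparr>carrier = {c. (\<forall>b. c b \<in> carrier R) \<and> finite {b. c b \<noteq> \<zero>\<^bsub>R\<^esub>} \<and> {b. c b \<noteq> \<zero>\<^bsub>R\<^esub>} \<subseteq> B},
     monoid.mult = undefined, one = undefined, ring.zero = (\<lambda>b. \<zero>\<^bsub>R\<^esub>), add = (\<lambda>c c' b. c b \<oplus>\<^bsub>R\<^esub> c' b),
     smult = (\<lambda>r c b. r \<otimes>\<^bsub>R\<^esub> c b)\<rparr>"

definition linear_extension ::
  "('r, 'k) ring_scheme \<Rightarrow> ('r, 'm) module \<Rightarrow> ('b \<Rightarrow> 'm) \<Rightarrow> ('b \<Rightarrow> 'r) \<Rightarrow> 'm" where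
  "linear_extension R M g c = (\<Oplus>\<^bsub>M\<^esub>b\<in>{b. c b \<noteq> \<zero>\<^bsub>R\<^esub>}. c b \<odot>\<^bsub>M\<^esub> g b)"

text \<open>A canonical free resolution of \<open>M\<close>, all of whose terms live in one type: the basis in degree
  \<open>0\<close> consists of the elements of \<open>M\<close>, and the basis in degree \<open>n + 1\<close> of all formal linear
  combinations (lists of coefficients and basis elements) in degree \<open>n\<close> that are mapped to zero.
  The boundary of such a basis element is the linear combination that it denotes.\<close>

datatype ('r, 'm) cell = Elem 'm | Syz "('r \<times> ('r, 'm) cell) list"

definition formal_sum :: "('r, 'k) ring_scheme \<Rightarrow> ('r \<times> 'b) list \<Rightarrow> 'b \<Rightarrow> 'r" where
  "formal_sum R xs b = (\<Oplus>\<^bsub>R\<^esub>i\<in>{i. i < length xs \<and> snd (xs ! i) = b}. fst (xs ! i))"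

definition res_augmentation ::
  "('r, 'k) ring_scheme \<Rightarrow> ('r, 'm) module \<Rightarrow> (('r, 'm) cell \<Rightarrow> 'r) \<Rightarrow> 'm" where
  "res_augmentation R M =
    linear_extension R M (\<lambda>b. case b of Elem x \<Rightarrow> x | Syz xs \<Rightarrow> \<zero>\<^bsub>M\<^esub>)"

definition res_boundary ::
  "('r, 'k) ring_scheme \<Rightarrow> (('r, 'm) cell \<Rightarrow> 'r) \<Rightarrow> ('r, 'm) cell \<Rightarrow> 'r" where
  "res_boundary R =
    linear_extension R (free_left_module R UNIV)
      (\<lambda>b. case b of Elem x \<Rightarrow> (\<lambda>_. \<zero>\<^bsub>R\<^esub>) | Syz xs \<Rightarrow> formal_sum R xs)"

fun res_basis ::
  "('r, 'k) ring_scheme \<Rightarrow> ('r, 'm) module \<Rightarrow> nat \<Rightarrow> ('r, 'm) cell set" where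
  "res_basis R M 0 = Elem ` carrier M"
| "res_basis R M (Suc 0) =
    Syz ` {xs \<in> lists (carrier R \<times> res_basis R M 0).
      res_augmentation R M (formal_sum R xs) = \<zero>\<^bsub>M\<^esub>}"
| "res_basis R M (Suc (Suc n)) =
    Syz ` {xs \<in> lists (carrier R \<times> res_basis R M (Suc n)).
      res_boundary R (formal_sum R xs) = (\<lambda>_. \<zero>\<^bsub>R\<^esub>)}"

definition free_resolution ::
  "('r, 'k) ring_scheme \<Rightarrow> ('r, 'm) module \<Rightarrow> nat \<Rightarrow> ('r, ('r, 'm) cell \<Rightarrow> 'r) module" where
  "free_resolution R M n = free_left_module R (res_basis R M n)"

definition Tor ::
  "('r, 'k) ring_scheme \<Rightarrow> ('r, 'a) module \<Rightarrow> ('r, 'm) module \<Rightarrow> nat \<Rightarrow>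
    ('a \<times> (('r, 'm) cell \<Rightarrow> 'r) \<Rightarrow>\<^sub>0 int) set set monoid" where
  "Tor R A M =
    homology_group (\<lambda>n. tensor R A (free_resolution R M n))
      (\<lambda>n. tensor_map R A (free_resolution R M n) (res_boundary R))"

text \<open>The product over all \<open>i\<close>, taken over the indices with a factor different from \<open>1\<close>. Infinite
  groups have \<^const>\<open>order\<close> zero, so this is only meaningful if all Tor groups are finite and almost all
  of them trivial.\<close>

definition mult_Euler_char ::
  "('r, 'k) ring_scheme \<Rightarrow> ('r, 'a) module \<Rightarrow> ('r, 'm) module \<Rightarrow> rat" where
  "mult_Euler_char R A M =
    (\<Prod>i\<in>{i. order (Tor R A M i) \<noteq> 1}. of_nat (order (Tor R A M i)) powi ((-1) ^ i))"


section \<open>Inverse limits and p-adic completion\<close>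

text \<open>For towers with transition maps \<open>\<phi> n\<close> from \<open>G (n + 1)\<close> to \<open>G n\<close>.\<close>

definition inverse_limit ::
  "(nat \<Rightarrow> ('a, 'e) monoid_scheme) \<Rightarrow> (nat \<Rightarrow> 'a \<Rightarrow> 'a) \<Rightarrow> (nat \<Rightarrow> 'a) monoid" where
  "inverse_limit G \<phi> =
    (product_group UNIV G)
      \<lparr>carrier := {x \<in> carrier (product_group UNIV G). \<forall>n. \<phi> n (x (Suc n)) = x n}\<rparr>"

definition inverse_limit1 ::
  "(nat \<Rightarrow> ('a, 'e) monoid_scheme) \<Rightarrow> (nat \<Rightarrow> 'a \<Rightarrow> 'a) \<Rightarrow> (nat \<Rightarrow> 'a) set monoid" where
  "inverse_limit1 G \<phi> =
    product_group UNIV G Mod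
      ((\<lambda>x n. x n \<otimes>\<^bsub>G n\<^esub> inv\<^bsub>G n\<^esub> \<phi> n (x (Suc n))) ` carrier (product_group UNIV G))"

text \<open>The subgroups \<open>p\<^sup>n A\<close> and \<open>ker (p\<^sup>n : A \<rightarrow> A)\<close> of an abelian group \<open>A\<close> in multiplicative notation.\<close>

definition power_image :: "nat \<Rightarrow> nat \<Rightarrow> ('a, 'e) monoid_scheme \<Rightarrow> 'a set" where
  "power_image p n A = (\<lambda>x. x [^]\<^bsub>A\<^esub> (p ^ n)) ` carrier A"

definition torsion_part :: "nat \<Rightarrow> nat \<Rightarrow> ('a, 'e) monoid_scheme \<Rightarrow> ('a, 'e) monoid_scheme" where
  "torsion_part p n A = A\<lparr>carrier := {x \<in> carrier A. x [^]\<^bsub>A\<^esub> (p ^ n) = \<one>\<^bsub>A\<^esub>}\<rparr>"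

definition torsion_limit :: "nat \<Rightarrow> ('a, 'e) monoid_scheme \<Rightarrow> (nat \<Rightarrow> 'a) monoid" where
  "torsion_limit p A = inverse_limit (\<lambda>n. torsion_part p n A) (\<lambda>n x. x [^]\<^bsub>A\<^esub> p)"

definition torsion_limit1 :: "nat \<Rightarrow> ('a, 'e) monoid_scheme \<Rightarrow> (nat \<Rightarrow> 'a) set monoid" where
  "torsion_limit1 p A = inverse_limit1 (\<lambda>n. torsion_part p n A) (\<lambda>n x. x [^]\<^bsub>A\<^esub> p)"

definition padic_completion :: "nat \<Rightarrow> ('a, 'e) monoid_scheme \<Rightarrow> (nat \<Rightarrow> 'a set) monoid" where
  "padic_completion p A =
    inverse_limit (\<lambda>n. A Mod power_image p n A) (\<lambda>n X. power_image p n A <#>\<^bsub>A\<^esub> X)"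

definition padic_completion_ring :: "nat \<Rightarrow> ('r, 'k) ring_scheme \<Rightarrow> (nat \<Rightarrow> 'r set) ring" where
  "padic_completion_ring p R =
    \<lparr>carrier = carrier (padic_completion p (add_monoid R)),
     monoid.mult = (\<lambda>x y n. rcoset_mult R (power_image p n (add_monoid R)) (x n) (y n)),
     one = (\<lambda>n. power_image p n (add_monoid R) +>\<^bsub>R\<^esub> \<one>\<^bsub>R\<^esub>),
     ring.zero = \<one>\<^bsub>padic_completion p (add_monoid R)\<^esub>,
     add = monoid.mult (padic_completion p (add_monoid R))\<rparr>"

definition completion_map :: "nat \<Rightarrow> ('r, 'k) ring_scheme \<Rightarrow> 'r \<Rightarrow> nat \<Rightarrow> 'r set" where
  "completion_map p R r = (\<lambda>n. power_image p n (add_monoid R) +>\<^bsub>R\<^esub> r)"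

definition completed_ring_module ::
  "nat \<Rightarrow> ('r, 'k) ring_scheme \<Rightarrow> ('r, nat \<Rightarrow> 'r set) module" where
  "completed_ring_module p R = right_module_via (padic_completion_ring p R) (completion_map p R)"

definition rat_ring :: "rat ring" where
  "rat_ring = \<lparr>carrier = UNIV, monoid.mult = (*), one = 1, ring.zero = 0, add = (+)\<rparr>"

text \<open>The tensor product over the integers of the completion of \<open>R\<close> with the rationals, as a right
  \<open>R\<close>-module by \<open>(e \<otimes> q) \<cdot> r = (e \<cdot> r) \<otimes> q\<close>. Only this structure enters into tensor products
  over \<open>R\<close>; the ring structure is not recorded.\<close>

definition rational_completed_ring_module ::
  "nat \<Rightarrow> ('r, 'k) ring_scheme \<Rightarrow> ('r, ((nat \<Rightarrow> 'r set) \<times> rat \<Rightarrow>\<^sub>0 int) set) module" where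
  "rational_completed_ring_module p R =
    (let E = int_module (padic_completion_ring p R); Q = int_module rat_ring; T = tensor \<Z> E Q
     in \<lparr>carrier = carrier T, monoid.mult = undefined, one = undefined, ring.zero = \<one>\<^bsub>T\<^esub>, add = monoid.mult T,
         smult = (\<lambda>r. tensor_lift T
           (\<lambda>e q. pure_tensor \<Z> E Q (r \<odot>\<^bsub>completed_ring_module p R\<^esub> e) q))\<rparr>)"

text \<open>The natural map sending \<open>(e\<^sub>n) \<otimes> x\<close> to \<open>(e\<^sub>n x)\<close>, where the product of the cosets
  \<open>e\<^sub>n = p\<^sup>n R + r\<close> and \<open>x\<close> is the coset \<open>p\<^sup>n M + r x\<close>.\<close>

definition completion_tensor_map ::
  "nat \<Rightarrow> ('r, 'k) ring_scheme \<Rightarrow> ('r, 'm) module \<Rightarrow>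
    ((nat \<Rightarrow> 'r set) \<times> 'm \<Rightarrow>\<^sub>0 int) set \<Rightarrow> nat \<Rightarrow> 'm set" where
  "completion_tensor_map p R M =
    tensor_lift (padic_completion p (add_monoid M))
      (\<lambda>e x n. \<Union>r\<in>e n. power_image p n (add_monoid M) +>\<^bsub>M\<^esub> (r \<odot>\<^bsub>M\<^esub> x))"

end

theory Submission
  imports Defs "HOL-Algebra.Multiplicative_Group"
begin

text \<open>Write \<open>q = p ^ n0\<close> and \<open>N = q M\<close>. The stability of the groups \<open>p\<^sup>i M\<close> says that \<open>N\<close> is
  \<open>p\<close>-divisible. The theorem holds because the completed ring \<open>E\<close> of \<open>R\<close> annihilates such groups: if
  \<open>x\<^sub>0, x\<^sub>1, \<dots>\<close> in \<open>N\<close> satisfy \<open>x\<^sub>k = p x\<^sub>k\<^sub>+\<^sub>1\<close>, then \<open>e \<otimes> x\<^sub>0\<close> vanishes in \<open>E \<otimes> M\<close>.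

  Two properties of \<open>E\<close> are responsible. A group is called \<^emph>\<open>p-reduced\<close> if a sequence with
  \<open>D\<^sub>k = p D\<^sub>k\<^sub>+\<^sub>1\<close> has \<open>D\<^sub>0 = 0\<close>, and \<^emph>\<open>p-summable\<close> if all series \<open>\<Sum>\<^sub>k p\<^sup>k e\<^sub>k\<close> have a value, in the
  sense that there are tails with \<open>w\<^sub>k = e\<^sub>k + p w\<^sub>k\<^sub>+\<^sub>1\<close>. Every \<open>p\<close>-adic completion has both properties,
  and a dual basis hands them on to \<open>E \<otimes> P\<close> for finitely generated projective \<open>P\<close>. In a group with
  both properties \<open>1 - p u\<close> is bijective for each endomorphism \<open>u\<close>, the inverse being the Neumann
  series \<open>\<Sum>\<^sub>k p\<^sup>k u\<^sup>k\<close> (\<open>one_minus_p_injective\<close>, \<open>one_minus_p_surjective\<close>).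

  \<^bold>\<open>Part a.\<close> A sequence of torsion elements can be telescoped into \<open>N\<close>, where the equations that
  define the derived limit are solved by extracting roots (\<open>lim1_torsion_surj\<close>). In order to see that
  \<open>e \<otimes> x\<^sub>0 = 0\<close>, lift the \<open>x\<^sub>k\<close> to \<open>q\<^sub>k\<close> in \<open>P\<^sub>0\<close>. The elements \<open>q\<^sub>k - p q\<^sub>k\<^sub>+\<^sub>1\<close> are boundaries of some
  \<open>s\<^sub>k\<close> in \<open>P\<^sub>1\<close>, and the boundary of \<open>\<Sum>\<^sub>k p\<^sup>k (e \<otimes> s\<^sub>k)\<close> can only be \<open>e \<otimes> q\<^sub>0\<close>
  (\<open>completion_tensor_kills_stable_part\<close>). As \<open>E\<close> is the sum of \<open>q E\<close> and the image of \<open>R\<close>, and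
  \<open>q w \<otimes> x = w \<otimes> q x = 0\<close>, the group
  \<open>E \<otimes> M\<close> is \<open>M / N\<close>, and so is the completion of \<open>M\<close> (\<open>completion_tensor_iso\<close>, \<open>completion_iso\<close>).

  \<^bold>\<open>Parts b and c.\<close> If the limit of the torsion groups vanishes, then \<open>p\<close> is bijective on \<open>N\<close>, and
  \<open>\<psi> = (p q)\<^sup>-\<^sup>1 q\<close> is an \<open>R\<close>-linear endomorphism of \<open>M\<close> with \<open>q (1 - p \<psi>) = 0\<close>
  (\<open>divided_projection\<close>). Lift \<open>\<psi>\<close> to an endomorphism \<open>u\<close> of a projective resolution. Then
  \<open>q (1 - p u)\<close> is null-homotopic. Whenever \<open>1 - p u\<close> is bijective after tensoring, every
  cycle is \<open>(1 - p u) s\<close> for a cycle \<open>s\<close>, and hence its \<open>q\<close>-fold multiple is a boundary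
  (\<open>cycle_power_is_boundary\<close>). With coefficients \<open>E\<close> this shows that \<open>q\<close> annihilates the homology,
  which therefore vanishes for \<open>n0 = 0\<close> and in general after tensoring with the rationals
  (\<open>rational_cycle_is_boundary\<close>). With coefficients \<open>\<int>\<close> the map \<open>1 - p u\<close> is still injective, and its
  cokernel is annihilated by some \<open>K\<close> prime to \<open>p\<close>, by Nakayama's lemma. Hence \<open>K q\<close> annihilates the
  finitely generated groups \<open>Tor\<^sub>i\<close>, which gives their finiteness and the bound on the
  \<open>p\<close>-primary part (\<open>Tor_finite\<close>).

  The Tor groups come from a canonical resolution that is far too large for such arguments;
  \<open>homology_comparison\<close> carries the results over from a finitely generated one.
\<close>

section \<open>Tensor products over a ring\<close>

text \<open>Right modules in the encoding by which \<open>r \<odot>\<^bsub>A\<^esub> a\<close> stands for \<open>a \<cdot> r\<close>; this is why \<open>act_mult\<close> reverses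
  the order of the factors.\<close>

locale right_module = R?: ring R + A?: abelian_group A
  for R :: "('r, 'k) ring_scheme" (structure) and A :: "('r, 'a) module" (structure) +
  assumes act_closed: "\<lbrakk>r \<in> carrier R; a \<in> carrier A\<rbrakk> \<Longrightarrow> r \<odot>\<^bsub>A\<^esub> a \<in> carrier A"
    and act_add_scalar: "\<lbrakk>r \<in> carrier R; s \<in> carrier R; a \<in> carrier A\<rbrakk> \<Longrightarrow>
      (r \<oplus> s) \<odot>\<^bsub>A\<^esub> a = r \<odot>\<^bsub>A\<^esub> a \<oplus>\<^bsub>A\<^esub> s \<odot>\<^bsub>A\<^esub> a"
    and act_add: "\<lbrakk>r \<in> carrier R; a \<in> carrier A; b \<in> carrier A\<rbrakk> \<Longrightarrow>
      r \<odot>\<^bsub>A\<^esub> (a \<oplus>\<^bsub>A\<^esub> b) = r \<odot>\<^bsub>A\<^esub> a \<oplus>\<^bsub>A\<^esub> r \<odot>\<^bsub>A\<^esub> b"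
    and act_mult: "\<lbrakk>r \<in> carrier R; s \<in> carrier R; a \<in> carrier A\<rbrakk> \<Longrightarrow>
      (r \<otimes> s) \<odot>\<^bsub>A\<^esub> a = s \<odot>\<^bsub>A\<^esub> (r \<odot>\<^bsub>A\<^esub> a)"
    and act_one: "a \<in> carrier A \<Longrightarrow> \<one> \<odot>\<^bsub>A\<^esub> a = a"

definition balanced ::
  "('r, 'k) ring_scheme \<Rightarrow> ('r, 'a) module \<Rightarrow> ('r, 'm) module \<Rightarrow> ('g, 'e) monoid_scheme \<Rightarrow>
    ('a \<Rightarrow> 'm \<Rightarrow> 'g) \<Rightarrow> bool" where
  "balanced R A M G \<phi> \<longleftrightarrow>
    (\<forall>a\<in>carrier A. \<forall>x\<in>carrier M. \<phi> a x \<in> carrier G) \<and>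
    (\<forall>a\<in>carrier A. \<forall>a'\<in>carrier A. \<forall>x\<in>carrier M. \<phi> (a \<oplus>\<^bsub>A\<^esub> a') x = \<phi> a x \<otimes>\<^bsub>G\<^esub> \<phi> a' x) \<and>
    (\<forall>a\<in>carrier A. \<forall>x\<in>carrier M. \<forall>x'\<in>carrier M. \<phi> a (x \<oplus>\<^bsub>M\<^esub> x') = \<phi> a x \<otimes>\<^bsub>G\<^esub> \<phi> a x') \<and>
    (\<forall>r\<in>carrier R. \<forall>a\<in>carrier A. \<forall>x\<in>carrier M. \<phi> (r \<odot>\<^bsub>A\<^esub> a) x = \<phi> a (r \<odot>\<^bsub>M\<^esub> x))"

lemma balancedI:
  assumes "\<And>a x. \<lbrakk>a \<in> carrier A; x \<in> carrier M\<rbrakk> \<Longrightarrow> \<phi> a x \<in> carrier G"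
    and "\<And>a a' x. \<lbrakk>a \<in> carrier A; a' \<in> carrier A; x \<in> carrier M\<rbrakk> \<Longrightarrow>
      \<phi> (a \<oplus>\<^bsub>A\<^esub> a') x = \<phi> a x \<otimes>\<^bsub>G\<^esub> \<phi> a' x"
    and "\<And>a x x'. \<lbrakk>a \<in> carrier A; x \<in> carrier M; x' \<in> carrier M\<rbrakk> \<Longrightarrow>
      \<phi> a (x \<oplus>\<^bsub>M\<^esub> x') = \<phi> a x \<otimes>\<^bsub>G\<^esub> \<phi> a x'"
    and "\<And>r a x. \<lbrakk>r \<in> carrier R; a \<in> carrier A; x \<in> carrier M\<rbrakk> \<Longrightarrow>
      \<phi> (r \<odot>\<^bsub>A\<^esub> a) x = \<phi> a (r \<odot>\<^bsub>M\<^esub> x)"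
  shows "balanced R A M G \<phi>"
  using assms unfolding balanced_def by blast

context comm_group
begin

text \<open>The homomorphism that extends \<open>f\<close> to the free abelian group, in the form in which it occurs in
  \<^const>\<open>tensor_lift\<close>.\<close>

definition frag_eval :: "('c \<Rightarrow> 'a) \<Rightarrow> ('c \<Rightarrow>\<^sub>0 int) \<Rightarrow> 'a" where
  "frag_eval f c = (\<Otimes>k\<in>Poly_Mapping.keys c. f k [^] Poly_Mapping.lookup c k)"

lemma frag_eval_superset:
  assumes "f \<in> S \<rightarrow> carrier G" "finite S'" "Poly_Mapping.keys c \<subseteq> S'" "S' \<subseteq> S"
  shows "frag_eval f c = (\<Otimes>k\<in>S'. f k [^] Poly_Mapping.lookup c k)"
  unfolding frag_eval_def
proof (rule finprod_mono_neutral_cong_left)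
  show "f k [^] Poly_Mapping.lookup c k = \<one>" if "k \<in> S' - Poly_Mapping.keys c" for k
    using that by (simp add: in_keys_iff)
qed (use assms in auto)

lemma frag_eval_hom:
  assumes "f \<in> S \<rightarrow> carrier G"
  shows "frag_eval f \<in> hom (free_Abelian_group S) G"
proof (rule homI)
  fix c assume "c \<in> carrier (free_Abelian_group S)"
  then show "frag_eval f c \<in> carrier G"
    unfolding frag_eval_def using assms by (auto intro!: finprod_closed int_pow_closed)
next
  fix c d assume cd: "c \<in> carrier (free_Abelian_group S)" "d \<in> carrier (free_Abelian_group S)"
  let ?K = "Poly_Mapping.keys c \<union> Poly_Mapping.keys d"
  have f: "f k \<in> carrier G" if "k \<in> ?K" for k using that cd assms by auto
  have "frag_eval f (c + d) = (\<Otimes>k\<in>?K. f k [^] Poly_Mapping.lookup (c + d) k)"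
    by (rule frag_eval_superset[OF assms]) (use cd keys_add[of c d] in auto)
  also have "\<dots> = (\<Otimes>k\<in>?K. f k [^] Poly_Mapping.lookup c k \<otimes> f k [^] Poly_Mapping.lookup d k)"
    using f by (intro finprod_cong) (auto simp: Poly_Mapping.lookup_add int_pow_mult simp_implies_def)
  also have "\<dots> = (\<Otimes>k\<in>?K. f k [^] Poly_Mapping.lookup c k) \<otimes> (\<Otimes>k\<in>?K. f k [^] Poly_Mapping.lookup d k)"
    using f by (intro finprod_multf) auto
  also have "\<dots> = frag_eval f c \<otimes> frag_eval f d"
    using cd frag_eval_superset[OF assms, of ?K c] frag_eval_superset[OF assms, of ?K d] by simp
  finally show "frag_eval f (c \<otimes>\<^bsub>free_Abelian_group S\<^esub> d) = frag_eval f c \<otimes> frag_eval f d"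
    by simp
qed

lemma frag_eval_of [simp]: "f k \<in> carrier G \<Longrightarrow> frag_eval f (frag_of k) = f k"
  by (simp add: frag_eval_def finprod_insert)

lemma frag_eval_diff:
  assumes "f \<in> S \<rightarrow> carrier G" "Poly_Mapping.keys c \<subseteq> S" "Poly_Mapping.keys d \<subseteq> S"
  shows "frag_eval f (c - d) = frag_eval f c \<otimes> inv (frag_eval f d)"
proof -
  interpret h: group_hom "free_Abelian_group S" G "frag_eval f"
    by (simp add: group_hom_def group_hom_axioms_def frag_eval_hom[OF assms(1)] is_group)
  show ?thesis
    using h.hom_mult[of c "- d"] h.hom_inv[of d] assms by simp
qed

end

locale tensor_product = A: right_module R A + M: left_module R M
  for R :: "('r, 'k) ring_scheme" (structure) and A :: "('r, 'a) module" and M :: "('r, 'm) module"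
begin

abbreviation "FA \<equiv> free_Abelian_group (carrier A \<times> carrier M)"
abbreviation "K \<equiv> tensor_kernel R A M"
abbreviation "T \<equiv> tensor R A M"
abbreviation pure (infixl \<open>\<otimes>\<^sub>t\<close> 75) where "a \<otimes>\<^sub>t x \<equiv> pure_tensor R A M a x"

lemma relations_closed: "tensor_relations R A M \<subseteq> carrier FA"
proof -
  have diff: "c - d \<in> carrier FA" if "c \<in> carrier FA" "d \<in> carrier FA" for c d
    using that keys_diff[of c d] by auto
  show ?thesis
    unfolding tensor_relations_def
    by (auto simp del: carrier_free_Abelian_group_iff simp: A.act_closed M.smult_closed intro!: diff)
qed

lemma kernel_subgroup: "subgroup K FA"
  unfolding tensor_kernel_def by (intro group.generate_is_subgroup relations_closed) simp

lemma kernel_normal: "K \<lhd> FA"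
  by (simp add: abelian_free_Abelian_group comm_group.normal_iff_subgroup kernel_subgroup)

lemma tensor_comm_group: "comm_group T"
  unfolding tensor_def
  by (intro comm_group.abelian_FactGroup abelian_free_Abelian_group kernel_subgroup)

sublocale T: comm_group T by (rule tensor_comm_group)

lemma coset_hom: "(\<lambda>c. K #>\<^bsub>FA\<^esub> c) \<in> hom FA T"
  unfolding tensor_def by (rule normal.r_coset_hom_Mod[OF kernel_normal])

lemma coset_eqI:
  assumes "c \<in> carrier FA" "d \<in> carrier FA" "c - d \<in> tensor_relations R A M"
  shows "K #>\<^bsub>FA\<^esub> c = K #>\<^bsub>FA\<^esub> d"
proof -
  have "c - d \<in> K" unfolding tensor_kernel_def using assms(3) by (rule generate.incl)
  then have "K #>\<^bsub>FA\<^esub> (c - d) = \<one>\<^bsub>T\<^esub>"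
    using group.coset_join2[OF group_free_Abelian_group _ kernel_subgroup]
      subgroup.mem_carrier[OF kernel_subgroup] by (simp add: tensor_def)
  moreover have "c - d \<in> carrier FA" using assms(3) relations_closed by blast
  ultimately show ?thesis
    using hom_mult[OF coset_hom, of "c - d" d] assms(2) hom_in_carrier[OF coset_hom, of d] by simp
qed

lemma pure_closed [simp]: "\<lbrakk>a \<in> carrier A; x \<in> carrier M\<rbrakk> \<Longrightarrow> a \<otimes>\<^sub>t x \<in> carrier T"
  unfolding pure_tensor_def by (rule hom_in_carrier[OF coset_hom]) simp

lemma pure_add_left:
  assumes "a \<in> carrier A" "a' \<in> carrier A" "x \<in> carrier M"
  shows "(a \<oplus>\<^bsub>A\<^esub> a') \<otimes>\<^sub>t x = a \<otimes>\<^sub>t x \<otimes>\<^bsub>T\<^esub> a' \<otimes>\<^sub>t x"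
proof -
  have "K #>\<^bsub>FA\<^esub> frag_of (a \<oplus>\<^bsub>A\<^esub> a', x) = K #>\<^bsub>FA\<^esub> (frag_of (a, x) \<otimes>\<^bsub>FA\<^esub> frag_of (a', x))"
  proof (rule coset_eqI)
    show "frag_of (a \<oplus>\<^bsub>A\<^esub> a', x) - frag_of (a, x) \<otimes>\<^bsub>FA\<^esub> frag_of (a', x) \<in> tensor_relations R A M"
      using assms unfolding tensor_relations_def by (auto simp: diff_diff_eq)
    show "frag_of (a, x) \<otimes>\<^bsub>FA\<^esub> frag_of (a', x) \<in> carrier FA"
      using assms by (intro monoid.m_closed group.is_monoid) simp_all
  qed (use assms in auto)
  then show ?thesis
    using assms hom_mult[OF coset_hom] by (simp add: pure_tensor_def)
qed

lemma pure_add_right: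
  assumes "a \<in> carrier A" "x \<in> carrier M" "x' \<in> carrier M"
  shows "a \<otimes>\<^sub>t (x \<oplus>\<^bsub>M\<^esub> x') = a \<otimes>\<^sub>t x \<otimes>\<^bsub>T\<^esub> a \<otimes>\<^sub>t x'"
proof -
  have "K #>\<^bsub>FA\<^esub> frag_of (a, x \<oplus>\<^bsub>M\<^esub> x') = K #>\<^bsub>FA\<^esub> (frag_of (a, x) \<otimes>\<^bsub>FA\<^esub> frag_of (a, x'))"
  proof (rule coset_eqI)
    show "frag_of (a, x \<oplus>\<^bsub>M\<^esub> x') - frag_of (a, x) \<otimes>\<^bsub>FA\<^esub> frag_of (a, x') \<in> tensor_relations R A M"
      using assms unfolding tensor_relations_def by (auto simp: diff_diff_eq)
    show "frag_of (a, x) \<otimes>\<^bsub>FA\<^esub> frag_of (a, x') \<in> carrier FA"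
      using assms by (intro monoid.m_closed group.is_monoid) simp_all
  qed (use assms in auto)
  then show ?thesis
    using assms hom_mult[OF coset_hom] by (simp add: pure_tensor_def)
qed

lemma pure_balanced:
  assumes "r \<in> carrier R" "a \<in> carrier A" "x \<in> carrier M"
  shows "(r \<odot>\<^bsub>A\<^esub> a) \<otimes>\<^sub>t x = a \<otimes>\<^sub>t (r \<odot>\<^bsub>M\<^esub> x)"
  unfolding pure_tensor_def
  by (rule coset_eqI) (use assms in \<open>auto simp: tensor_relations_def A.act_closed M.smult_closed\<close>)

lemma pure_hom_right: "a \<in> carrier A \<Longrightarrow> (\<lambda>x. a \<otimes>\<^sub>t x) \<in> hom (add_monoid M) T"
  by (rule homI) (simp_all add: pure_add_right)

lemma pure_hom_left: "x \<in> carrier M \<Longrightarrow> (\<lambda>a. a \<otimes>\<^sub>t x) \<in> hom (add_monoid A) T"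
  by (rule homI) (simp_all add: pure_add_left)

lemma pure_inv_right:
  "\<lbrakk>a \<in> carrier A; x \<in> carrier M\<rbrakk> \<Longrightarrow> a \<otimes>\<^sub>t (\<ominus>\<^bsub>M\<^esub> x) = inv\<^bsub>T\<^esub> (a \<otimes>\<^sub>t x)"
  using group_hom.hom_inv[of "add_monoid M" T "\<lambda>x. a \<otimes>\<^sub>t x" x]
  by (simp add: group_hom_def group_hom_axioms_def pure_hom_right M.add.is_group T.is_group a_inv_def)

lemma pure_zero_right [simp]: "a \<in> carrier A \<Longrightarrow> a \<otimes>\<^sub>t \<zero>\<^bsub>M\<^esub> = \<one>\<^bsub>T\<^esub>"
  using hom_one[OF pure_hom_right M.add.is_group T.is_group] by simp

lemma pure_zero_left [simp]: "x \<in> carrier M \<Longrightarrow> \<zero>\<^bsub>A\<^esub> \<otimes>\<^sub>t x = \<one>\<^bsub>T\<^esub>"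
  using hom_one[OF pure_hom_left A.add.is_group T.is_group] by simp

lemma tensor_induct [consumes 1, case_names zero pure add]:
  assumes "t \<in> carrier T" and zero: "P \<one>\<^bsub>T\<^esub>"
    and pure: "\<And>a x. \<lbrakk>a \<in> carrier A; x \<in> carrier M\<rbrakk> \<Longrightarrow> P (a \<otimes>\<^sub>t x)"
    and add: "\<And>s t. \<lbrakk>s \<in> carrier T; t \<in> carrier T; P s; P t\<rbrakk> \<Longrightarrow> P (s \<otimes>\<^bsub>T\<^esub> t)"
  shows "P t"
proof -
  interpret h: group_hom FA T "\<lambda>c. K #>\<^bsub>FA\<^esub> c"
    by (simp add: group_hom_def group_hom_axioms_def coset_hom T.is_group)
  obtain c where c: "Poly_Mapping.keys c \<subseteq> carrier A \<times> carrier M" "t = K #>\<^bsub>FA\<^esub> c"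
    using assms(1) unfolding tensor_def carrier_FactGroup by auto
  \<comment> \<open>The inverse of a pure tensor is again pure, so inverses need no case of their own.\<close>
  have "P (K #>\<^bsub>FA\<^esub> c) \<and> P (inv\<^bsub>T\<^esub> (K #>\<^bsub>FA\<^esub> c))"
  proof (rule free_Abelian_group_induct[OF c(1)])
    show "P (K #>\<^bsub>FA\<^esub> 0) \<and> P (inv\<^bsub>T\<^esub> (K #>\<^bsub>FA\<^esub> 0))"
      using zero h.hom_one by simp
  next
    fix c d
    assume cd: "Poly_Mapping.keys c \<subseteq> carrier A \<times> carrier M" "Poly_Mapping.keys d \<subseteq> carrier A \<times> carrier M"
      and P: "P (K #>\<^bsub>FA\<^esub> c) \<and> P (inv\<^bsub>T\<^esub> (K #>\<^bsub>FA\<^esub> c))"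
        "P (K #>\<^bsub>FA\<^esub> d) \<and> P (inv\<^bsub>T\<^esub> (K #>\<^bsub>FA\<^esub> d))"
    have *: "K #>\<^bsub>FA\<^esub> (c - d) = (K #>\<^bsub>FA\<^esub> c) \<otimes>\<^bsub>T\<^esub> inv\<^bsub>T\<^esub> (K #>\<^bsub>FA\<^esub> d)"
      using h.hom_mult[of c "- d"] h.hom_inv[of d] cd by simp
    have cl: "K #>\<^bsub>FA\<^esub> c \<in> carrier T" "K #>\<^bsub>FA\<^esub> d \<in> carrier T"
      using cd h.hom_closed by simp_all
    show "P (K #>\<^bsub>FA\<^esub> (c - d)) \<and> P (inv\<^bsub>T\<^esub> (K #>\<^bsub>FA\<^esub> (c - d)))"
      unfolding * using P cl by (simp add: T.inv_mult add)
  next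
    fix k assume "k \<in> carrier A \<times> carrier M"
    then obtain a x where k: "k = (a, x)" "a \<in> carrier A" "x \<in> carrier M" by auto
    show "P (K #>\<^bsub>FA\<^esub> frag_of k) \<and> P (inv\<^bsub>T\<^esub> (K #>\<^bsub>FA\<^esub> frag_of k))"
      using pure[OF k(2,3)] pure[of a "\<ominus>\<^bsub>M\<^esub> x"] pure_inv_right[OF k(2,3)] k M.add.inv_closed[of x]
      by (simp add: pure_tensor_def)
  qed
  then show ?thesis using c(2) by simp
qed

lemma hom_eqI:
  assumes "f \<in> hom T G" "g \<in> hom T G" "group G"
    and "\<And>a x. \<lbrakk>a \<in> carrier A; x \<in> carrier M\<rbrakk> \<Longrightarrow> f (a \<otimes>\<^sub>t x) = g (a \<otimes>\<^sub>t x)"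
    and "t \<in> carrier T"
  shows "f t = g t"
  using assms(5)
  by (induction t rule: tensor_induct)
    (simp_all add: assms(4) hom_mult[OF assms(1)] hom_mult[OF assms(2)]
      hom_one[OF assms(1) T.is_group assms(3)] hom_one[OF assms(2) T.is_group assms(3)])

text \<open>Because \<open>\<phi>\<close> is balanced and biadditive, its linear extension vanishes on the defining relations and
  is constant on the cosets of the subgroup that they generate. So the image of a coset is a
  singleton, as \<^const>\<open>the_elem\<close> in the definition of \<^const>\<open>tensor_lift\<close> presupposes.\<close>

lemma tensor_lift:
  assumes "comm_group G" and bal: "balanced R A M G \<phi>"
  shows tensor_lift_hom: "tensor_lift G \<phi> \<in> hom T G"
    and tensor_lift_pure: "\<lbrakk>a \<in> carrier A; x \<in> carrier M\<rbrakk> \<Longrightarrow> tensor_lift G \<phi> (a \<otimes>\<^sub>t x) = \<phi> a x"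
proof -
  interpret G: comm_group G by fact
  let ?f = "\<lambda>k. \<phi> (fst k) (snd k)" and ?S = "carrier A \<times> carrier M"
  let ?e = "G.frag_eval ?f"
  have f: "?f \<in> ?S \<rightarrow> carrier G" using bal unfolding balanced_def by auto
  interpret e: group_hom FA G ?e
    by (simp add: group_hom_def group_hom_axioms_def G.frag_eval_hom[OF f])
  note bal' = bal[unfolded balanced_def]
  have diff: "?e (c - d) = ?e c \<otimes>\<^bsub>G\<^esub> inv\<^bsub>G\<^esub> ?e d \<and> c - d \<in> carrier FA"
    if "c \<in> carrier FA" "d \<in> carrier FA" for c d
    using G.frag_eval_diff[OF f, of c d] that keys_diff[of c d] by auto
  have of: "?e (frag_of (a, x)) = \<phi> a x \<and> frag_of (a, x) \<in> carrier FA \<and> \<phi> a x \<in> carrier G"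
    if "a \<in> carrier A" "x \<in> carrier M" for a x
    using bal' that by simp
  have cancel: "(g \<otimes>\<^bsub>G\<^esub> h) \<otimes>\<^bsub>G\<^esub> inv\<^bsub>G\<^esub> g \<otimes>\<^bsub>G\<^esub> inv\<^bsub>G\<^esub> h = \<one>\<^bsub>G\<^esub>"
    if "g \<in> carrier G" "h \<in> carrier G" for g h
    using that by (simp add: G.m_assoc flip: G.inv_mult_group) (simp add: G.m_assoc[symmetric] G.m_comm[of h g])
  have "c \<in> kernel FA G ?e" if "c \<in> tensor_relations R A M" for c
    using that unfolding tensor_relations_def
  proof (elim UnE CollectE exE conjE)
    fix a a' x assume c: "c = frag_of (a \<oplus>\<^bsub>A\<^esub> a', x) - frag_of (a, x) - frag_of (a', x)"
      and in_A: "a \<in> carrier A" "a' \<in> carrier A" "x \<in> carrier M"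
    then show ?thesis
      using bal' of[of "a \<oplus>\<^bsub>A\<^esub> a'" x] of[of a x] of[of a' x] cancel
      by (simp add: kernel_def diff del: carrier_free_Abelian_group_iff)
  next
    fix a x x' assume c: "c = frag_of (a, x \<oplus>\<^bsub>M\<^esub> x') - frag_of (a, x) - frag_of (a, x')"
      and in_A: "a \<in> carrier A" "x \<in> carrier M" "x' \<in> carrier M"
    then show ?thesis
      using bal' of[of a "x \<oplus>\<^bsub>M\<^esub> x'"] of[of a x] of[of a x'] cancel
      by (simp add: kernel_def diff del: carrier_free_Abelian_group_iff)
  next
    fix r a x assume c: "c = frag_of (r \<odot>\<^bsub>A\<^esub> a, x) - frag_of (a, r \<odot>\<^bsub>M\<^esub> x)"
      and in_A: "r \<in> carrier R" "a \<in> carrier A" "x \<in> carrier M"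
    then show ?thesis
      using bal' of[of "r \<odot>\<^bsub>A\<^esub> a" x] of[of a "r \<odot>\<^bsub>M\<^esub> x"] A.act_closed M.smult_closed
      by (simp add: kernel_def diff del: carrier_free_Abelian_group_iff)
  qed
  then have "tensor_relations R A M \<subseteq> kernel FA G ?e" by blast
  then have ker: "K \<subseteq> kernel FA G ?e"
    unfolding tensor_kernel_def
    by (intro group.generate_subgroup_incl e.subgroup_kernel) simp_all
  have *: "tensor_lift G \<phi> (K #>\<^bsub>FA\<^esub> c) = ?e c" if c: "c \<in> carrier FA" for c
  proof -
    have "?e ` (K #>\<^bsub>FA\<^esub> c) = {?e c}"
    proof -
      have "?e (k \<otimes>\<^bsub>FA\<^esub> c) = ?e c" if "k \<in> K" for k
        using ker that c e.hom_mult[of k c] unfolding kernel_def by auto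
      moreover have "0 \<in> K" using subgroup.one_closed[OF kernel_subgroup] by simp
      ultimately show ?thesis by (auto simp: r_coset_def)
    qed
    then show ?thesis by (simp add: tensor_lift_def G.frag_eval_def)
  qed
  show "tensor_lift G \<phi> \<in> hom T G"
  proof (rule homI)
    fix s assume "s \<in> carrier T"
    then obtain c where "c \<in> carrier FA" "s = K #>\<^bsub>FA\<^esub> c"
      unfolding tensor_def carrier_FactGroup by auto
    then show "tensor_lift G \<phi> s \<in> carrier G" using * e.hom_closed by simp
  next
    fix s t assume "s \<in> carrier T" "t \<in> carrier T"
    then obtain c d where cd: "c \<in> carrier FA" "s = K #>\<^bsub>FA\<^esub> c" "d \<in> carrier FA" "t = K #>\<^bsub>FA\<^esub> d"
      unfolding tensor_def carrier_FactGroup by auto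
    have "s \<otimes>\<^bsub>T\<^esub> t = K #>\<^bsub>FA\<^esub> (c \<otimes>\<^bsub>FA\<^esub> d)" using hom_mult[OF coset_hom cd(1,3)] cd by simp
    then show "tensor_lift G \<phi> (s \<otimes>\<^bsub>T\<^esub> t) = tensor_lift G \<phi> s \<otimes>\<^bsub>G\<^esub> tensor_lift G \<phi> t"
      using *[of "c \<otimes>\<^bsub>FA\<^esub> d"] * cd e.hom_mult[of c d] e.G.m_closed[OF cd(1,3)] by simp
  qed
  show "tensor_lift G \<phi> (a \<otimes>\<^sub>t x) = \<phi> a x" if "a \<in> carrier A" "x \<in> carrier M"
    using *[of "frag_of (a, x)"] of[OF that] by (simp add: pure_tensor_def)
qed

end

section \<open>Functoriality of the tensor product\<close>

lemma hom_finprod: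
  assumes "h \<in> hom G H" "comm_group G" "comm_group H" "f \<in> I \<rightarrow> carrier G"
  shows "h (finprod G f I) = finprod H (\<lambda>i. h (f i)) I"
proof -
  interpret G: comm_group G by fact
  interpret H: comm_group H by fact
  have hf: "h (f i) \<in> carrier H" if "i \<in> I" for i
    using assms(4) that hom_in_carrier[OF assms(1)] by auto
  show ?thesis
    using assms(4) hf
  proof (induction I rule: infinite_finite_induct)
    case (insert i I)
    then show ?case
      by (simp add: Pi_iff hom_mult[OF assms(1)])
  qed (simp_all add: hom_one[OF assms(1) G.is_group H.is_group])
qed

lemma hom_multI:
  assumes "f \<in> hom G H" "g \<in> hom G H" "comm_group H"
  shows "(\<lambda>x. f x \<otimes>\<^bsub>H\<^esub> g x) \<in> hom G H"
proof -
  interpret H: comm_group H by fact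
  show ?thesis
    by (rule homI) (auto simp: hom_mult[OF assms(1)] hom_mult[OF assms(2)]
        hom_in_carrier[OF assms(1)] hom_in_carrier[OF assms(2)] H.m_ac)
qed

lemma hom_powI:
  assumes "f \<in> hom G H" "comm_group H"
  shows "(\<lambda>x. f x [^]\<^bsub>H\<^esub> (k::nat)) \<in> hom G H"
proof -
  interpret H: comm_group H by fact
  show ?thesis
    by (rule homI) (auto simp: hom_mult[OF assms(1)] hom_in_carrier[OF assms(1)] H.nat_pow_distrib)
qed

lemma hom_oneI: "group H \<Longrightarrow> (\<lambda>x. \<one>\<^bsub>H\<^esub>) \<in> hom G H"
  by (rule homI) (simp_all add: group.is_monoid monoid.l_one)

lemma hom_finprodI:
  assumes "\<And>i. i \<in> I \<Longrightarrow> f i \<in> hom G H" "comm_group H"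
  shows "(\<lambda>x. \<Otimes>\<^bsub>H\<^esub>i\<in>I. f i x) \<in> hom G H"
proof -
  interpret H: comm_group H by fact
  show ?thesis
    by (rule homI) (auto simp: Pi_iff assms(1) hom_mult[OF assms(1)] hom_in_carrier[OF assms(1)]
        intro!: H.finprod_closed H.finprod_multf cong: H.finprod_cong)
qed

lemma linear_mapsI:
  assumes "\<And>x. x \<in> carrier M \<Longrightarrow> f x \<in> carrier N"
    and "\<And>x y. \<lbrakk>x \<in> carrier M; y \<in> carrier M\<rbrakk> \<Longrightarrow> f (x \<oplus>\<^bsub>M\<^esub> y) = f x \<oplus>\<^bsub>N\<^esub> f y"
    and "\<And>r x. \<lbrakk>r \<in> carrier R; x \<in> carrier M\<rbrakk> \<Longrightarrow> f (r \<odot>\<^bsub>M\<^esub> x) = r \<odot>\<^bsub>N\<^esub> f x"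
  shows "f \<in> linear_maps R M N"
  using assms by (auto simp: linear_maps_def hom_def)

lemma linear_mapsD:
  assumes "f \<in> linear_maps R M N"
  shows linear_map_hom: "f \<in> hom (add_monoid M) (add_monoid N)"
    and linear_map_closed: "x \<in> carrier M \<Longrightarrow> f x \<in> carrier N"
    and linear_map_add: "\<lbrakk>x \<in> carrier M; y \<in> carrier M\<rbrakk> \<Longrightarrow> f (x \<oplus>\<^bsub>M\<^esub> y) = f x \<oplus>\<^bsub>N\<^esub> f y"
    and linear_map_smult: "\<lbrakk>r \<in> carrier R; x \<in> carrier M\<rbrakk> \<Longrightarrow> f (r \<odot>\<^bsub>M\<^esub> x) = r \<odot>\<^bsub>N\<^esub> f x"
  using assms by (auto simp: linear_maps_def hom_def)

lemma linear_map_comp: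
  assumes "f \<in> linear_maps R M N" "g \<in> linear_maps R N L"
  shows "(\<lambda>x. g (f x)) \<in> linear_maps R M L"
  using linear_mapsD[OF assms(1)] linear_mapsD[OF assms(2)] by (intro linear_mapsI) simp_all

locale tensor_functor = A: right_module R A + M: left_module R M + N: left_module R N
  for R :: "('r, 'k) ring_scheme" (structure) and A :: "('r, 'a) module"
    and M :: "('r, 'm) module" and N :: "('r, 'n) module"
begin

sublocale TM: tensor_product R A M by unfold_locales
sublocale TN: tensor_product R A N by unfold_locales

lemma balanced_pure_map:
  assumes f: "f \<in> linear_maps R M N"
  shows "balanced R A M TN.T (\<lambda>a x. TN.pure a (f x))"
  by (rule balancedI)
    (simp_all add: linear_mapsD[OF f] TN.pure_add_left TN.pure_add_right TN.pure_balanced)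

lemma tensor_map:
  assumes f: "f \<in> linear_maps R M N"
  shows tensor_map_hom: "tensor_map R A N f \<in> hom TM.T TN.T"
    and tensor_map_pure: "\<lbrakk>a \<in> carrier A; x \<in> carrier M\<rbrakk> \<Longrightarrow>
      tensor_map R A N f (TM.pure a x) = TN.pure a (f x)"
  unfolding tensor_map_def
  using TM.tensor_lift[OF TN.tensor_comm_group balanced_pure_map[OF f]] by auto

lemma tensor_map_closed:
  "\<lbrakk>f \<in> linear_maps R M N; t \<in> carrier TM.T\<rbrakk> \<Longrightarrow> tensor_map R A N f t \<in> carrier TN.T"
  by (rule hom_in_carrier[OF tensor_map_hom])

lemma tensor_map_zero:
  assumes "f \<in> linear_maps R M N" "\<And>x. x \<in> carrier M \<Longrightarrow> f x = \<zero>\<^bsub>N\<^esub>" "t \<in> carrier TM.T"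
  shows "tensor_map R A N f t = \<one>\<^bsub>TN.T\<^esub>"
  by (rule TM.hom_eqI[OF tensor_map_hom[OF assms(1)] hom_oneI[OF TN.T.is_group] TN.T.is_group _ assms(3)])
    (simp add: tensor_map_pure[OF assms(1)] assms(2))

lemma tensor_map_cong:
  assumes "f \<in> linear_maps R M N" "g \<in> linear_maps R M N" "\<And>x. x \<in> carrier M \<Longrightarrow> f x = g x"
    "t \<in> carrier TM.T"
  shows "tensor_map R A N f t = tensor_map R A N g t"
  by (rule TM.hom_eqI[OF tensor_map_hom[OF assms(1)] tensor_map_hom[OF assms(2)] TN.T.is_group _ assms(4)])
    (simp add: tensor_map_pure[OF assms(1)] tensor_map_pure[OF assms(2)] assms(3))

lemma tensor_map_add:
  assumes "f \<in> linear_maps R M N" "g \<in> linear_maps R M N" "h \<in> linear_maps R M N"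
    "\<And>x. x \<in> carrier M \<Longrightarrow> h x = f x \<oplus>\<^bsub>N\<^esub> g x" "t \<in> carrier TM.T"
  shows "tensor_map R A N h t = tensor_map R A N f t \<otimes>\<^bsub>TN.T\<^esub> tensor_map R A N g t"
  by (rule TM.hom_eqI[OF tensor_map_hom[OF assms(3)] hom_multI[OF tensor_map_hom[OF assms(1)]
          tensor_map_hom[OF assms(2)] TN.tensor_comm_group] TN.T.is_group _ assms(5)])
    (simp add: tensor_map_pure assms(1-4) TN.pure_add_right linear_map_closed[OF assms(1)]
      linear_map_closed[OF assms(2)])

lemma tensor_map_pow:
  assumes f: "f \<in> linear_maps R M N" and h: "h \<in> linear_maps R M N"
    and eq: "\<And>x. x \<in> carrier M \<Longrightarrow> h x = [(k::nat)] \<cdot>\<^bsub>N\<^esub> f x" and t: "t \<in> carrier TM.T"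
  shows "tensor_map R A N h t = tensor_map R A N f t [^]\<^bsub>TN.T\<^esub> k"
proof (rule TM.hom_eqI[OF tensor_map_hom[OF h] hom_powI[OF tensor_map_hom[OF f] TN.tensor_comm_group]
      TN.T.is_group _ t])
  fix a x assume ax: "a \<in> carrier A" "x \<in> carrier M"
  show "tensor_map R A N h (TM.pure a x) = tensor_map R A N f (TM.pure a x) [^]\<^bsub>TN.T\<^esub> k"
    using hom_nat_pow[OF TN.pure_hom_right[OF ax(1)], of "f x" k] ax
    by (simp add: tensor_map_pure[OF h] tensor_map_pure[OF f] eq linear_map_closed[OF f] add_pow_def
        N.add.is_group TN.T.is_group)
qed

end

lemma tensor_map_id:
  assumes "right_module R A" "left_module R M" "f \<in> linear_maps R M M"
    "\<And>x. x \<in> carrier M \<Longrightarrow> f x = x" "t \<in> carrier (tensor R A M)"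
  shows "tensor_map R A M f t = t"
proof -
  interpret tensor_functor R A M M using assms by (simp add: tensor_functor_def)
  show ?thesis
    by (rule TM.hom_eqI[OF tensor_map_hom[OF assms(3)] _ TM.T.is_group _ assms(5)])
      (simp_all add: tensor_map_pure[OF assms(3)] assms(4) hom_def)
qed

lemma tensor_map_comp:
  assumes "right_module R A" "left_module R M" "left_module R N" "left_module R L"
    and f: "f \<in> linear_maps R M N" and g: "g \<in> linear_maps R N L"
    and t: "t \<in> carrier (tensor R A M)"
  shows "tensor_map R A L g (tensor_map R A N f t) = tensor_map R A L (\<lambda>x. g (f x)) t"
proof -
  interpret f: tensor_functor R A M N using assms by (simp add: tensor_functor_def)
  interpret g: tensor_functor R A N L using assms by (simp add: tensor_functor_def)
  interpret gf: tensor_functor R A M L using assms by (simp add: tensor_functor_def)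
  note gf = linear_map_comp[OF f g]
  have "(\<lambda>t. tensor_map R A L g (tensor_map R A N f t)) \<in> hom (tensor R A M) (tensor R A L)"
    using hom_compose[OF f.tensor_map_hom[OF f] g.tensor_map_hom[OF g]] by (simp add: comp_def)
  then show ?thesis
    by (rule f.TM.hom_eqI[OF _ gf.tensor_map_hom[OF gf] g.TN.T.is_group _ t])
      (simp add: f.tensor_map_pure[OF f] g.tensor_map_pure[OF g] gf.tensor_map_pure[OF gf]
        linear_map_closed[OF f])
qed


section \<open>Modules with a dual basis\<close>

text \<open>The data of the dual basis lemma: elements \<open>b j\<close> of \<open>P\<close> and linear functionals \<open>\<phi> j\<close> that expand
  every element. They exist exactly for the projective modules, with finite \<open>J\<close> exactly for the finitely
  generated projective ones. The \<open>b j\<close> may be linearly dependent, so this treats free modules on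
  infinite sets and finitely generated projective modules alike.\<close>

definition dual_basis ::
  "('r, 'k) ring_scheme \<Rightarrow> ('r, 'q) module \<Rightarrow> 'j set \<Rightarrow> ('j \<Rightarrow> 'q) \<Rightarrow> ('j \<Rightarrow> 'q \<Rightarrow> 'r) \<Rightarrow> bool" where
  "dual_basis R P J b \<phi> \<longleftrightarrow>
    (\<forall>j\<in>J. b j \<in> carrier P) \<and>
    (\<forall>j\<in>J. \<forall>x\<in>carrier P. \<phi> j x \<in> carrier R) \<and>
    (\<forall>j\<in>J. \<forall>x\<in>carrier P. \<forall>y\<in>carrier P. \<phi> j (x \<oplus>\<^bsub>P\<^esub> y) = \<phi> j x \<oplus>\<^bsub>R\<^esub> \<phi> j y) \<and>
    (\<forall>j\<in>J. \<forall>r\<in>carrier R. \<forall>x\<in>carrier P. \<phi> j (r \<odot>\<^bsub>P\<^esub> x) = r \<otimes>\<^bsub>R\<^esub> \<phi> j x) \<and>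
    (\<forall>x\<in>carrier P. finite {j \<in> J. \<phi> j x \<noteq> \<zero>\<^bsub>R\<^esub>} \<and>
      x = (\<Oplus>\<^bsub>P\<^esub>j\<in>{j \<in> J. \<phi> j x \<noteq> \<zero>\<^bsub>R\<^esub>}. \<phi> j x \<odot>\<^bsub>P\<^esub> b j))"

context left_module
begin

lemma smult_hom: "r \<in> carrier R \<Longrightarrow> (\<lambda>x. r \<odot>\<^bsub>M\<^esub> x) \<in> hom (add_monoid M) (add_monoid M)"
  by (rule homI) (simp_all add: smult_closed smult_r_distr)

lemma smult_hom_left: "x \<in> carrier M \<Longrightarrow> (\<lambda>r. r \<odot>\<^bsub>M\<^esub> x) \<in> hom (add_monoid R) (add_monoid M)"
  by (rule homI) (simp_all add: smult_closed smult_l_distr)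

lemma smult_l_null [simp]: "x \<in> carrier M \<Longrightarrow> \<zero> \<odot>\<^bsub>M\<^esub> x = \<zero>\<^bsub>M\<^esub>"
  using hom_one[OF smult_hom_left R.add.is_group M.add.is_group] by simp

lemma smult_r_null [simp]: "r \<in> carrier R \<Longrightarrow> r \<odot>\<^bsub>M\<^esub> \<zero>\<^bsub>M\<^esub> = \<zero>\<^bsub>M\<^esub>"
  using hom_one[OF smult_hom M.add.is_group M.add.is_group] by simp

lemma smult_finsum:
  assumes "r \<in> carrier R" "f \<in> I \<rightarrow> carrier M"
  shows "r \<odot>\<^bsub>M\<^esub> (\<Oplus>\<^bsub>M\<^esub>i\<in>I. f i) = (\<Oplus>\<^bsub>M\<^esub>i\<in>I. r \<odot>\<^bsub>M\<^esub> f i)"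
  using hom_finprod[OF smult_hom[OF assms(1)] M.a_comm_group M.a_comm_group, of f I] assms(2)
  by (simp add: finsum_def)

end

lemma linear_map_finsum:
  assumes "f \<in> linear_maps R M N" "left_module R M" "left_module R N" "g \<in> I \<rightarrow> carrier M"
  shows "f (\<Oplus>\<^bsub>M\<^esub>i\<in>I. g i) = (\<Oplus>\<^bsub>N\<^esub>i\<in>I. f (g i))"
proof -
  interpret M: left_module R M by fact
  interpret N: left_module R N by fact
  show ?thesis
    using hom_finprod[OF linear_map_hom[OF assms(1)] M.a_comm_group N.a_comm_group, of g I] assms(4)
    by (simp add: finsum_def)
qed

lemma linear_map_zero:
  assumes "f \<in> linear_maps R M N" "left_module R M" "left_module R N"
  shows "f \<zero>\<^bsub>M\<^esub> = \<zero>\<^bsub>N\<^esub>"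
  using linear_map_finsum[OF assms, of undefined "{}"]
  by (metis Pi_empty UNIV_I abelian_group.axioms(1) abelian_monoid.finsum_empty assms(2,3) left_module_def)

text \<open>The functionals \<open>\<phi>\<close> embed \<open>P\<close> into the free module on \<open>J\<close>, and this is the restriction to \<open>P\<close> of the
  map of the free module that sends the basis vector \<open>j\<close> to \<open>y j\<close>.\<close>

definition dual_basis_map ::
  "('r, 'k) ring_scheme \<Rightarrow> ('r, 'n) module \<Rightarrow> 'j set \<Rightarrow> ('j \<Rightarrow> 'q \<Rightarrow> 'r) \<Rightarrow> ('j \<Rightarrow> 'n) \<Rightarrow> 'q \<Rightarrow> 'n" where
  "dual_basis_map R N J \<phi> y x = (\<Oplus>\<^bsub>N\<^esub>j\<in>{j \<in> J. \<phi> j x \<noteq> \<zero>\<^bsub>R\<^esub>}. \<phi> j x \<odot>\<^bsub>N\<^esub> y j)"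

locale dual_based_module = P: left_module R P
  for R :: "('r, 'k) ring_scheme" (structure) and P :: "('r, 'q) module" +
  fixes J :: "'j set" and b \<phi>
  assumes dual_basis: "dual_basis R P J b \<phi>"
begin

lemma basis_closed [simp]: "j \<in> J \<Longrightarrow> b j \<in> carrier P"
  and coord_closed [simp]: "\<lbrakk>j \<in> J; x \<in> carrier P\<rbrakk> \<Longrightarrow> \<phi> j x \<in> carrier R"
  and coord_add: "\<lbrakk>j \<in> J; x \<in> carrier P; y \<in> carrier P\<rbrakk> \<Longrightarrow> \<phi> j (x \<oplus>\<^bsub>P\<^esub> y) = \<phi> j x \<oplus>\<^bsub>R\<^esub> \<phi> j y"
  and coord_smult: "\<lbrakk>j \<in> J; r \<in> carrier R; x \<in> carrier P\<rbrakk> \<Longrightarrow> \<phi> j (r \<odot>\<^bsub>P\<^esub> x) = r \<otimes>\<^bsub>R\<^esub> \<phi> j x"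
  and support_finite [simp]: "x \<in> carrier P \<Longrightarrow> finite {j \<in> J. \<phi> j x \<noteq> \<zero>\<^bsub>R\<^esub>}"
  and expansion: "x \<in> carrier P \<Longrightarrow> dual_basis_map R P J \<phi> b x = x"
  using dual_basis unfolding dual_basis_def dual_basis_map_def by auto

lemma dual_basis_map_superset:
  assumes "left_module R N" "y \<in> J \<rightarrow> carrier N" "x \<in> carrier P"
    "finite I" "I \<subseteq> J" "{j \<in> J. \<phi> j x \<noteq> \<zero>\<^bsub>R\<^esub>} \<subseteq> I"
  shows "dual_basis_map R N J \<phi> y x = (\<Oplus>\<^bsub>N\<^esub>j\<in>I. \<phi> j x \<odot>\<^bsub>N\<^esub> y j)"
proof -
  interpret N: left_module R N by fact
  show ?thesis
    unfolding dual_basis_map_def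
    using assms by (intro N.add.finprod_mono_neutral_cong_left)
      (auto simp: Pi_iff subset_iff intro!: N.smult_closed)
qed

lemma dual_basis_map_linear:
  assumes "left_module R N" "y \<in> J \<rightarrow> carrier N"
  shows "dual_basis_map R N J \<phi> y \<in> linear_maps R P N"
proof (rule linear_mapsI)
  interpret N: left_module R N by fact
  have y: "y j \<in> carrier N" if "j \<in> J" for j using assms(2) that by auto
  fix x assume x: "x \<in> carrier P"
  show "dual_basis_map R N J \<phi> y x \<in> carrier N"
    unfolding dual_basis_map_def using x y by (auto intro!: N.finsum_closed N.smult_closed)
  fix x' assume x': "x' \<in> carrier P"
  let ?I = "{j \<in> J. \<phi> j x \<noteq> \<zero>} \<union> {j \<in> J. \<phi> j x' \<noteq> \<zero>}"
  have "dual_basis_map R N J \<phi> y (x \<oplus>\<^bsub>P\<^esub> x') = (\<Oplus>\<^bsub>N\<^esub>j\<in>?I. \<phi> j (x \<oplus>\<^bsub>P\<^esub> x') \<odot>\<^bsub>N\<^esub> y j)"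
    using x x' by (intro dual_basis_map_superset[OF assms]) (auto simp: coord_add)
  also have "\<dots> = (\<Oplus>\<^bsub>N\<^esub>j\<in>?I. \<phi> j x \<odot>\<^bsub>N\<^esub> y j \<oplus>\<^bsub>N\<^esub> \<phi> j x' \<odot>\<^bsub>N\<^esub> y j)"
    using x x' y by (intro N.finsum_cong') (auto simp: coord_add N.smult_l_distr intro!: N.smult_closed N.a_closed)
  also have "\<dots> = (\<Oplus>\<^bsub>N\<^esub>j\<in>?I. \<phi> j x \<odot>\<^bsub>N\<^esub> y j) \<oplus>\<^bsub>N\<^esub> (\<Oplus>\<^bsub>N\<^esub>j\<in>?I. \<phi> j x' \<odot>\<^bsub>N\<^esub> y j)"
    using x x' y by (intro N.finsum_addf) (auto intro!: N.smult_closed)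
  also have "\<dots> = dual_basis_map R N J \<phi> y x \<oplus>\<^bsub>N\<^esub> dual_basis_map R N J \<phi> y x'"
    using x x' dual_basis_map_superset[OF assms x, of ?I] dual_basis_map_superset[OF assms x', of ?I]
    by auto
  finally show "dual_basis_map R N J \<phi> y (x \<oplus>\<^bsub>P\<^esub> x') =
    dual_basis_map R N J \<phi> y x \<oplus>\<^bsub>N\<^esub> dual_basis_map R N J \<phi> y x'" .
next
  interpret N: left_module R N by fact
  have y: "y j \<in> carrier N" if "j \<in> J" for j using assms(2) that by auto
  fix r x assume r: "r \<in> carrier R" and x: "x \<in> carrier P"
  let ?I = "{j \<in> J. \<phi> j x \<noteq> \<zero>}"
  have "dual_basis_map R N J \<phi> y (r \<odot>\<^bsub>P\<^esub> x) = (\<Oplus>\<^bsub>N\<^esub>j\<in>?I. \<phi> j (r \<odot>\<^bsub>P\<^esub> x) \<odot>\<^bsub>N\<^esub> y j)"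
    using x r by (intro dual_basis_map_superset[OF assms]) (auto simp: coord_smult P.smult_closed)
  also have "\<dots> = (\<Oplus>\<^bsub>N\<^esub>j\<in>?I. r \<odot>\<^bsub>N\<^esub> (\<phi> j x \<odot>\<^bsub>N\<^esub> y j))"
    using x r y by (intro N.finsum_cong') (auto simp: coord_smult N.smult_assoc1 intro!: N.smult_closed)
  also have "\<dots> = r \<odot>\<^bsub>N\<^esub> dual_basis_map R N J \<phi> y x"
    unfolding dual_basis_map_def using x r y by (intro N.smult_finsum[symmetric]) (auto intro!: N.smult_closed)
  finally show "dual_basis_map R N J \<phi> y (r \<odot>\<^bsub>P\<^esub> x) = r \<odot>\<^bsub>N\<^esub> dual_basis_map R N J \<phi> y x" .
qed

lemma linear_map_expansion:
  assumes "left_module R N" "f \<in> linear_maps R P N" "x \<in> carrier P"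
  shows "f x = dual_basis_map R N J \<phi> (\<lambda>j. f (b j)) x"
proof -
  interpret N: left_module R N by fact
  let ?I = "{j \<in> J. \<phi> j x \<noteq> \<zero>}"
  have "f x = f (dual_basis_map R P J \<phi> b x)" using expansion[OF assms(3)] by simp
  also have "\<dots> = (\<Oplus>\<^bsub>N\<^esub>j\<in>?I. f (\<phi> j x \<odot>\<^bsub>P\<^esub> b j))"
    unfolding dual_basis_map_def
    using assms by (intro linear_map_finsum[OF assms(2) P.left_module_axioms assms(1)])
      (auto intro!: P.smult_closed)
  also have "\<dots> = dual_basis_map R N J \<phi> (\<lambda>j. f (b j)) x"
    unfolding dual_basis_map_def using assms(3)
    by (intro N.finsum_cong') (auto simp: linear_mapsD[OF assms(2)] intro!: N.smult_closed)
  finally show ?thesis .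
qed

text \<open>Choose preimages \<open>y j\<close> of the elements \<open>f (b j)\<close>. The map built from them need not send \<open>b j\<close> to \<open>y j\<close>,
  but its composite with \<open>g\<close> has the same expansion as \<open>f\<close>.\<close>

lemma lifting:
  assumes "left_module R N" "left_module R C" "g \<in> linear_maps R N C" "f \<in> linear_maps R P C"
    "\<And>x. x \<in> carrier P \<Longrightarrow> f x \<in> g ` carrier N"
  obtains h where "h \<in> linear_maps R P N" "\<And>x. x \<in> carrier P \<Longrightarrow> g (h x) = f x"
proof -
  interpret N: left_module R N by fact
  interpret C: left_module R C by fact
  have "\<forall>j\<in>J. \<exists>y. y \<in> carrier N \<and> g y = f (b j)" using assms(5) basis_closed by (metis imageE)
  then obtain y where y: "\<And>j. j \<in> J \<Longrightarrow> y j \<in> carrier N \<and> g (y j) = f (b j)" by metis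
  show thesis
  proof (rule that)
    show h: "dual_basis_map R N J \<phi> y \<in> linear_maps R P N"
      using dual_basis_map_linear[OF assms(1)] y by auto
    fix x assume x: "x \<in> carrier P"
    have "g (dual_basis_map R N J \<phi> y x) = (\<Oplus>\<^bsub>C\<^esub>j\<in>{j \<in> J. \<phi> j x \<noteq> \<zero>}. g (\<phi> j x \<odot>\<^bsub>N\<^esub> y j))"
      unfolding dual_basis_map_def
      using x y by (intro linear_map_finsum[OF assms(3,1,2)]) (auto intro!: N.smult_closed)
    also have "\<dots> = dual_basis_map R C J \<phi> (\<lambda>j. f (b j)) x"
      unfolding dual_basis_map_def using x y
      by (intro C.finsum_cong')
        (auto simp: linear_mapsD[OF assms(3)] linear_map_closed[OF assms(4)] intro!: C.smult_closed)
    also have "\<dots> = f x" using linear_map_expansion[OF assms(2,4) x] by simp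
    finally show "g (dual_basis_map R N J \<phi> y x) = f x" .
  qed
qed

end

locale finite_dual_based_tensor = dual_based_module R P J b \<phi> + A: right_module R A
  for R :: "('r, 'k) ring_scheme" (structure) and P :: "('r, 'q) module" and J :: "'j set" and b \<phi>
    and A :: "('r, 'a) module" +
  assumes finite_J: "finite J"
begin

sublocale tensor_product R A P by unfold_locales

notation pure (infixl \<open>\<otimes>\<^sub>t\<close> 75)

definition coordinate :: "'j \<Rightarrow> ('a \<times> 'q \<Rightarrow>\<^sub>0 int) set \<Rightarrow> 'a" where
  "coordinate j = tensor_lift (add_monoid A) (\<lambda>a x. \<phi> j x \<odot>\<^bsub>A\<^esub> a)"

lemma coordinate_balanced: "j \<in> J \<Longrightarrow> balanced R A P (add_monoid A) (\<lambda>a x. \<phi> j x \<odot>\<^bsub>A\<^esub> a)"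
  by (rule balancedI)
    (simp_all add: A.act_closed A.act_add A.act_add_scalar coord_add coord_smult A.act_mult)

lemma coordinate_hom: "j \<in> J \<Longrightarrow> coordinate j \<in> hom T (add_monoid A)"
  and coordinate_pure: "\<lbrakk>j \<in> J; a \<in> carrier A; x \<in> carrier P\<rbrakk> \<Longrightarrow> coordinate j (a \<otimes>\<^sub>t x) = \<phi> j x \<odot>\<^bsub>A\<^esub> a"
  unfolding coordinate_def using tensor_lift[OF A.a_comm_group coordinate_balanced] by auto

lemma coordinate_closed: "\<lbrakk>j \<in> J; t \<in> carrier T\<rbrakk> \<Longrightarrow> coordinate j t \<in> carrier A"
  using hom_in_carrier[OF coordinate_hom] by simp

text \<open>The coordinates exhibit \<open>A \<otimes> P\<close> as a direct summand of a finite power of \<open>A\<close>. In this way properties of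
  \<open>A\<close> pass to \<open>A \<otimes> P\<close>.\<close>

lemma tensor_expansion:
  assumes t: "t \<in> carrier T"
  shows "t = (\<Otimes>\<^bsub>T\<^esub>j\<in>J. coordinate j t \<otimes>\<^sub>t b j)"
proof (rule hom_eqI[OF _ hom_finprodI T.is_group _ t])
  show "(\<lambda>t. t) \<in> hom T T" by (simp add: hom_def)
  show "(\<lambda>t. coordinate j t \<otimes>\<^sub>t b j) \<in> hom T T" if "j \<in> J" for j
    using hom_compose[OF coordinate_hom[OF that] pure_hom_left[of "b j"]] that by (simp add: comp_def)
  show "comm_group T" by (rule tensor_comm_group)
  fix a x assume ax: "a \<in> carrier A" "x \<in> carrier P"
  have "a \<otimes>\<^sub>t x = a \<otimes>\<^sub>t (\<Oplus>\<^bsub>P\<^esub>j\<in>J. \<phi> j x \<odot>\<^bsub>P\<^esub> b j)"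
    using expansion[OF ax(2)] dual_basis_map_superset[OF P.left_module_axioms _ ax(2) finite_J]
    by (simp add: Pi_iff)
  also have "\<dots> = (\<Otimes>\<^bsub>T\<^esub>j\<in>J. a \<otimes>\<^sub>t (\<phi> j x \<odot>\<^bsub>P\<^esub> b j))"
    unfolding finsum_def using ax
    by (intro hom_finprod[OF pure_hom_right[OF ax(1)] P.a_comm_group tensor_comm_group])
      (auto intro!: P.smult_closed)
  also have "\<dots> = (\<Otimes>\<^bsub>T\<^esub>j\<in>J. coordinate j (a \<otimes>\<^sub>t x) \<otimes>\<^sub>t b j)"
    using ax by (intro T.finprod_cong')
      (auto simp: coordinate_pure pure_balanced A.act_closed P.smult_closed)
  finally show "a \<otimes>\<^sub>t x = (\<Otimes>\<^bsub>T\<^esub>j\<in>J. coordinate j (a \<otimes>\<^sub>t x) \<otimes>\<^sub>t b j)" .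
qed

lemma tensor_eq_one:
  assumes "t \<in> carrier T" "\<And>j. j \<in> J \<Longrightarrow> coordinate j t = \<zero>\<^bsub>A\<^esub>"
  shows "t = \<one>\<^bsub>T\<^esub>"
  using tensor_expansion[OF assms(1)] assms(2) by (simp cong: T.finprod_cong)

end

section \<open>Multiples and differences of linear maps\<close>

lemma (in left_module) smult_r_minus:
  "\<lbrakk>r \<in> carrier R; x \<in> carrier M\<rbrakk> \<Longrightarrow> r \<odot>\<^bsub>M\<^esub> (\<ominus>\<^bsub>M\<^esub> x) = \<ominus>\<^bsub>M\<^esub> (r \<odot>\<^bsub>M\<^esub> x)"
  using group_hom.hom_inv[of "add_monoid M" "add_monoid M" "\<lambda>x. r \<odot>\<^bsub>M\<^esub> x" x] smult_hom[of r]
  by (simp add: group_hom_def group_hom_axioms_def M.add.is_group a_inv_def)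

lemma (in left_module) smult_nat_mult:
  "\<lbrakk>r \<in> carrier R; x \<in> carrier M\<rbrakk> \<Longrightarrow> r \<odot>\<^bsub>M\<^esub> ([(k::nat)] \<cdot>\<^bsub>M\<^esub> x) = [k] \<cdot>\<^bsub>M\<^esub> (r \<odot>\<^bsub>M\<^esub> x)"
  using hom_nat_pow[OF smult_hom, of r x k] by (simp add: add_pow_def M.add.is_group)

lemma linear_map_nat_mult:
  assumes "f \<in> linear_maps R M N" "left_module R M" "left_module R N" "x \<in> carrier M"
  shows "f ([(k::nat)] \<cdot>\<^bsub>M\<^esub> x) = [k] \<cdot>\<^bsub>N\<^esub> f x"
proof -
  interpret M: left_module R M by fact
  interpret N: left_module R N by fact
  show ?thesis
    using hom_nat_pow[OF linear_map_hom[OF assms(1)], of x k] assms(4)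
    by (simp add: add_pow_def M.M.add.is_group N.M.add.is_group)
qed

lemma linear_map_minus:
  assumes "f \<in> linear_maps R M N" "left_module R M" "left_module R N" "x \<in> carrier M"
  shows "f (\<ominus>\<^bsub>M\<^esub> x) = \<ominus>\<^bsub>N\<^esub> f x"
proof -
  interpret M: left_module R M by fact
  interpret N: left_module R N by fact
  show ?thesis
    using group_hom.hom_inv[of "add_monoid M" "add_monoid N" f x] linear_map_hom[OF assms(1)] assms(4)
    by (simp add: group_hom_def group_hom_axioms_def M.M.add.is_group N.M.add.is_group a_inv_def)
qed

lemma linear_map_diff:
  assumes "f \<in> linear_maps R M N" "left_module R M" "left_module R N"
    "x \<in> carrier M" "y \<in> carrier M"
  shows "f (x \<ominus>\<^bsub>M\<^esub> y) = f x \<ominus>\<^bsub>N\<^esub> f y"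
proof -
  interpret M: left_module R M by fact
  show ?thesis
    using assms by (simp add: a_minus_def linear_map_add[OF assms(1)] linear_map_minus[OF assms(1-3)])
qed

lemma linear_maps_diffI:
  assumes "f \<in> linear_maps R M N" "g \<in> linear_maps R M N" "left_module R N"
  shows "(\<lambda>x. f x \<ominus>\<^bsub>N\<^esub> g x) \<in> linear_maps R M N"
proof -
  interpret N: left_module R N by fact
  show ?thesis
    by (rule linear_mapsI)
      (simp_all add: linear_mapsD[OF assms(1)] linear_mapsD[OF assms(2)] a_minus_def
        N.smult_r_minus N.smult_r_distr N.smult_closed N.minus_add N.a_ac)
qed

lemma linear_maps_nat_multI:
  assumes "f \<in> linear_maps R M N" "left_module R N"
  shows "(\<lambda>x. [(k::nat)] \<cdot>\<^bsub>N\<^esub> f x) \<in> linear_maps R M N"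
proof -
  interpret N: left_module R N by fact
  show ?thesis
    by (rule linear_mapsI)
      (simp_all add: linear_mapsD[OF assms(1)] N.smult_nat_mult N.add.nat_pow_distrib)
qed

lemma linear_maps_id: "(\<lambda>x. x) \<in> linear_maps R M M"
  by (rule linear_mapsI) simp_all


section \<open>Comparison of resolutions\<close>

text \<open>Resolutions extend indefinitely to the left, so that the canonical resolution and finite ones, padded
  with zero modules, are instances of the same notion. Projectivity is a separate condition, imposed
  on the source of a comparison map.\<close>

locale resolution = M: left_module R M
  for R :: "('r, 'k) ring_scheme" (structure) and M :: "('r, 'm) module" +
  fixes P :: "nat \<Rightarrow> ('r, 'q) module" and \<delta> \<eta>
  assumes modules: "left_module R (P i)"
    and boundary_linear: "\<delta> i \<in> linear_maps R (P (Suc i)) (P i)"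
    and augmentation_linear: "\<eta> \<in> linear_maps R (P 0) M"
    and augmentation_surj: "\<eta> ` carrier (P 0) = carrier M"
    and exact_zero: "{x \<in> carrier (P 0). \<eta> x = \<zero>\<^bsub>M\<^esub>} = \<delta> 0 ` carrier (P (Suc 0))"
    and exact_Suc: "{x \<in> carrier (P (Suc i)). \<delta> i x = \<zero>\<^bsub>P i\<^esub>} = \<delta> (Suc i) ` carrier (P (Suc (Suc i)))"
begin

lemma augmentation_boundary: "x \<in> carrier (P (Suc 0)) \<Longrightarrow> \<eta> (\<delta> 0 x) = \<zero>\<^bsub>M\<^esub>"
  using exact_zero by auto

lemma boundary_boundary: "x \<in> carrier (P (Suc (Suc i))) \<Longrightarrow> \<delta> i (\<delta> (Suc i) x) = \<zero>\<^bsub>P i\<^esub>"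
  using exact_Suc[of i] by auto

end

locale based_resolution = resolution R M P \<delta> \<eta>
  for R :: "('r, 'k) ring_scheme" (structure) and M :: "('r, 'm) module"
    and P :: "nat \<Rightarrow> ('r, 'q) module" and \<delta> \<eta> +
  fixes J :: "nat \<Rightarrow> 'j set" and b \<phi>
  assumes dual_bases: "dual_basis R (P i) (J i) (b i) (\<phi> i)"
begin

lemma dual_based: "dual_based_module R (P i) (J i) (b i) (\<phi> i)"
  using modules dual_bases by (simp add: dual_based_module_def dual_based_module_axioms_def)

lemmas lifting_at = dual_based_module.lifting[OF dual_based]

end

locale resolution_pair = X: based_resolution R M X dX eX J b \<phi> + Y: resolution R N Y dY eY
  for R :: "('r, 'k) ring_scheme" (structure) and M :: "('r, 'm) module"
    and X :: "nat \<Rightarrow> ('r, 'x) module" and dX eX and J :: "nat \<Rightarrow> 'j set" and b \<phi>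
    and N :: "('r, 'n) module" and Y :: "nat \<Rightarrow> ('r, 'y) module" and dY eY
begin

text \<open>The lift is constructed degree by degree. The invariant that \<open>f n\<close> maps boundaries to boundaries is
  what makes the next lifting problem solvable, and it is inherited because \<open>Y\<close> is exact.\<close>

lemma chain_map_lift:
  assumes \<psi>: "\<psi> \<in> linear_maps R M N"
  obtains f where "\<And>i. f i \<in> linear_maps R (X i) (Y i)"
    and "\<And>x. x \<in> carrier (X 0) \<Longrightarrow> eY (f 0 x) = \<psi> (eX x)"
    and "\<And>i x. x \<in> carrier (X (Suc i)) \<Longrightarrow> dY i (f (Suc i) x) = f i (dX i x)"
proof -
  let ?P = "\<lambda>n f. f \<in> linear_maps R (X n) (Y n) \<and>
    (\<forall>z\<in>carrier (X (Suc n)). f (dX n z) \<in> dY n ` carrier (Y (Suc n))) \<and>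
    (n = 0 \<longrightarrow> (\<forall>x\<in>carrier (X 0). eY (f x) = \<psi> (eX x)))"
  let ?Q = "\<lambda>n f f'. \<forall>x\<in>carrier (X (Suc n)). dY n (f' x) = f (dX n x)"
  have "\<exists>f. \<forall>n. ?P n (f n) \<and> ?Q n (f n) (f (Suc n))"
  proof (rule dependent_nat_choice)
    have in_im: "\<psi> (eX x) \<in> eY ` carrier (Y 0)" if "x \<in> carrier (X 0)" for x
      using that Y.augmentation_surj linear_map_closed[OF X.augmentation_linear] linear_map_closed[OF \<psi>]
      by auto
    obtain f where f: "f \<in> linear_maps R (X 0) (Y 0)" "\<And>x. x \<in> carrier (X 0) \<Longrightarrow> eY (f x) = \<psi> (eX x)"
      using X.lifting_at[OF Y.modules Y.M.left_module_axioms Y.augmentation_linear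
          linear_map_comp[OF X.augmentation_linear \<psi>] in_im] by blast
    have "f (dX 0 z) \<in> dY 0 ` carrier (Y (Suc 0))" if z: "z \<in> carrier (X (Suc 0))" for z
    proof -
      have "eY (f (dX 0 z)) = \<zero>\<^bsub>N\<^esub>"
        using f(2)[OF linear_map_closed[OF X.boundary_linear z]] X.augmentation_boundary[OF z]
          linear_map_zero[OF \<psi> X.M.left_module_axioms Y.M.left_module_axioms] by simp
      then show ?thesis
        using Y.exact_zero linear_map_closed[OF f(1) linear_map_closed[OF X.boundary_linear z]] by auto
    qed
    with f show "\<exists>f. ?P 0 f" by auto
  next
    fix f n assume "?P n f"
    then have f: "f \<in> linear_maps R (X n) (Y n)"
      "\<And>z. z \<in> carrier (X (Suc n)) \<Longrightarrow> f (dX n z) \<in> dY n ` carrier (Y (Suc n))" by auto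
    obtain f' where f': "f' \<in> linear_maps R (X (Suc n)) (Y (Suc n))"
      "\<And>x. x \<in> carrier (X (Suc n)) \<Longrightarrow> dY n (f' x) = f (dX n x)"
      using X.lifting_at[OF Y.modules Y.modules Y.boundary_linear
          linear_map_comp[OF X.boundary_linear f(1)] f(2)] by blast
    have "f' (dX (Suc n) z) \<in> dY (Suc n) ` carrier (Y (Suc (Suc n)))"
      if z: "z \<in> carrier (X (Suc (Suc n)))" for z
    proof -
      have "dY n (f' (dX (Suc n) z)) = \<zero>\<^bsub>Y n\<^esub>"
        using f'(2)[OF linear_map_closed[OF X.boundary_linear z]] X.boundary_boundary[OF z]
          linear_map_zero[OF f(1) X.modules Y.modules] by simp
      then show ?thesis
        using Y.exact_Suc[of n] linear_map_closed[OF f'(1) linear_map_closed[OF X.boundary_linear z]] by auto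
    qed
    with f' show "\<exists>f'. ?P (Suc n) f' \<and> ?Q n f f'" by auto
  qed
  then show thesis using that by blast
qed

text \<open>If \<open>w n \<circ> d = d \<circ> h n \<circ> d\<close>, then \<open>w (n + 1) - h n \<circ> d\<close> takes its values in the cycles of \<open>Y\<close>, which
  are boundaries, and lifts to \<open>h (n + 1)\<close>; the equation for \<open>n + 1\<close> follows from \<open>d \<circ> d = 0\<close>.\<close>

lemma null_homotopy:
  assumes w: "\<And>i. w i \<in> linear_maps R (X i) (Y i)"
    and w0: "\<And>x. x \<in> carrier (X 0) \<Longrightarrow> eY (w 0 x) = \<zero>\<^bsub>N\<^esub>"
    and comm: "\<And>i x. x \<in> carrier (X (Suc i)) \<Longrightarrow> dY i (w (Suc i) x) = w i (dX i x)"
  obtains h where "\<And>i. h i \<in> linear_maps R (X i) (Y (Suc i))"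
    and "\<And>x. x \<in> carrier (X 0) \<Longrightarrow> w 0 x = dY 0 (h 0 x)"
    and "\<And>i x. x \<in> carrier (X (Suc i)) \<Longrightarrow> w (Suc i) x = dY (Suc i) (h (Suc i) x) \<oplus>\<^bsub>Y (Suc i)\<^esub> h i (dX i x)"
proof -
  let ?P = "\<lambda>n h. h \<in> linear_maps R (X n) (Y (Suc n)) \<and>
    (\<forall>z\<in>carrier (X (Suc n)). dY n (h (dX n z)) = w n (dX n z)) \<and>
    (n = 0 \<longrightarrow> (\<forall>x\<in>carrier (X 0). dY 0 (h x) = w 0 x))"
  let ?Q = "\<lambda>n h h'. \<forall>x\<in>carrier (X (Suc n)). dY (Suc n) (h' x) = w (Suc n) x \<ominus>\<^bsub>Y (Suc n)\<^esub> h (dX n x)"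
  have "\<exists>h. \<forall>n. ?P n (h n) \<and> ?Q n (h n) (h (Suc n))"
  proof (rule dependent_nat_choice)
    have in_im: "w 0 x \<in> dY 0 ` carrier (Y (Suc 0))" if "x \<in> carrier (X 0)" for x
      using that w0[OF that] Y.exact_zero linear_map_closed[OF w that] by auto
    obtain h where h: "h \<in> linear_maps R (X 0) (Y (Suc 0))" "\<And>x. x \<in> carrier (X 0) \<Longrightarrow> dY 0 (h x) = w 0 x"
      using X.lifting_at[OF Y.modules Y.modules Y.boundary_linear w in_im] by blast
    then show "\<exists>h. ?P 0 h" using linear_map_closed[OF X.boundary_linear] by auto
  next
    fix h n assume "?P n h"
    then have h: "h \<in> linear_maps R (X n) (Y (Suc n))"
      "\<And>z. z \<in> carrier (X (Suc n)) \<Longrightarrow> dY n (h (dX n z)) = w n (dX n z)" by auto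
    interpret Yn: left_module R "Y n" by (rule Y.modules)
    interpret Yn1: left_module R "Y (Suc n)" by (rule Y.modules)
    let ?g = "\<lambda>x. w (Suc n) x \<ominus>\<^bsub>Y (Suc n)\<^esub> h (dX n x)"
    have hd: "(\<lambda>x. h (dX n x)) \<in> linear_maps R (X (Suc n)) (Y (Suc n))"
      by (rule linear_map_comp[OF X.boundary_linear h(1)])
    have g: "?g \<in> linear_maps R (X (Suc n)) (Y (Suc n))"
      by (rule linear_maps_diffI[OF w hd Y.modules])
    have "?g x \<in> dY (Suc n) ` carrier (Y (Suc (Suc n)))" if x: "x \<in> carrier (X (Suc n))" for x
    proof -
      have "dY n (?g x) = dY n (w (Suc n) x) \<ominus>\<^bsub>Y n\<^esub> dY n (h (dX n x))"
        by (rule linear_map_diff[OF Y.boundary_linear Y.modules Y.modules linear_map_closed[OF w x]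
              linear_map_closed[OF hd x]])
      also have "\<dots> = \<zero>\<^bsub>Y n\<^esub>"
        using comm[OF x] h(2)[OF x] linear_map_closed[OF w linear_map_closed[OF X.boundary_linear x]]
        by (simp add: a_minus_def Yn.r_neg)
      finally show ?thesis
        using Y.exact_Suc[of n] linear_map_closed[OF g x] by auto
    qed
    then obtain h' where h': "h' \<in> linear_maps R (X (Suc n)) (Y (Suc (Suc n)))"
      "\<And>x. x \<in> carrier (X (Suc n)) \<Longrightarrow> dY (Suc n) (h' x) = ?g x"
      using X.lifting_at[OF Y.modules Y.modules Y.boundary_linear g] by blast
    have "dY (Suc n) (h' (dX (Suc n) z)) = w (Suc n) (dX (Suc n) z)" if z: "z \<in> carrier (X (Suc (Suc n)))" for z
      using h'(2)[OF linear_map_closed[OF X.boundary_linear z]] X.boundary_boundary[OF z]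
        linear_map_zero[OF h(1) X.modules Y.modules] linear_map_closed[OF w linear_map_closed[OF X.boundary_linear z]]
      by (simp add: a_minus_def)
    with h' show "\<exists>h'. ?P (Suc n) h' \<and> ?Q n h h'" by auto
  qed
  then obtain h where h: "\<And>n. h n \<in> linear_maps R (X n) (Y (Suc n))"
    "\<And>x. x \<in> carrier (X 0) \<Longrightarrow> dY 0 (h 0 x) = w 0 x"
    "\<And>n x. x \<in> carrier (X (Suc n)) \<Longrightarrow> dY (Suc n) (h (Suc n) x) = w (Suc n) x \<ominus>\<^bsub>Y (Suc n)\<^esub> h n (dX n x)"
    by blast
  show thesis
  proof (rule that[OF h(1)])
    show "w 0 x = dY 0 (h 0 x)" if "x \<in> carrier (X 0)" for x using h(2)[OF that] by simp
    fix i x assume x: "x \<in> carrier (X (Suc i))"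
    interpret Yi: left_module R "Y (Suc i)" by (rule Y.modules)
    show "w (Suc i) x = dY (Suc i) (h (Suc i) x) \<oplus>\<^bsub>Y (Suc i)\<^esub> h i (dX i x)"
      using h(3)[OF x] linear_map_closed[OF w x] linear_map_closed[OF h(1) linear_map_closed[OF X.boundary_linear x]]
      by (simp add: a_minus_def Yi.a_assoc Yi.l_neg)
  qed
qed

end

section \<open>Reduced and summable groups\<close>

text \<open>A sequence of successive \<open>p\<close>-th roots is the same as a homomorphism from \<open>\<int>[1/p]\<close> to \<open>G\<close>, so the
  condition means \<open>Hom(\<int>[1/p], G) = 0\<close>.\<close>

definition p_reduced :: "nat \<Rightarrow> ('g, 'e) monoid_scheme \<Rightarrow> bool" where
  "p_reduced p G \<longleftrightarrow>
    (\<forall>D. (\<forall>k. D k \<in> carrier G \<and> D k = D (Suc k) [^]\<^bsub>G\<^esub> p) \<longrightarrow> D (0::nat) = \<one>\<^bsub>G\<^esub>)"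

text \<open>In additive notation \<open>w k\<close> is a value of the series \<open>\<Sum>\<^sub>i p\<^sup>i e (k + i)\<close>. Recording only the relation between
  consecutive tails avoids any topology on \<open>G\<close>; the condition means \<open>Ext\<^sup>1(\<int>[1/p], G) = 0\<close>. Groups that are
  both reduced and summable are those which are derived \<open>p\<close>-complete.\<close>

definition p_summable :: "nat \<Rightarrow> ('g, 'e) monoid_scheme \<Rightarrow> bool" where
  "p_summable p G \<longleftrightarrow>
    (\<forall>e. (\<forall>k::nat. e k \<in> carrier G) \<longrightarrow>
      (\<exists>w. \<forall>k. w k \<in> carrier G \<and> w k = e k \<otimes>\<^bsub>G\<^esub> w (Suc k) [^]\<^bsub>G\<^esub> p))"

lemma p_reducedD:
  "\<lbrakk>p_reduced p G; \<And>k. D k \<in> carrier G; \<And>k. D k = D (Suc k) [^]\<^bsub>G\<^esub> p\<rbrakk> \<Longrightarrow> D (0::nat) = \<one>\<^bsub>G\<^esub>"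
  unfolding p_reduced_def by blast

lemma p_summableE:
  assumes "p_summable p G" "\<And>k::nat. e k \<in> carrier G"
  obtains w where "\<And>k. w k \<in> carrier G" "\<And>k. w k = e k \<otimes>\<^bsub>G\<^esub> w (Suc k) [^]\<^bsub>G\<^esub> p"
  using assms unfolding p_summable_def by blast

context comm_group
begin

lemma cancel_common_factor:
  assumes "a \<in> carrier G" "x \<in> carrier G" "y \<in> carrier G"
  shows "(a \<otimes> x [^] (p::nat)) \<otimes> inv (a \<otimes> y [^] p) = (x \<otimes> inv y) [^] p"
  using assms by (simp add: nat_pow_distrib inv_mult nat_pow_inv m_ac) (simp add: m_assoc[symmetric])

text \<open>If \<open>t = p u t\<close>, then the elements \<open>u\<^sup>k t\<close> are successive \<open>p\<close>-th roots, starting with \<open>t\<close>.\<close>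

lemma one_minus_p_injective:
  assumes "p_reduced p G" "u \<in> hom G G" "t \<in> carrier G" "t = u t [^] p"
  shows "t = \<one>"
proof -
  have cl: "(u ^^ k) t \<in> carrier G" for k
    by (induction k) (auto simp: assms(3) hom_in_carrier[OF assms(2)])
  have "(u ^^ k) t = (u ^^ Suc k) t [^] p" for k
  proof (induction k)
    case (Suc k)
    have "(u ^^ Suc k) t = u ((u ^^ Suc k) t [^] p)" by (subst Suc[symmetric]) simp
    also have "\<dots> = u ((u ^^ Suc k) t) [^] p" by (rule hom_nat_pow[OF assms(2) cl is_group is_group])
    finally show ?case by simp
  qed (simp add: assms(4)[symmetric])
  then have "(u ^^ 0) t = \<one>"
    using p_reducedD[OF assms(1), of "\<lambda>k. (u ^^ k) t"] cl by blast
  then show ?thesis by simp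
qed

text \<open>The solution is a value of the Neumann series \<open>\<Sum>\<^sub>k p\<^sup>k u\<^sup>k t\<close>. Values of series are not unique a priori,
  but the defect in the equation has all successive \<open>p\<close>-th roots and hence vanishes.\<close>

lemma one_minus_p_surjective:
  assumes "p_reduced p G" "p_summable p G" "u \<in> hom G G" "t \<in> carrier G"
  obtains s where "s \<in> carrier G" "s = t \<otimes> u s [^] p"
proof -
  have cl: "(u ^^ k) t \<in> carrier G" for k
    by (induction k) (auto simp: assms(4) hom_in_carrier[OF assms(3)])
  obtain w where w: "\<And>k. w k \<in> carrier G" "\<And>k. w k = (u ^^ k) t \<otimes> w (Suc k) [^] p"
    using p_summableE[OF assms(2), of "\<lambda>k. (u ^^ k) t"] cl by metis
  have uw: "u (w k) \<in> carrier G" for k using w(1) hom_in_carrier[OF assms(3)] by blast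
  \<comment> \<open>Both \<open>w (k + 1)\<close> and \<open>u (w k)\<close> sum the shifted series.\<close>
  define D where "D k = w (Suc k) \<otimes> inv (u (w k))" for k
  have "D k = D (Suc k) [^] p" for k
  proof -
    have "u (w k) = u ((u ^^ k) t) \<otimes> u (w (Suc k)) [^] p"
      using w(2)[of k] cl w(1) by (metis assms(3) hom_mult hom_nat_pow is_group nat_pow_closed)
    moreover have "w (Suc k) = u ((u ^^ k) t) \<otimes> w (Suc (Suc k)) [^] p" using w(2)[of "Suc k"] by simp
    moreover have "u ((u ^^ k) t) \<in> carrier G" using cl[of "Suc k"] by simp
    ultimately show ?thesis
      unfolding D_def using w(1) uw cancel_common_factor by metis
  qed
  moreover have "D k \<in> carrier G" for k using w(1) uw by (simp add: D_def)
  ultimately have "D 0 = \<one>" using p_reducedD[OF assms(1), of D] by blast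
  then have "w (Suc 0) = u (w 0)"
    using w(1) uw inv_solve_right'[of \<one> "w (Suc 0)" "u (w 0)"] by (simp add: D_def)
  then have "w 0 = t \<otimes> u (w 0) [^] p" using w(2)[of 0] by simp
  with w(1) show thesis by (rule that)
qed

end

context finite_dual_based_tensor
begin

lemma tensor_p_reduced:
  assumes "p_reduced p (add_monoid A)"
  shows "p_reduced p T"
  unfolding p_reduced_def
proof (intro allI impI)
  fix D assume D: "\<forall>k. D k \<in> carrier T \<and> D k = D (Suc k) [^]\<^bsub>T\<^esub> p"
  then have D_closed: "D k \<in> carrier T" for k by blast
  have "coordinate j (D 0) = \<zero>\<^bsub>A\<^esub>" if j: "j \<in> J" for j
  proof -
    have "coordinate j (D k) = coordinate j (D (Suc k)) [^]\<^bsub>add_monoid A\<^esub> p" for k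
      using D hom_nat_pow[OF coordinate_hom[OF j] _ T.is_group A.A.a_group] by metis
    moreover have "coordinate j (D k) \<in> carrier (add_monoid A)" for k
      using D_closed j coordinate_closed by simp
    ultimately have "coordinate j (D 0) = \<one>\<^bsub>add_monoid A\<^esub>"
      using p_reducedD[OF assms, of "\<lambda>k. coordinate j (D k)"] by blast
    then show ?thesis by simp
  qed
  then show "D 0 = \<one>\<^bsub>T\<^esub>" using D_closed tensor_eq_one by blast
qed

text \<open>Sum the series of the coordinates in \<open>A\<close>, and expand with the resulting tails.\<close>

lemma tensor_p_summable:
  assumes "p_summable p (add_monoid A)"
  shows "p_summable p T"
  unfolding p_summable_def
proof (intro allI impI)
  fix e assume e: "\<forall>k::nat. e k \<in> carrier T"
  have "\<exists>w. (\<forall>k. w k \<in> carrier A) \<and> (\<forall>k. w k = coordinate j (e k) \<oplus>\<^bsub>A\<^esub> [p] \<cdot>\<^bsub>A\<^esub> w (Suc k))"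
    if "j \<in> J" for j
  proof -
    have "coordinate j (e k) \<in> carrier (add_monoid A)" for k
      using e coordinate_closed[OF that] by simp
    then obtain w where "\<And>k. w k \<in> carrier (add_monoid A)"
      "\<And>k. w k = coordinate j (e k) \<otimes>\<^bsub>add_monoid A\<^esub> w (Suc k) [^]\<^bsub>add_monoid A\<^esub> p"
      using p_summableE[OF assms, of "\<lambda>k. coordinate j (e k)"] by blast
    then show ?thesis
      unfolding add_pow_def monoid.simps partial_object.simps by blast
  qed
  then have "\<forall>j\<in>J. \<exists>w. (\<forall>k. w k \<in> carrier A) \<and> (\<forall>k. w k = coordinate j (e k) \<oplus>\<^bsub>A\<^esub> [p] \<cdot>\<^bsub>A\<^esub> w (Suc k))"
    by blast
  from bchoice[OF this] obtain w where w: "\<And>j k. j \<in> J \<Longrightarrow> w j k \<in> carrier A"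
    "\<And>j k. j \<in> J \<Longrightarrow> w j k = coordinate j (e k) \<oplus>\<^bsub>A\<^esub> [p] \<cdot>\<^bsub>A\<^esub> w j (Suc k)"
    by blast
  let ?w = "\<lambda>k. \<Otimes>\<^bsub>T\<^esub>j\<in>J. w j k \<otimes>\<^sub>t b j"
  have "?w k \<in> carrier T \<and> ?w k = e k \<otimes>\<^bsub>T\<^esub> ?w (Suc k) [^]\<^bsub>T\<^esub> p" for k
  proof
    show "?w k \<in> carrier T" using w(1) by (auto intro!: T.finprod_closed)
    have pw: "[p] \<cdot>\<^bsub>A\<^esub> w j k \<otimes>\<^sub>t b j = (w j k \<otimes>\<^sub>t b j) [^]\<^bsub>T\<^esub> p" if "j \<in> J" for j k
      using hom_nat_pow[OF pure_hom_left[of "b j"], of "w j k" p] w(1) that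
      by (simp add: add_pow_def A.A.a_group T.is_group)
    have "?w k = (\<Otimes>\<^bsub>T\<^esub>j\<in>J. (coordinate j (e k) \<otimes>\<^sub>t b j) \<otimes>\<^bsub>T\<^esub> (w j (Suc k) \<otimes>\<^sub>t b j) [^]\<^bsub>T\<^esub> p)"
    proof (rule T.finprod_cong')
      show "w j k \<otimes>\<^sub>t b j = (coordinate j (e k) \<otimes>\<^sub>t b j) \<otimes>\<^bsub>T\<^esub> (w j (Suc k) \<otimes>\<^sub>t b j) [^]\<^bsub>T\<^esub> p" if "j \<in> J" for j
        by (subst w(2)[OF that]) (use that e w(1) in \<open>simp add: pure_add_left coordinate_closed pw\<close>)
    qed (use w(1) e in \<open>auto intro!: T.m_closed T.nat_pow_closed pure_closed coordinate_closed\<close>)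
    also have "\<dots> = (\<Otimes>\<^bsub>T\<^esub>j\<in>J. coordinate j (e k) \<otimes>\<^sub>t b j) \<otimes>\<^bsub>T\<^esub> (\<Otimes>\<^bsub>T\<^esub>j\<in>J. (w j (Suc k) \<otimes>\<^sub>t b j) [^]\<^bsub>T\<^esub> p)"
      using w(1) e by (intro T.finprod_multf) (auto intro!: T.nat_pow_closed pure_closed coordinate_closed)
    also have "(\<Otimes>\<^bsub>T\<^esub>j\<in>J. (w j (Suc k) \<otimes>\<^sub>t b j) [^]\<^bsub>T\<^esub> p) = ?w (Suc k) [^]\<^bsub>T\<^esub> p"
      using w(1) hom_finprod[OF hom_powI[of "\<lambda>x. x" T T p] tensor_comm_group tensor_comm_group,
          of "\<lambda>j. w j (Suc k) \<otimes>\<^sub>t b j" J] by (simp add: hom_def Pi_iff tensor_comm_group)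
    finally show "?w k = e k \<otimes>\<^bsub>T\<^esub> ?w (Suc k) [^]\<^bsub>T\<^esub> p"
      using tensor_expansion[of "e k"] e by simp
  qed
  then show "\<exists>w. \<forall>k. w k \<in> carrier T \<and> w k = e k \<otimes>\<^bsub>T\<^esub> w (Suc k) [^]\<^bsub>T\<^esub> p"
    by (intro exI[of _ ?w] allI)
qed

end

section \<open>Contracting the tensor product of a resolution\<close>

locale tensored_resolution = based_resolution R M P \<delta> \<eta> J b \<phi> + A: right_module R A
  for R :: "('r, 'k) ring_scheme" (structure) and M :: "('r, 'm) module"
    and P :: "nat \<Rightarrow> ('r, 'q) module" and \<delta> \<eta> and J :: "nat \<Rightarrow> 'j set" and b \<phi>
    and A :: "('r, 'a) module"
begin

abbreviation "C i \<equiv> tensor R A (P i)"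
abbreviation "D i \<equiv> tensor_map R A (P i) (\<delta> i)"

lemma functor_at: "tensor_functor R A (P i) (P j)"
  using A.right_module_axioms modules by (simp add: tensor_functor_def)

lemma product: "tensor_product R A (P i)"
  using A.right_module_axioms modules by (simp add: tensor_product_def)

lemma C_comm_group: "comm_group (C i)"
  by (rule tensor_product.tensor_comm_group[OF product])

lemma C_group: "group (C i)"
  using C_comm_group comm_group.axioms(2) by blast

lemma D_hom: "D i \<in> hom (C (Suc i)) (C i)"
  by (rule tensor_functor.tensor_map_hom[OF functor_at boundary_linear])

lemma D_closed: "t \<in> carrier (C (Suc i)) \<Longrightarrow> D i t \<in> carrier (C i)"
  by (rule hom_in_carrier[OF D_hom])

lemma D_D:
  assumes t: "t \<in> carrier (C (Suc (Suc i)))"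
  shows "D i (D (Suc i) t) = \<one>\<^bsub>C i\<^esub>"
  unfolding tensor_map_comp[OF A.right_module_axioms modules modules modules boundary_linear boundary_linear t]
  by (rule tensor_functor.tensor_map_zero[OF functor_at linear_map_comp[OF boundary_linear boundary_linear]
        boundary_boundary t])

lemma cycles_closed: "z \<in> cycles C D i \<Longrightarrow> z \<in> carrier (C i)"
  by (cases i) (auto simp: cycles_def kernel_def)

lemma boundary_in_cycles: "t \<in> carrier (C (Suc i)) \<Longrightarrow> D i t \<in> cycles C D i"
  by (cases i) (auto simp: cycles_def kernel_def D_closed D_D)

lemma cycles_Suc: "z \<in> cycles C D (Suc j) \<longleftrightarrow> z \<in> carrier (C (Suc j)) \<and> D j z = \<one>\<^bsub>C j\<^esub>"
  by (auto simp: cycles_def kernel_def)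

text \<open>On a cycle the summand \<open>h \<circ> \<delta>\<close> of a null-homotopic map vanishes.\<close>

lemma null_homotopic_cycle:
  assumes w: "\<And>i. w i \<in> linear_maps R (P i) (P i)"
    and h: "\<And>i. h i \<in> linear_maps R (P i) (P (Suc i))"
    and w0: "\<And>x. x \<in> carrier (P 0) \<Longrightarrow> w 0 x = \<delta> 0 (h 0 x)"
    and wS: "\<And>i x. x \<in> carrier (P (Suc i)) \<Longrightarrow>
      w (Suc i) x = \<delta> (Suc i) (h (Suc i) x) \<oplus>\<^bsub>P (Suc i)\<^esub> h i (\<delta> i x)"
    and z: "z \<in> cycles C D i"
  shows "tensor_map R A (P i) (w i) z \<in> D i ` carrier (C (Suc i))"
proof -
  have zC: "z \<in> carrier (C i)" by (rule cycles_closed[OF z])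
  have hz: "tensor_map R A (P (Suc i)) (h i) z \<in> carrier (C (Suc i))"
    by (rule tensor_functor.tensor_map_closed[OF functor_at h zC])
  note dh = linear_map_comp[OF h boundary_linear]
  have "tensor_map R A (P i) (w i) z = D i (tensor_map R A (P (Suc i)) (h i) z)"
  proof (cases i)
    case 0
    have "tensor_map R A (P 0) (w 0) z = tensor_map R A (P 0) (\<lambda>x. \<delta> 0 (h 0 x)) z"
      using zC 0 by (intro tensor_functor.tensor_map_cong[OF functor_at w dh w0]) simp_all
    then show ?thesis
      using zC 0 tensor_map_comp[OF A.right_module_axioms modules modules modules h boundary_linear, of z 0] by simp
  next
    case (Suc j)
    have zC': "z \<in> carrier (C (Suc j))" and Dz: "D j z = \<one>\<^bsub>C j\<^esub>"
      using z Suc by (auto simp: cycles_Suc)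
    note hd = linear_map_comp[OF boundary_linear[of j] h[of j]]
    have "tensor_map R A (P (Suc j)) (\<lambda>x. h j (\<delta> j x)) z = tensor_map R A (P (Suc j)) (h j) (D j z)"
      using tensor_map_comp[OF A.right_module_axioms modules modules modules boundary_linear h zC'] by simp
    also have "\<dots> = \<one>\<^bsub>C (Suc j)\<^esub>"
      unfolding Dz using hom_one[OF tensor_functor.tensor_map_hom[OF functor_at h] C_group C_group] .
    finally have hd1: "tensor_map R A (P (Suc j)) (\<lambda>x. h j (\<delta> j x)) z = \<one>\<^bsub>C (Suc j)\<^esub>" .
    have "tensor_map R A (P (Suc j)) (w (Suc j)) z =
        tensor_map R A (P (Suc j)) (\<lambda>x. \<delta> (Suc j) (h (Suc j) x)) z \<otimes>\<^bsub>C (Suc j)\<^esub> \<one>\<^bsub>C (Suc j)\<^esub>"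
      using tensor_functor.tensor_map_add[OF functor_at dh hd w wS zC'] hd1 by simp
    also have "\<dots> = tensor_map R A (P (Suc j)) (\<lambda>x. \<delta> (Suc j) (h (Suc j) x)) z"
      using tensor_functor.tensor_map_closed[OF functor_at dh zC'] group.is_monoid[OF C_group]
      by (simp add: monoid.r_one)
    also have "\<dots> = D (Suc j) (tensor_map R A (P (Suc (Suc j))) (h (Suc j)) z)"
      using tensor_map_comp[OF A.right_module_axioms modules modules modules h boundary_linear zC'] by simp
    finally show ?thesis using Suc by simp
  qed
  then show ?thesis using hz by blast
qed

end

locale finite_tensored_resolution = tensored_resolution +
  assumes finite_index: "finite (J i)"
begin

lemma based_tensor: "finite_dual_based_tensor R (P i) (J i) (b i) (\<phi> i) A"
  using dual_based finite_index A.right_module_axioms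
  by (simp add: finite_dual_based_tensor_def finite_dual_based_tensor_axioms_def)

text \<open>Let \<open>u\<close> be a lift of \<open>\<psi>\<close> to the resolution and \<open>\<theta> = 1 - p u\<close>. Since \<open>q \<theta>\<close> lifts \<open>q (1 - p \<psi>) = 0\<close>, it is
  null-homotopic. For a cycle \<open>z\<close> of the tensored complex there is \<open>s\<close> with \<open>K z = \<theta> s\<close>. The boundary of \<open>s\<close>
  is mapped to \<open>0\<close> by \<open>\<theta>\<close>, which is injective, so \<open>s\<close> is a cycle as well and \<open>K q z = q \<theta> s\<close> is a
  boundary.
  
  The predicate \<open>good\<close> keeps track of what is known about \<open>K\<close>: for complete coefficients \<open>K\<close> is \<open>1\<close>, for
  integral ones it is only prime to \<open>p\<close>.\<close>

lemma cycle_power_is_boundary: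
  assumes \<psi>: "\<psi> \<in> linear_maps R M M"
    and split: "\<And>x. x \<in> carrier M \<Longrightarrow> [(q::nat)] \<cdot>\<^bsub>M\<^esub> x = [q] \<cdot>\<^bsub>M\<^esub> ([p] \<cdot>\<^bsub>M\<^esub> \<psi> x)"
    and reduced: "p_reduced p (add_monoid A)"
    and almost_onto: "\<And>u. u \<in> hom (C i) (C i) \<Longrightarrow>
      \<exists>K. good K \<and> (\<forall>t\<in>carrier (C i). \<exists>s\<in>carrier (C i). t [^]\<^bsub>C i\<^esub> (K::nat) \<otimes>\<^bsub>C i\<^esub> u s [^]\<^bsub>C i\<^esub> p = s)"
  obtains K where "good K" "\<And>z. z \<in> cycles C D i \<Longrightarrow> z [^]\<^bsub>C i\<^esub> (K * q) \<in> D i ` carrier (C (Suc i))"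
proof -
  interpret self: resolution_pair R M P \<delta> \<eta> J b \<phi> M P \<delta> \<eta> by unfold_locales
  obtain u where u: "\<And>i. u i \<in> linear_maps R (P i) (P i)"
    and u0: "\<And>x. x \<in> carrier (P 0) \<Longrightarrow> \<eta> (u 0 x) = \<psi> (\<eta> x)"
    and uS: "\<And>i x. x \<in> carrier (P (Suc i)) \<Longrightarrow> \<delta> i (u (Suc i) x) = u i (\<delta> i x)"
    using self.chain_map_lift[OF \<psi>] by blast
  define \<theta> where "\<theta> i x = x \<ominus>\<^bsub>P i\<^esub> [p] \<cdot>\<^bsub>P i\<^esub> u i x" for i x
  define w where "w i x = [q] \<cdot>\<^bsub>P i\<^esub> \<theta> i x" for i x
  have pu: "(\<lambda>x. [p] \<cdot>\<^bsub>P i\<^esub> u i x) \<in> linear_maps R (P i) (P i)" for i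
    by (rule linear_maps_nat_multI[OF u modules])
  have \<theta>: "\<theta> i \<in> linear_maps R (P i) (P i)" for i
    unfolding \<theta>_def[abs_def] by (rule linear_maps_diffI[OF linear_maps_id pu modules])
  have w: "w i \<in> linear_maps R (P i) (P i)" for i
    unfolding w_def[abs_def] by (rule linear_maps_nat_multI[OF \<theta> modules])
  have \<theta>S: "\<delta> i (\<theta> (Suc i) x) = \<theta> i (\<delta> i x)" if x: "x \<in> carrier (P (Suc i))" for i x
    using linear_map_diff[OF boundary_linear modules modules x linear_map_closed[OF pu x]]
      linear_map_nat_mult[OF boundary_linear modules modules linear_map_closed[OF u x]]
    by (simp add: \<theta>_def uS[OF x])
  have wS: "\<delta> i (w (Suc i) x) = w i (\<delta> i x)" if x: "x \<in> carrier (P (Suc i))" for i x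
    using linear_map_nat_mult[OF boundary_linear modules modules linear_map_closed[OF \<theta> x]]
    by (simp add: w_def \<theta>S[OF x])
  have w0: "\<eta> (w 0 x) = \<zero>\<^bsub>M\<^esub>" if x: "x \<in> carrier (P 0)" for x
  proof -
    note aug = augmentation_linear modules M.left_module_axioms
    have \<eta>x: "\<eta> x \<in> carrier M" and \<psi>\<eta>x: "\<psi> (\<eta> x) \<in> carrier M"
      using linear_map_closed[OF augmentation_linear x] linear_map_closed[OF \<psi>] by auto
    have "\<eta> (w 0 x) = [q] \<cdot>\<^bsub>M\<^esub> (\<eta> x \<ominus>\<^bsub>M\<^esub> [p] \<cdot>\<^bsub>M\<^esub> \<psi> (\<eta> x))"
      using linear_map_nat_mult[OF aug linear_map_closed[OF \<theta> x]]
        linear_map_diff[OF aug x linear_map_closed[OF pu x]]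
        linear_map_nat_mult[OF aug linear_map_closed[OF u x]]
      by (simp add: w_def \<theta>_def u0[OF x])
    also have "\<dots> = [q] \<cdot>\<^bsub>M\<^esub> \<eta> x \<ominus>\<^bsub>M\<^esub> [q] \<cdot>\<^bsub>M\<^esub> ([p] \<cdot>\<^bsub>M\<^esub> \<psi> (\<eta> x))"
      using \<eta>x \<psi>\<eta>x by (simp add: a_minus_def M.M.add.nat_pow_distrib M.M.add.nat_pow_inv)
    also have "\<dots> = \<zero>\<^bsub>M\<^esub>" using split[OF \<eta>x] \<psi>\<eta>x by (simp add: a_minus_def M.M.r_neg)
    finally show ?thesis .
  qed
  obtain h where h: "\<And>i. h i \<in> linear_maps R (P i) (P (Suc i))"
    and h0: "\<And>x. x \<in> carrier (P 0) \<Longrightarrow> w 0 x = \<delta> 0 (h 0 x)"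
    and hS: "\<And>i x. x \<in> carrier (P (Suc i)) \<Longrightarrow>
      w (Suc i) x = \<delta> (Suc i) (h (Suc i) x) \<oplus>\<^bsub>P (Suc i)\<^esub> h i (\<delta> i x)"
    using self.null_homotopy[OF w w0 wS] by blast
  let ?U = "\<lambda>i. tensor_map R A (P i) (u i)" and ?\<Theta> = "\<lambda>i. tensor_map R A (P i) (\<theta> i)"
  have U_hom: "?U i \<in> hom (C i) (C i)" for i by (rule tensor_functor.tensor_map_hom[OF functor_at u])
  have \<Theta>_closed: "?\<Theta> i t \<in> carrier (C i)" if "t \<in> carrier (C i)" for i t
    by (rule tensor_functor.tensor_map_closed[OF functor_at \<theta> that])
  have \<Theta>U: "t = ?\<Theta> i t \<otimes>\<^bsub>C i\<^esub> ?U i t [^]\<^bsub>C i\<^esub> p" if t: "t \<in> carrier (C i)" for i t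
  proof -
    interpret Pi: left_module R "P i" by (rule modules)
    have "x = \<theta> i x \<oplus>\<^bsub>P i\<^esub> [p] \<cdot>\<^bsub>P i\<^esub> u i x" if "x \<in> carrier (P i)" for x
      using that linear_map_closed[OF u that] by (simp add: \<theta>_def a_minus_def Pi.a_assoc Pi.l_neg)
    then show ?thesis
      using tensor_functor.tensor_map_add[OF functor_at \<theta> pu linear_maps_id _ t]
        tensor_functor.tensor_map_pow[OF functor_at u pu _ t]
        tensor_map_id[OF A.right_module_axioms modules linear_maps_id _ t] by simp
  qed
  have \<Theta>_inj: "t = \<one>\<^bsub>C i\<^esub>" if t: "t \<in> carrier (C i)" and "?\<Theta> i t = \<one>\<^bsub>C i\<^esub>" for i t
  proof -
    interpret Ci: comm_group "C i" by (rule C_comm_group)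
    have "t = ?U i t [^]\<^bsub>C i\<^esub> p"
      using \<Theta>U[OF t] that(2) hom_in_carrier[OF U_hom t] by simp
    then show ?thesis
      by (rule Ci.one_minus_p_injective[OF finite_dual_based_tensor.tensor_p_reduced[OF based_tensor reduced]
            U_hom t])
  qed
  obtain K :: nat where K: "good K"
    "\<And>t. t \<in> carrier (C i) \<Longrightarrow> \<exists>s\<in>carrier (C i). t [^]\<^bsub>C i\<^esub> K \<otimes>\<^bsub>C i\<^esub> ?U i s [^]\<^bsub>C i\<^esub> p = s"
    using almost_onto[OF U_hom] by blast
  show thesis
  proof (rule that[OF K(1)])
    fix z assume z: "z \<in> cycles C D i"
    interpret Ci: comm_group "C i" by (rule C_comm_group)
    have zC: "z \<in> carrier (C i)" by (rule cycles_closed[OF z])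
    obtain s where s: "s \<in> carrier (C i)" "z [^]\<^bsub>C i\<^esub> K \<otimes>\<^bsub>C i\<^esub> ?U i s [^]\<^bsub>C i\<^esub> p = s"
      using K(2)[OF zC] by blast
    have \<Theta>s: "?\<Theta> i s = z [^]\<^bsub>C i\<^esub> K"
      using \<Theta>U[OF s(1)] s zC \<Theta>_closed[OF s(1)] hom_in_carrier[OF U_hom s(1)]
      by (metis Ci.nat_pow_closed Ci.right_cancel)
    have s_cycle: "s \<in> cycles C D i"
    proof (cases i)
      case 0
      then show ?thesis using s(1) by (simp add: cycles_def)
    next
      case (Suc j)
      have s': "s \<in> carrier (C (Suc j))" and zS: "z \<in> carrier (C (Suc j))" and Dz: "D j z = \<one>\<^bsub>C j\<^esub>"
        using s(1) z Suc by (auto simp: cycles_Suc)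
      have "?\<Theta> j (D j s) = tensor_map R A (P j) (\<lambda>x. \<theta> j (\<delta> j x)) s"
        by (rule tensor_map_comp[OF A.right_module_axioms modules modules modules boundary_linear \<theta> s'])
      also have "\<dots> = tensor_map R A (P j) (\<lambda>x. \<delta> j (\<theta> (Suc j) x)) s"
        by (rule tensor_functor.tensor_map_cong[OF functor_at linear_map_comp[OF boundary_linear \<theta>]
              linear_map_comp[OF \<theta> boundary_linear] \<theta>S[symmetric] s'])
      also have "\<dots> = D j (?\<Theta> (Suc j) s)"
        by (rule tensor_map_comp[OF A.right_module_axioms modules modules modules \<theta> boundary_linear s', symmetric])
      also have "\<dots> = D j z [^]\<^bsub>C j\<^esub> K"
        using \<Theta>s Suc hom_nat_pow[OF D_hom zS C_group C_group, of K] by simp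
      also have "\<dots> = \<one>\<^bsub>C j\<^esub>" unfolding Dz by (rule monoid.nat_pow_one[OF group.is_monoid[OF C_group]])
      finally have "D j s = \<one>\<^bsub>C j\<^esub>" by (rule \<Theta>_inj[OF D_closed[OF s']])
      then show ?thesis using s' Suc by (simp add: cycles_Suc)
    qed
    have "z [^]\<^bsub>C i\<^esub> (K * q) = tensor_map R A (P i) (w i) s"
      using tensor_functor.tensor_map_pow[OF functor_at \<theta> w w_def s(1)] zC
      by (simp add: \<Theta>s Ci.nat_pow_pow)
    then show "z [^]\<^bsub>C i\<^esub> (K * q) \<in> D i ` carrier (C (Suc i))"
      using null_homotopic_cycle[OF w h h0 hS s_cycle] by simp
  qed
qed

end

section \<open>Nakayama's lemma for a prime\<close>

lemma (in comm_group) int_pow_finprod: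
  assumes "f \<in> I \<rightarrow> carrier G"
  shows "(\<Otimes>i\<in>I. f i) [^] (k::int) = (\<Otimes>i\<in>I. f i [^] k)"
  using hom_finprod[of "\<lambda>x. x [^] k" G G f I] assms comm_group_axioms
  by (simp add: hom_def int_pow_distrib)

lemma dvd_mult_minus_one: "\<lbrakk>p dvd a - 1; p dvd b - 1\<rbrakk> \<Longrightarrow> p dvd a * b - (1::int)"
  using dvd_add[OF dvd_mult[of p "b - 1" a], of "a - 1"] by (simp add: algebra_simps)

text \<open>Nakayama's lemma by elimination, in additive notation: the relations
  \<open>m\<^sub>j x\<^sub>j = p \<Sum>\<^sub>l c\<^sub>j\<^sub>l x\<^sub>l\<close> with \<open>m\<^sub>j \<equiv> 1 (mod p)\<close> can be solved for one generator after the other,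
  because the pivot \<open>m\<^sub>n - p c\<^sub>n\<^sub>n\<close> is again congruent to \<open>1\<close>. Allowing \<open>m\<^sub>j \<noteq> 1\<close> is what keeps the form
  of the relations stable under elimination.\<close>

lemma (in comm_group) nakayama_elimination:
  fixes x :: "'j \<Rightarrow> 'a" and p :: int
  assumes "finite J" "x \<in> J \<rightarrow> carrier G"
    and "\<And>j. j \<in> J \<Longrightarrow> \<exists>m c. p dvd m - 1 \<and> x j [^] m = (\<Otimes>l\<in>J. x l [^] (p * c l))"
  shows "\<exists>m. p dvd m - 1 \<and> (\<forall>j\<in>J. x j [^] m = \<one>)"
  using assms
proof (induction J rule: finite_induct)
  case empty
  then show ?case by (intro exI[of _ 1]) simp
next
  case (insert n J)
  have xn: "x n \<in> carrier G" and xJ: "\<And>j. j \<in> J \<Longrightarrow> x j \<in> carrier G"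
    using insert.prems(1) by auto
  have split: "(\<Otimes>l\<in>insert n J. x l [^] (p * c l)) = x n [^] (p * c n) \<otimes> (\<Otimes>l\<in>J. x l [^] (p * c l))" for c
    using insert.hyps xn xJ by (intro finprod_insert) auto
  obtain mn cn where mn: "p dvd mn - 1"
    and en: "x n [^] mn = x n [^] (p * cn n) \<otimes> (\<Otimes>l\<in>J. x l [^] (p * cn l))"
    using insert.prems(2)[of n] unfolding split by blast
  \<comment> \<open>The pivot for solving the \<open>n\<close>-th relation for \<open>x n\<close>.\<close>
  define m' where "m' = mn - p * cn n"
  have m': "p dvd m' - 1"
    using dvd_diff[OF mn, of "p * cn n"] by (simp add: m'_def algebra_simps)
  have cl: "(\<Otimes>l\<in>J. x l [^] (p * c l)) \<in> carrier G" for c using xJ by (intro finprod_closed) auto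
  have em': "x n [^] m' = (\<Otimes>l\<in>J. x l [^] (p * cn l))"
    unfolding m'_def using en xn cl[of cn] by (simp add: int_pow_diff m_ac) (simp add: m_assoc[symmetric])
  have "\<exists>m c. p dvd m - 1 \<and> x j [^] m = (\<Otimes>l\<in>J. x l [^] (p * c l))" if j: "j \<in> J" for j
  proof -
    obtain mj c where mj: "p dvd mj - 1"
      and ej: "x j [^] mj = x n [^] (p * c n) \<otimes> (\<Otimes>l\<in>J. x l [^] (p * c l))"
      using insert.prems(2)[of j] j unfolding split by blast
    have "x j [^] (mj * m') = (x n [^] (p * c n) \<otimes> (\<Otimes>l\<in>J. x l [^] (p * c l))) [^] m'"
      using xJ[OF j] by (simp add: int_pow_pow[symmetric] ej)
    also have "\<dots> = (x n [^] m') [^] (p * c n) \<otimes> (\<Otimes>l\<in>J. x l [^] (p * c l)) [^] m'"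
      using xn cl[of c] by (simp add: int_pow_distrib int_pow_pow mult.commute)
    also have "\<dots> = (\<Otimes>l\<in>J. (x l [^] (p * cn l)) [^] (p * c n)) \<otimes> (\<Otimes>l\<in>J. (x l [^] (p * c l)) [^] m')"
      unfolding em' using xJ by (subst (1 2) int_pow_finprod) auto
    also have "\<dots> = (\<Otimes>l\<in>J. (x l [^] (p * cn l)) [^] (p * c n) \<otimes> (x l [^] (p * c l)) [^] m')"
      using xJ by (intro finprod_multf[symmetric]) auto
    also have "\<dots> = (\<Otimes>l\<in>J. x l [^] (p * (cn l * (p * c n) + c l * m')))"
      using xJ by (intro finprod_cong') (auto simp: int_pow_pow int_pow_mult[symmetric] algebra_simps)
    finally show ?thesis
      using dvd_mult_minus_one[OF mj m'] by (intro exI conjI) simp_all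
  qed
  then obtain m where m: "p dvd m - 1" "\<And>j. j \<in> J \<Longrightarrow> x j [^] m = \<one>"
    using insert.IH insert.prems(1) by auto
  have "x n [^] (m' * m) = \<one>"
  proof -
    have "x n [^] (m' * m) = (\<Otimes>l\<in>J. (x l [^] (p * cn l)) [^] m)"
      using xn xJ by (simp add: int_pow_pow[symmetric] em') (subst int_pow_finprod, auto)
    also have "\<dots> = (\<Otimes>l\<in>J. \<one>)"
    proof (rule finprod_cong')
      fix l assume l: "l \<in> J"
      have "(x l [^] (p * cn l)) [^] m = (x l [^] m) [^] (p * cn l)"
        using xJ[OF l] by (simp add: int_pow_pow mult.commute)
      then show "(x l [^] (p * cn l)) [^] m = \<one>" using m(2)[OF l] by simp
    qed auto
    finally show ?thesis by simp
  qed
  moreover have "x j [^] (m' * m) = \<one>" if "j \<in> J" for j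
    using m(2)[OF that] xJ[OF that] by (simp add: mult.commute[of m'] flip: int_pow_pow)
  ultimately show ?case
    using dvd_mult_minus_one[OF m' m(1)] by (intro exI[of _ "m' * m"]) auto
qed

section \<open>The canonical free resolution\<close>

definition basis_vector :: "('r, 'k) ring_scheme \<Rightarrow> 'b \<Rightarrow> 'b \<Rightarrow> 'r" where
  "basis_vector R b = (\<lambda>x. if x = b then \<one>\<^bsub>R\<^esub> else \<zero>\<^bsub>R\<^esub>)"

lemma linear_maps_cong:
  assumes "f \<in> linear_maps R M N" "left_module R M" "\<And>x. x \<in> carrier M \<Longrightarrow> g x = f x"
  shows "g \<in> linear_maps R M N"
proof -
  interpret M: left_module R M by fact
  show ?thesis
    using linear_mapsD[OF assms(1)] assms(3) M.smult_closed by (intro linear_mapsI) simp_all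
qed

context ring
begin

lemma free_left_module_simps:
  "carrier (free_left_module R B) =
    {c. (\<forall>b. c b \<in> carrier R) \<and> finite {b. c b \<noteq> \<zero>} \<and> {b. c b \<noteq> \<zero>} \<subseteq> B}"
  "\<zero>\<^bsub>free_left_module R B\<^esub> = (\<lambda>b. \<zero>)"
  "c \<oplus>\<^bsub>free_left_module R B\<^esub> c' = (\<lambda>b. c b \<oplus> c' b)"
  "r \<odot>\<^bsub>free_left_module R B\<^esub> c = (\<lambda>b. r \<otimes> c b)"
  by (simp_all add: free_left_module_def)

lemma free_left_module: "left_module R (free_left_module R B)"
proof (intro left_module.intro left_module_axioms.intro)
  show "ring R" by (rule ring_axioms)
  show "abelian_group (free_left_module R B)"
  proof (rule abelian_groupI, goal_cases)
    case (1 c c')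
    have "{b. c b \<oplus> c' b \<noteq> \<zero>} \<subseteq> {b. c b \<noteq> \<zero>} \<union> {b. c' b \<noteq> \<zero>}" by auto
    then show ?case using 1 by (auto simp: free_left_module_simps intro: finite_subset)
  next
    case (6 c)
    have "{b. \<ominus> c b \<noteq> \<zero>} \<subseteq> {b. c b \<noteq> \<zero>}" by auto
    then show ?case
      using 6 by (intro bexI[of _ "\<lambda>b. \<ominus> c b"]) (auto simp: free_left_module_simps l_neg intro: finite_subset)
  qed (auto simp: free_left_module_simps a_ac)
  fix r c assume "r \<in> carrier R" "c \<in> carrier (free_left_module R B)"
  moreover have "{b. r \<otimes> c b \<noteq> \<zero>} \<subseteq> {b. c b \<noteq> \<zero>}" if "r \<in> carrier R" using that by auto
  ultimately show "r \<odot>\<^bsub>free_left_module R B\<^esub> c \<in> carrier (free_left_module R B)"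
    by (auto simp: free_left_module_simps intro: finite_subset)
qed (auto simp: free_left_module_simps l_distr r_distr m_assoc)

lemma free_finsum:
  assumes "f \<in> I \<rightarrow> carrier (free_left_module R B)"
  shows "(\<Oplus>\<^bsub>free_left_module R B\<^esub>i\<in>I. f i) = (\<lambda>x. \<Oplus>i\<in>I. f i x)"
proof
  fix x
  interpret F: left_module R "free_left_module R B" by (rule free_left_module)
  have "(\<lambda>c. c x) \<in> hom (add_monoid (free_left_module R B)) (add_monoid R)"
    by (auto simp: hom_def free_left_module_simps)
  from hom_finprod[OF this F.M.a_comm_group a_comm_group, of f I] assms
  show "(\<Oplus>\<^bsub>free_left_module R B\<^esub>i\<in>I. f i) x = (\<Oplus>i\<in>I. f i x)"
    by (simp add: finsum_def)
qed

lemma basis_vector_closed [simp]: "b \<in> B \<Longrightarrow> basis_vector R b \<in> carrier (free_left_module R B)"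
proof -
  assume "b \<in> B"
  moreover have "{x. basis_vector R b x \<noteq> \<zero>} \<subseteq> {b}" by (auto simp: basis_vector_def)
  ultimately show ?thesis
    unfolding free_left_module_simps
    by (auto intro: finite_subset[of _ "{b}"]) (auto simp: basis_vector_def)
qed

lemma free_dual_basis:
  "dual_basis R (free_left_module R B) B (basis_vector R) (\<lambda>b c. c b)"
  unfolding dual_basis_def
proof (intro conjI ballI)
  fix c assume c: "c \<in> carrier (free_left_module R B)"
  let ?S = "{j \<in> B. c j \<noteq> \<zero>}"
  have S: "?S = {j. c j \<noteq> \<zero>}" using c by (auto simp: free_left_module_simps)
  then show fin: "finite ?S" using c by (simp add: free_left_module_simps)
  interpret F: left_module R "free_left_module R B" by (rule free_left_module)
  have cR: "c x \<in> carrier R" for x using c by (simp add: free_left_module_simps)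
  have "(\<Oplus>\<^bsub>free_left_module R B\<^esub>j\<in>?S. c j \<odot>\<^bsub>free_left_module R B\<^esub> basis_vector R j) =
    (\<lambda>x. \<Oplus>j\<in>?S. (c j \<odot>\<^bsub>free_left_module R B\<^esub> basis_vector R j) x)"
    using cR by (intro free_finsum) (auto intro!: F.smult_closed)
  also have "\<dots> = c"
  proof
    fix x
    have "(\<Oplus>j\<in>?S. (c j \<odot>\<^bsub>free_left_module R B\<^esub> basis_vector R j) x) = (\<Oplus>j\<in>?S. if x = j then c j else \<zero>)"
      using cR by (intro finsum_cong') (auto simp: free_left_module_simps basis_vector_def)
    also have "\<dots> = c x"
    proof (cases "x \<in> ?S")
      case True
      then show ?thesis using fin cR by (intro finsum_singleton) auto
    next
      case False
      then have "(\<Oplus>j\<in>?S. if x = j then c j else \<zero>) = (\<Oplus>j\<in>?S. \<zero>)" by (intro finsum_cong') auto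
      then show ?thesis using False S by (simp add: finsum_zero)
    qed
    finally show "(\<Oplus>j\<in>?S. (c j \<odot>\<^bsub>free_left_module R B\<^esub> basis_vector R j) x) = c x" .
  qed
  finally show "c = (\<Oplus>\<^bsub>free_left_module R B\<^esub>j\<in>?S. c j \<odot>\<^bsub>free_left_module R B\<^esub> basis_vector R j)" by simp
qed (simp_all add: basis_vector_closed, simp_all add: free_left_module_simps)

lemma free_dual_based: "dual_based_module R (free_left_module R B) B (basis_vector R) (\<lambda>b c. c b)"
  by (intro dual_based_module.intro dual_based_module_axioms.intro free_left_module free_dual_basis)

lemma linear_extension_free:
  assumes "c \<in> carrier (free_left_module R B)"
  shows "linear_extension R M g c = dual_basis_map R M B (\<lambda>b c. c b) g c"
proof -
  have "{b. c b \<noteq> \<zero>} = {b \<in> B. c b \<noteq> \<zero>}" using assms by (auto simp: free_left_module_simps)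
  then show ?thesis by (simp add: linear_extension_def dual_basis_map_def)
qed

lemma linear_extension_linear:
  assumes "left_module R N" "g \<in> B \<rightarrow> carrier N"
  shows "linear_extension R N g \<in> linear_maps R (free_left_module R B) N"
  using linear_maps_cong[OF dual_based_module.dual_basis_map_linear[OF free_dual_based assms] free_left_module]
    linear_extension_free by blast

lemma linear_extension_basis_vector:
  assumes "left_module R N" "g \<in> B \<rightarrow> carrier N" "b \<in> B"
  shows "linear_extension R N g (basis_vector R b) = g b"
proof -
  interpret N: left_module R N by fact
  have gb: "g b \<in> carrier N" using assms by auto
  have "linear_extension R N g (basis_vector R b) = (\<Oplus>\<^bsub>N\<^esub>j\<in>{b}. basis_vector R b j \<odot>\<^bsub>N\<^esub> g j)"
    unfolding linear_extension_free[OF basis_vector_closed[OF assms(3)]]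
    by (rule dual_based_module.dual_basis_map_superset[OF free_dual_based assms(1,2)])
      (use assms(3) basis_vector_closed[OF assms(3)] in \<open>auto simp: basis_vector_def\<close>)
  then show ?thesis
    using gb N.smult_one[OF gb] by (simp add: N.finsum_insert basis_vector_def)
qed

lemma linear_extension_zero:
  assumes "left_module R N" "f \<in> linear_maps R (free_left_module R B) N"
    "\<And>b. b \<in> B \<Longrightarrow> f (basis_vector R b) = \<zero>\<^bsub>N\<^esub>" "c \<in> carrier (free_left_module R B)"
  shows "f c = \<zero>\<^bsub>N\<^esub>"
proof -
  interpret N: left_module R N by fact
  have "c b \<in> carrier R" for b using assms(4) by (simp add: free_left_module_simps)
  then show ?thesis
    unfolding dual_based_module.linear_map_expansion[OF free_dual_based assms(1,2,4)] dual_basis_map_def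
    using assms(3) by (intro N.add.finprod_one_eqI) simp
qed

lemma formal_sum_closed:
  assumes "xs \<in> lists (carrier R \<times> B)"
  shows "formal_sum R xs \<in> carrier (free_left_module R B)"
proof -
  have cl: "formal_sum R xs b \<in> carrier R" for b
    unfolding formal_sum_def using assms by (intro finsum_closed) (auto simp: lists_eq_set mem_Times_iff dest!: nth_mem)
  have "formal_sum R xs b = \<zero>" if "b \<notin> snd ` set xs" for b
  proof -
    have "{i. i < length xs \<and> snd (xs ! i) = b} = {}" using that by (force simp: image_iff dest: nth_mem)
    then show ?thesis by (simp add: formal_sum_def del: Collect_empty_eq)
  qed
  then have "{b. formal_sum R xs b \<noteq> \<zero>} \<subseteq> snd ` set xs" by auto
  moreover have "snd ` set xs \<subseteq> B" using assms by (auto simp: lists_eq_set)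
  ultimately show ?thesis
    unfolding free_left_module_simps using cl by (auto intro: finite_subset)
qed

lemma formal_sum_surj:
  assumes c: "c \<in> carrier (free_left_module R B)"
  obtains xs where "xs \<in> lists (carrier R \<times> B)" "formal_sum R xs = c"
proof -
  have cR: "c b \<in> carrier R" for b using c by (simp add: free_left_module_simps)
  have fin: "finite {b. c b \<noteq> \<zero>}" and sub: "{b. c b \<noteq> \<zero>} \<subseteq> B"
    using c by (auto simp: free_left_module_simps)
  obtain bs where bs: "set bs = {b. c b \<noteq> \<zero>}" "distinct bs" using finite_distinct_list[OF fin] by blast
  let ?xs = "map (\<lambda>b. (c b, b)) bs"
  have "formal_sum R ?xs b = c b" for b
  proof (cases "b \<in> set bs")
    case True
    then obtain i where i: "i < length bs" "bs ! i = b" by (auto simp: in_set_conv_nth)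
    then have "{l. l < length ?xs \<and> snd (?xs ! l) = b} = {i}" using bs(2) by (auto simp: nth_eq_iff_index_eq)
    then have "formal_sum R ?xs b = (\<Oplus>l\<in>{i}. fst (?xs ! l))" by (simp only: formal_sum_def)
    then show ?thesis using i cR by (simp add: finsum_insert)
  next
    case False
    then have "{l. l < length ?xs \<and> snd (?xs ! l) = b} = {}" by auto
    then have "formal_sum R ?xs b = \<zero>" by (simp only: formal_sum_def finsum_empty)
    then show ?thesis using False bs(1) by simp
  qed
  then show thesis using that[of ?xs] bs(1) sub cR by (auto simp: lists_eq_set)
qed

end

locale canonical_resolution = left_module R M
  for R :: "('r, 'k) ring_scheme" (structure) and M :: "('r, 'm) module"
begin

abbreviation "F n \<equiv> free_resolution R M n"

lemma F_module: "left_module R (F n)"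
  unfolding free_resolution_def by (rule R.free_left_module)

definition cell_boundary :: "('r, 'm) cell \<Rightarrow> ('r, 'm) cell \<Rightarrow> 'r" where
  "cell_boundary b = (case b of Elem x \<Rightarrow> (\<lambda>_. \<zero>) | Syz xs \<Rightarrow> formal_sum R xs)"

lemma cell_boundary_closed: "cell_boundary \<in> res_basis R M (Suc n) \<rightarrow> carrier (F n)"
  by (cases n) (auto simp: cell_boundary_def free_resolution_def intro!: R.formal_sum_closed simp del: in_lists_conv_set)

text \<open>\<^const>\<open>res_boundary\<close> adds up in the free module on all cells, whatever the degree of its argument. The
  summands lie in \<open>F n\<close>, and there the sum is the same.\<close>

lemma res_boundary_eq:
  assumes c: "c \<in> carrier (F (Suc n))"
  shows "res_boundary R c = linear_extension R (F n) cell_boundary c"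
proof -
  interpret Fn: left_module R "F n" by (rule F_module)
  interpret U: left_module R "free_left_module R UNIV :: ('r, ('r, 'm) cell \<Rightarrow> 'r) module"
    by (rule R.free_left_module)
  have cR: "c b \<in> carrier R" for b using c by (simp add: free_resolution_def R.free_left_module_simps)
  have sub: "{b. c b \<noteq> \<zero>} \<subseteq> res_basis R M (Suc n)"
    using c by (auto simp: free_resolution_def R.free_left_module_simps)
  let ?f = "\<lambda>b x. c b \<otimes> cell_boundary b x"
  have f: "?f b = c b \<odot>\<^bsub>F n\<^esub> cell_boundary b" "?f b = c b \<odot>\<^bsub>free_left_module R UNIV\<^esub> cell_boundary b" for b
    by (simp_all add: free_resolution_def R.free_left_module_simps)
  have in_F: "?f \<in> {b. c b \<noteq> \<zero>} \<rightarrow> carrier (F n)"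
    unfolding f(1) using cR sub cell_boundary_closed by (auto intro!: Fn.smult_closed)
  moreover have "carrier (F n) \<subseteq> carrier (free_left_module R UNIV)"
    by (auto simp: free_resolution_def R.free_left_module_simps)
  ultimately have in_U: "?f \<in> {b. c b \<noteq> \<zero>} \<rightarrow> carrier (free_left_module R UNIV)" by blast
  have "res_boundary R c = (\<Oplus>\<^bsub>free_left_module R UNIV\<^esub>b\<in>{b. c b \<noteq> \<zero>}. ?f b)"
    unfolding f(2) by (simp add: res_boundary_def linear_extension_def cell_boundary_def)
  also have "\<dots> = (\<Oplus>\<^bsub>F n\<^esub>b\<in>{b. c b \<noteq> \<zero>}. ?f b)"
    using R.free_finsum[OF in_U] R.free_finsum[OF in_F[unfolded free_resolution_def]]
    by (simp add: free_resolution_def)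
  also have "\<dots> = linear_extension R (F n) cell_boundary c"
    unfolding f(1) by (simp add: linear_extension_def)
  finally show ?thesis .
qed

lemma res_boundary_linear: "res_boundary R \<in> linear_maps R (F (Suc n)) (F n)"
proof (rule linear_maps_cong)
  show "linear_extension R (F n) cell_boundary \<in> linear_maps R (F (Suc n)) (F n)"
    unfolding free_resolution_def[of R M "Suc n"]
    by (rule R.linear_extension_linear[OF F_module cell_boundary_closed])
qed (rule F_module, rule res_boundary_eq)

lemma res_boundary_basis_vector:
  assumes "b \<in> res_basis R M (Suc n)"
  shows "res_boundary R (basis_vector R b) = cell_boundary b"
  using R.linear_extension_basis_vector[OF F_module cell_boundary_closed assms]
    res_boundary_eq[of "basis_vector R b" n] assms by (simp add: free_resolution_def)

lemma elem_closed: "(\<lambda>b. case b of Elem x \<Rightarrow> x | Syz xs \<Rightarrow> \<zero>\<^bsub>M\<^esub>) \<in> res_basis R M 0 \<rightarrow> carrier M"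
  by auto

lemma res_augmentation_linear: "res_augmentation R M \<in> linear_maps R (F 0) M"
  unfolding res_augmentation_def free_resolution_def
  by (rule R.linear_extension_linear[OF left_module_axioms elem_closed])

lemma res_augmentation_basis_vector: "x \<in> carrier M \<Longrightarrow> res_augmentation R M (basis_vector R (Elem x)) = x"
  unfolding res_augmentation_def
  by (subst R.linear_extension_basis_vector[OF left_module_axioms elem_closed]) auto

text \<open>Exactness is built in: an element of the kernel is denoted by some list, and the cell made of this list
  has it as its boundary. Stated for an arbitrary map \<open>d\<close>, this serves the augmentation and the
  boundary maps alike.\<close>

lemma free_resolution_exact:
  assumes d: "d \<in> linear_maps R (F n) N" "left_module R N"
    and basis: "res_basis R M (Suc n) =
      Syz ` {xs \<in> lists (carrier R \<times> res_basis R M n). d (formal_sum R xs) = \<zero>\<^bsub>N\<^esub>}"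
  shows "{c \<in> carrier (F n). d c = \<zero>\<^bsub>N\<^esub>} = res_boundary R ` carrier (F (Suc n))"
proof (intro equalityI subsetI)
  fix c assume c: "c \<in> {c \<in> carrier (F n). d c = \<zero>\<^bsub>N\<^esub>}"
  then obtain xs where xs: "xs \<in> lists (carrier R \<times> res_basis R M n)" "formal_sum R xs = c"
    using R.formal_sum_surj[of c "res_basis R M n"] by (auto simp: free_resolution_def)
  then have b: "Syz xs \<in> res_basis R M (Suc n)" using c unfolding basis by auto
  then have "res_boundary R (basis_vector R (Syz xs)) = c"
    using res_boundary_basis_vector[OF b] xs(2) by (simp add: cell_boundary_def)
  moreover have "basis_vector R (Syz xs) \<in> carrier (F (Suc n))"
    using b by (simp add: free_resolution_def)
  ultimately show "c \<in> res_boundary R ` carrier (F (Suc n))" by blast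
next
  fix c assume "c \<in> res_boundary R ` carrier (F (Suc n))"
  then obtain e where e: "e \<in> carrier (F (Suc n))" "c = res_boundary R e" by blast
  have "d (res_boundary R e) = \<zero>\<^bsub>N\<^esub>"
  proof (rule R.linear_extension_zero[OF d(2), of "\<lambda>e. d (res_boundary R e)"])
    show "(\<lambda>e. d (res_boundary R e)) \<in> linear_maps R (free_left_module R (res_basis R M (Suc n))) N"
      using linear_map_comp[OF res_boundary_linear d(1)] by (simp add: free_resolution_def)
    show "d (res_boundary R (basis_vector R b)) = \<zero>\<^bsub>N\<^esub>" if b: "b \<in> res_basis R M (Suc n)" for b
      using b res_boundary_basis_vector[OF b] unfolding basis by (auto simp: cell_boundary_def)
    show "e \<in> carrier (free_left_module R (res_basis R M (Suc n)))" using e by (simp add: free_resolution_def)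
  qed
  then show "c \<in> {c \<in> carrier (F n). d c = \<zero>\<^bsub>N\<^esub>}"
    using e linear_map_closed[OF res_boundary_linear] by auto
qed

lemma free_resolution:
  "based_resolution R M F (\<lambda>_. res_boundary R) (res_augmentation R M)
    (res_basis R M) (\<lambda>_. basis_vector R) (\<lambda>_ b c. c b)"
proof (intro based_resolution.intro resolution.intro resolution_axioms.intro based_resolution_axioms.intro)
  show "left_module R M" by (rule left_module_axioms)
  show "left_module R (F n)" for n by (rule F_module)
  show "res_boundary R \<in> linear_maps R (F (Suc n)) (F n)" for n by (rule res_boundary_linear)
  show "res_augmentation R M \<in> linear_maps R (F 0) M" by (rule res_augmentation_linear)
  show "res_augmentation R M ` carrier (F 0) = carrier M"
  proof (intro equalityI subsetI)
    fix x assume "x \<in> carrier M"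
    then show "x \<in> res_augmentation R M ` carrier (F 0)"
      using res_augmentation_basis_vector[of x]
      by (intro image_eqI[of _ _ "basis_vector R (Elem x)"]) (auto simp: free_resolution_def)
  qed (use linear_map_closed[OF res_augmentation_linear] in auto)
  show "{c \<in> carrier (F 0). res_augmentation R M c = \<zero>\<^bsub>M\<^esub>} = res_boundary R ` carrier (F (Suc 0))"
    by (rule free_resolution_exact[OF res_augmentation_linear left_module_axioms]) simp
  show "{c \<in> carrier (F (Suc n)). res_boundary R c = \<zero>\<^bsub>F n\<^esub>} = res_boundary R ` carrier (F (Suc (Suc n)))" for n
    by (rule free_resolution_exact[OF res_boundary_linear F_module])
      (simp add: free_resolution_def R.free_left_module_simps)
  show "dual_basis R (F n) (res_basis R M n) (basis_vector R) (\<lambda>b c. c b)" for n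
    unfolding free_resolution_def by (rule R.free_dual_basis)
qed

end

section \<open>Finitely generated projective modules\<close>

text \<open>Projectivity splits the surjection from the free module on the set \<open>carrier P\<close>, and the components of
  the splitting \<open>h\<close> are coordinates with respect to all elements of \<open>P\<close>. A finite set of generators involves
  only finitely many of these coordinates, and all others vanish on \<open>P\<close>.\<close>

lemma fg_projective_dual_basis:
  fixes P :: "('r, 'q) module"
  assumes "left_module R P" "fin_generated R P" "projective R P"
  obtains J \<phi> where "finite J" "dual_basis R P J (\<lambda>x. x) \<phi>"
proof -
  interpret P: left_module R P by fact
  let ?F = "free_left_module R (carrier P)"
  interpret F: left_module R ?F by (rule P.R.free_left_module)
  let ?g = "linear_extension R P (\<lambda>x. x)"
  have g: "?g \<in> linear_maps R ?F P" by (rule P.R.linear_extension_linear[OF assms(1)]) auto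
  have "x \<in> ?g ` carrier ?F" if "x \<in> carrier P" for x
    using P.R.linear_extension_basis_vector[OF assms(1), of "\<lambda>x. x" "carrier P" x] that
    by (intro image_eqI[of _ _ "basis_vector R x"]) auto
  then have "?g ` carrier ?F = carrier P" using linear_map_closed[OF g] by auto
  then obtain h where h: "h \<in> linear_maps R P ?F" "\<And>x. x \<in> carrier P \<Longrightarrow> ?g (h x) = x"
    using assms(3) P.R.free_left_module assms(1) g linear_maps_id[of R P] unfolding projective_def by blast
  obtain S where S: "finite S" "S \<subseteq> carrier P"
    "\<And>x. x \<in> carrier P \<Longrightarrow> \<exists>c\<in>S \<rightarrow> carrier R. x = (\<Oplus>\<^bsub>P\<^esub>s\<in>S. c s \<odot>\<^bsub>P\<^esub> s)"
    using assms(2) unfolding fin_generated_def by blast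
  have hF: "h x \<in> carrier ?F" if "x \<in> carrier P" for x using linear_map_closed[OF h(1) that] .
  let ?J = "\<Union>s\<in>S. {y. h s y \<noteq> \<zero>\<^bsub>R\<^esub>}"
  have J: "finite ?J" "?J \<subseteq> carrier P"
    using S(1,2) hF by (auto simp: P.R.free_left_module_simps subset_iff)
  have supp: "{y. h x y \<noteq> \<zero>\<^bsub>R\<^esub>} \<subseteq> ?J" if x: "x \<in> carrier P" for x
  proof -
    obtain c where c: "c \<in> S \<rightarrow> carrier R" "x = (\<Oplus>\<^bsub>P\<^esub>s\<in>S. c s \<odot>\<^bsub>P\<^esub> s)" using S(3)[OF x] by blast
    have "h x = (\<Oplus>\<^bsub>?F\<^esub>s\<in>S. h (c s \<odot>\<^bsub>P\<^esub> s))"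
      unfolding c(2) using c(1) S(2)
      by (intro linear_map_finsum[OF h(1) assms(1) P.R.free_left_module]) (auto intro!: P.smult_closed)
    also have "\<dots> = (\<lambda>y. \<Oplus>\<^bsub>R\<^esub>s\<in>S. h (c s \<odot>\<^bsub>P\<^esub> s) y)"
      using c(1) S(2) by (intro P.R.free_finsum) (auto intro!: hF P.smult_closed)
    finally have hx: "h x y = (\<Oplus>\<^bsub>R\<^esub>s\<in>S. h (c s \<odot>\<^bsub>P\<^esub> s) y)" for y by simp
    have "h x y = \<zero>\<^bsub>R\<^esub>" if "y \<notin> ?J" for y
      unfolding hx
    proof (rule P.R.add.finprod_one_eqI)
      fix s assume s: "s \<in> S"
      then have "s \<in> carrier P" "c s \<in> carrier R" "h s y = \<zero>\<^bsub>R\<^esub>" using c(1) S(2) that by auto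
      then show "h (c s \<odot>\<^bsub>P\<^esub> s) y = \<zero>\<^bsub>R\<^esub>"
        by (simp add: linear_map_smult[OF h(1)] P.R.free_left_module_simps)
    qed
    then show ?thesis by blast
  qed
  have "dual_basis R P ?J (\<lambda>x. x) (\<lambda>y x. h x y)"
    unfolding dual_basis_def
  proof (intro conjI ballI)
    fix x assume x: "x \<in> carrier P"
    have supp': "{y \<in> ?J. h x y \<noteq> \<zero>\<^bsub>R\<^esub>} = {y. h x y \<noteq> \<zero>\<^bsub>R\<^esub>}" using supp[OF x] by blast
    show "finite {y \<in> ?J. h x y \<noteq> \<zero>\<^bsub>R\<^esub>}" by (rule finite_subset[OF _ J(1)]) auto
    show "x = (\<Oplus>\<^bsub>P\<^esub>y\<in>{y \<in> ?J. h x y \<noteq> \<zero>\<^bsub>R\<^esub>}. h x y \<odot>\<^bsub>P\<^esub> y)"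
      unfolding supp' using h(2)[OF x] by (simp add: linear_extension_def)
  qed (use J hF in \<open>auto simp: linear_map_add[OF h(1)] linear_map_smult[OF h(1)] P.R.free_left_module_simps\<close>)
  with J(1) show thesis by (rule that)
qed

section \<open>The homology of a tensored resolution\<close>

context tensored_resolution
begin

abbreviation "B i \<equiv> D i ` carrier (C (Suc i))"
abbreviation "Z i \<equiv> (C i)\<lparr>carrier := cycles C D i\<rparr>"
abbreviation "H i \<equiv> homology_group C D i"

lemma cycles_subgroup: "subgroup (cycles C D i) (C i)"
proof (cases i)
  case 0
  then show ?thesis using group.subgroup_self[OF C_group] by (simp add: cycles_def)
next
  case (Suc j)
  interpret d: group_hom "C (Suc j)" "C j" "D j"
    by (simp add: group_hom_def group_hom_axioms_def C_group D_hom)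
  show ?thesis using Suc d.subgroup_kernel by (simp add: cycles_def)
qed

lemma Z_comm_group: "comm_group (Z i)"
proof (rule group.group_comm_groupI)
  show "group (Z i)" by (rule subgroup.subgroup_is_group[OF cycles_subgroup C_group])
  fix z z' assume "z \<in> carrier (Z i)" "z' \<in> carrier (Z i)"
  then show "z \<otimes>\<^bsub>Z i\<^esub> z' = z' \<otimes>\<^bsub>Z i\<^esub> z"
    using comm_monoid.m_comm[OF comm_group.axioms(1)[OF C_comm_group]] cycles_closed by simp
qed

lemma boundaries_subgroup: "subgroup (B i) (Z i)"
proof -
  have "D i \<in> hom (C (Suc i)) (Z i)"
    using boundary_in_cycles hom_mult[OF D_hom] by (auto simp: hom_def)
  then interpret d: group_hom "C (Suc i)" "Z i" "D i"
    using Z_comm_group comm_group.axioms(2) by (auto simp: group_hom_def group_hom_axioms_def C_group)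
  show ?thesis by (rule d.img_is_subgroup)
qed

lemma boundaries_normal: "B i \<lhd> Z i"
  using comm_group.normal_iff_subgroup[OF Z_comm_group] boundaries_subgroup by blast

lemma homology_comm_group: "comm_group (H i)"
  unfolding homology_group_def
  by (rule comm_group.abelian_FactGroup[OF Z_comm_group boundaries_subgroup])

abbreviation "cls i z \<equiv> B i #>\<^bsub>Z i\<^esub> z"

lemma carrier_homology: "carrier (H i) = cls i ` cycles C D i"
  by (simp add: homology_group_def carrier_FactGroup)

lemma class_eq:
  assumes "z \<in> cycles C D i" "z' \<in> cycles C D i" "z \<otimes>\<^bsub>C i\<^esub> inv\<^bsub>C i\<^esub> z' \<in> B i"
  shows "cls i z = cls i z'"
proof -
  interpret Z: comm_group "Z i" by (rule Z_comm_group)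
  have "z \<otimes>\<^bsub>Z i\<^esub> inv\<^bsub>Z i\<^esub> z' \<in> B i"
    using assms group.m_inv_consistent[OF C_group cycles_subgroup assms(2)] by simp
  then have "z \<in> cls i z'"
    using subgroup.rcos_module_rev[OF boundaries_subgroup Z.is_group, of z' z] assms by simp
  then show ?thesis
    using Z.repr_independence[OF _ _ boundaries_subgroup, of z z'] assms by simp
qed

lemma class_boundary: "z \<in> B i \<Longrightarrow> cls i z = \<one>\<^bsub>H i\<^esub>"
  using group.coset_join2[OF comm_group.axioms(2)[OF Z_comm_group] _ boundaries_subgroup, of z i]
    subgroup.mem_carrier[OF boundaries_subgroup] by (simp add: homology_group_def)

lemma class_pow:
  assumes "z \<in> cycles C D i"
  shows "cls i z [^]\<^bsub>H i\<^esub> (n::nat) = cls i (z [^]\<^bsub>C i\<^esub> n)"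
proof -
  have "z [^]\<^bsub>Z i\<^esub> n = z [^]\<^bsub>C i\<^esub> n"
    using monoid.nat_pow_consistent[OF group.is_monoid[OF C_group]] by metis
  then show ?thesis
    using normal.FactGroup_pow[OF boundaries_normal, of z i n] assms by (simp add: homology_group_def)
qed

lemma homology_trivial:
  assumes "cycles C D i \<subseteq> B i"
  shows "trivial_group (H i)"
proof -
  interpret H: comm_group "H i" by (rule homology_comm_group)
  show ?thesis
    unfolding H.trivial_group_subset carrier_homology using assms class_boundary by auto
qed

end

section \<open>Finite resolutions as resolutions by zero in high degrees\<close>

lemma zero_submodule:
  assumes "left_module R P"
  shows "left_module R (P\<lparr>carrier := {\<zero>\<^bsub>P\<^esub>}\<rparr>)"
proof -
  interpret P: left_module R P by fact
  show ?thesis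
  proof (intro left_module.intro left_module_axioms.intro)
    show "abelian_group (P\<lparr>carrier := {\<zero>\<^bsub>P\<^esub>}\<rparr>)" by (rule abelian_groupI) auto
  qed (auto simp: P.R.ring_axioms P.smult_one)
qed

text \<open>With zero modules beyond degree \<open>d\<close>, injectivity of the last map becomes exactness in degree \<open>d\<close>.\<close>

lemma fg_projective_resolution_extend:
  fixes P :: "nat \<Rightarrow> ('r, 'q) module"
  assumes "fg_projective_resolution R M d P \<delta> \<eta>" "left_module R M"
  obtains P' :: "nat \<Rightarrow> ('r, 'q) module" and \<delta>' J \<phi>
  where "based_resolution R M P' \<delta>' \<eta> J (\<lambda>_ x. x) \<phi>" "\<And>i. finite (J i)"
    "\<And>i. i \<le> d \<Longrightarrow> P' i = P i" "\<And>i. i < d \<Longrightarrow> \<delta>' i = \<delta> i"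
    "\<And>i. d < i \<Longrightarrow> carrier (P' i) = {\<zero>\<^bsub>P' i\<^esub>}"
proof -
  note res = assms(1)[unfolded fg_projective_resolution_def]
  define P' where "P' i = (if i \<le> d then P i else (P d)\<lparr>carrier := {\<zero>\<^bsub>P d\<^esub>}\<rparr>)" for i
  define \<delta>' where "\<delta>' i = (if i < d then \<delta> i else (\<lambda>_. \<zero>\<^bsub>P' i\<^esub>))" for i
  have mod: "left_module R (P' i)" for i
    using res zero_submodule[of R "P d"] by (simp add: P'_def)
  have high: "carrier (P' i) = {\<zero>\<^bsub>P' i\<^esub>}" if "d < i" for i using that by (simp add: P'_def)
  have image: "\<delta>' i ` carrier (P' (Suc i)) = incoming_image d (\<lambda>i. add_monoid (P i)) \<delta> i" if "i \<le> d" for i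
    using that by (auto simp: incoming_image_def \<delta>'_def P'_def)
  have "\<exists>J \<phi>. finite J \<and> dual_basis R (P' i) J (\<lambda>x. x) \<phi>" for i
  proof (cases "i \<le> d")
    case True
    then have "left_module R (P i)" "fin_generated R (P i)" "projective R (P i)" using res by auto
    then obtain J \<phi> where "finite J" "dual_basis R (P i) J (\<lambda>x. x) \<phi>" by (rule fg_projective_dual_basis)
    then show ?thesis using True by (auto simp: P'_def)
  next
    case False
    interpret Pi: left_module R "P' i" by (rule mod)
    have "dual_basis R (P' i) {} (\<lambda>x. x) (\<lambda>_ _. undefined)"
      using high[of i] False by (simp add: dual_basis_def Pi.finsum_empty)
    then show ?thesis by blast
  qed
  then obtain J \<phi> where J: "\<And>i. finite (J i)" "\<And>i. dual_basis R (P' i) (J i) (\<lambda>x. x) (\<phi> i)" by metis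
  have "based_resolution R M P' \<delta>' \<eta> J (\<lambda>_ x. x) \<phi>"
  proof (intro based_resolution.intro resolution.intro resolution_axioms.intro based_resolution_axioms.intro)
    fix i
    interpret Pi: left_module R "P' i" by (rule mod)
    show "\<delta>' i \<in> linear_maps R (P' (Suc i)) (P' i)"
    proof (cases "i < d")
      case True
      then show ?thesis using res by (simp add: \<delta>'_def P'_def)
    next
      case False
      then show ?thesis
        by (intro linear_mapsI) (simp_all add: \<delta>'_def Pi.smult_r_null)
    qed
    show "{x \<in> carrier (P' (Suc i)). \<delta>' i x = \<zero>\<^bsub>P' i\<^esub>} = \<delta>' (Suc i) ` carrier (P' (Suc (Suc i)))"
    proof (cases "Suc i \<le> d")
      case True
      have "{x \<in> carrier (P' (Suc i)). \<delta>' i x = \<zero>\<^bsub>P' i\<^esub>} = cycles (\<lambda>i. add_monoid (P i)) \<delta> (Suc i)"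
        using True by (auto simp: cycles_def kernel_def P'_def \<delta>'_def)
      then show ?thesis using res image[OF True] True by blast
    next
      case False
      then show ?thesis using high[of "Suc i"] high[of "Suc (Suc i)"] by (auto simp: \<delta>'_def)
    qed
  next
    show "{x \<in> carrier (P' 0). \<eta> x = \<zero>\<^bsub>M\<^esub>} = \<delta>' 0 ` carrier (P' (Suc 0))"
      using res image[of 0] by (simp add: kernel_def P'_def)
  qed (use res assms(2) mod J(2) in \<open>simp_all add: P'_def\<close>)
  then show thesis
  proof (rule that)
    show "carrier (P' i) = {\<zero>\<^bsub>P' i\<^esub>}" if "d < i" for i by (rule high[OF that])
  qed (simp_all add: J(1) P'_def \<delta>'_def)
qed

lemma (in tensor_product) trivial_tensor:
  assumes "carrier M = {\<zero>\<^bsub>M\<^esub>}" "t \<in> carrier T"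
  shows "t = \<one>\<^bsub>T\<^esub>"
  using assms(2) by (induction t rule: tensor_induct) (use assms(1) in simp_all)

text \<open>The converse passage: the padded complex \<open>C'\<close> vanishes in degree \<open>d + 1\<close>, so that its exactness in
  degree \<open>d\<close> is injectivity of the last map of \<open>C\<close>.\<close>

lemma exact_complexI:
  assumes "\<And>i. comm_group (C' i)" "\<And>i. D' i \<in> hom (C' (Suc i)) (C' i)"
    and "\<And>i z. \<lbrakk>i \<le> d; z \<in> cycles C' D' i\<rbrakk> \<Longrightarrow> z \<in> D' i ` carrier (C' (Suc i))"
    and "\<And>i. D' i ` carrier (C' (Suc i)) \<subseteq> cycles C' D' i"
    and "carrier (C' (Suc d)) = {\<one>\<^bsub>C' (Suc d)\<^esub>}"
    and "\<And>i. i \<le> d \<Longrightarrow> C i = C' i" "\<And>i. i < d \<Longrightarrow> D i = D' i"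
  shows "exact_complex d C D"
  unfolding exact_complex_def
proof (intro conjI allI impI)
  fix i assume i: "i \<le> d"
  have cyc: "cycles C D i = cycles C' D' i"
    using i assms(6,7) by (cases i) (simp_all add: cycles_def kernel_def)
  have "D' d \<one>\<^bsub>C' (Suc d)\<^esub> = \<one>\<^bsub>C' d\<^esub>"
    using hom_one[OF assms(2)] assms(1) comm_group.axioms(2) by blast
  then have "incoming_image d C D i = D' i ` carrier (C' (Suc i))"
    using i assms(5-7) by (cases "i = d") (simp_all add: incoming_image_def)
  then show "cycles C D i = incoming_image d C D i"
    unfolding cyc using assms(3,4) i by blast
qed (use assms(1,2,6,7) in simp_all)

section \<open>Homology does not depend on the resolution\<close>

locale tensored_pair = X: tensored_resolution R M X dX eX JX bX \<phi>X A +
    Y: tensored_resolution R N Y dY eY JY bY \<phi>Y A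
  for R :: "('r, 'k) ring_scheme" (structure) and M :: "('r, 'm) module"
    and X :: "nat \<Rightarrow> ('r, 'x) module" and dX eX and JX :: "nat \<Rightarrow> 'i set" and bX \<phi>X
    and N :: "('r, 'n) module" and Y :: "nat \<Rightarrow> ('r, 'y) module" and dY eY and JY :: "nat \<Rightarrow> 'j set" and bY \<phi>Y
    and A :: "('r, 'a) module"
begin

sublocale resolution_pair R M X dX eX JX bX \<phi>X N Y dY eY by unfold_locales

lemma functor_XY: "tensor_functor R A (X i) (Y j)"
  using X.A.right_module_axioms X.modules Y.modules by (simp add: tensor_functor_def)

lemma tensor_chain_map:
  assumes f: "\<And>i. f i \<in> linear_maps R (X i) (Y i)"
    and comm: "\<And>i x. x \<in> carrier (X (Suc i)) \<Longrightarrow> dY i (f (Suc i) x) = f i (dX i x)"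
    and t: "t \<in> carrier (X.C (Suc i))"
  shows "Y.D i (tensor_map R A (Y (Suc i)) (f (Suc i)) t) = tensor_map R A (Y i) (f i) (X.D i t)"
proof -
  have "Y.D i (tensor_map R A (Y (Suc i)) (f (Suc i)) t) = tensor_map R A (Y i) (\<lambda>x. dY i (f (Suc i) x)) t"
    by (rule tensor_map_comp[OF X.A.right_module_axioms X.modules Y.modules Y.modules f Y.boundary_linear t])
  also have "\<dots> = tensor_map R A (Y i) (\<lambda>x. f i (dX i x)) t"
    by (rule tensor_functor.tensor_map_cong[OF functor_XY linear_map_comp[OF f Y.boundary_linear]
          linear_map_comp[OF X.boundary_linear f] comm t])
  also have "\<dots> = tensor_map R A (Y i) (f i) (X.D i t)"
    by (rule tensor_map_comp[OF X.A.right_module_axioms X.modules X.modules Y.modules X.boundary_linear f t,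
          symmetric])
  finally show ?thesis .
qed

lemma tensor_chain_map_cycles:
  assumes f: "\<And>i. f i \<in> linear_maps R (X i) (Y i)"
    and comm: "\<And>i x. x \<in> carrier (X (Suc i)) \<Longrightarrow> dY i (f (Suc i) x) = f i (dX i x)"
    and z: "z \<in> cycles X.C X.D i"
  shows "tensor_map R A (Y i) (f i) z \<in> cycles Y.C Y.D i"
proof -
  have cl: "tensor_map R A (Y i) (f i) z \<in> carrier (Y.C i)"
    by (rule tensor_functor.tensor_map_closed[OF functor_XY f X.cycles_closed[OF z]])
  show ?thesis
  proof (cases i)
    case 0
    then show ?thesis using cl by (simp add: cycles_def)
  next
    case (Suc j)
    have z': "z \<in> carrier (X.C (Suc j))" "X.D j z = \<one>\<^bsub>X.C j\<^esub>"
      using z Suc by (auto simp: X.cycles_Suc)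
    have "Y.D j (tensor_map R A (Y (Suc j)) (f (Suc j)) z) = \<one>\<^bsub>Y.C j\<^esub>"
    proof -
      have "Y.D j (tensor_map R A (Y (Suc j)) (f (Suc j)) z) = tensor_map R A (Y j) (f j) (X.D j z)"
        by (rule tensor_chain_map[OF f comm z'(1)])
      then show ?thesis
        using hom_one[OF tensor_functor.tensor_map_hom[OF functor_XY f] X.C_group Y.C_group] z'(2) by simp
    qed
    then show ?thesis using cl Suc by (simp add: Y.cycles_Suc)
  qed
qed

end

text \<open>Let \<open>f\<close> and \<open>g\<close> be chain maps over the identity of \<open>M\<close> in the two directions. As \<open>g f - 1\<close> is
  null-homotopic, a cycle \<open>z\<close> whose image \<open>f z\<close> is a boundary is a boundary itself. This injectivity of
  \<open>f\<close> on homology suffices to transfer finiteness, annihilators and vanishing.\<close>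

lemma homology_comparison:
  assumes "tensored_resolution R M X dX eX JX bX \<phi>X A" "tensored_resolution R M Y dY eY JY bY \<phi>Y A"
  shows "\<exists>\<Phi>. (\<forall>i. \<Phi> i \<in> hom (tensor R A (X i)) (tensor R A (Y i))) \<and>
    (\<forall>i. \<forall>z\<in>cycles (\<lambda>i. tensor R A (X i)) (\<lambda>i. tensor_map R A (X i) (dX i)) i.
      \<Phi> i z \<in> cycles (\<lambda>i. tensor R A (Y i)) (\<lambda>i. tensor_map R A (Y i) (dY i)) i \<and>
      (\<Phi> i z \<in> tensor_map R A (Y i) (dY i) ` carrier (tensor R A (Y (Suc i))) \<longrightarrow>
        z \<in> tensor_map R A (X i) (dX i) ` carrier (tensor R A (X (Suc i)))))"
proof -
  interpret X: tensored_resolution R M X dX eX JX bX \<phi>X A by fact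
  interpret Y: tensored_resolution R M Y dY eY JY bY \<phi>Y A by fact
  interpret XY: tensored_pair R M X dX eX JX bX \<phi>X M Y dY eY JY bY \<phi>Y A by unfold_locales
  interpret YX: tensored_pair R M Y dY eY JY bY \<phi>Y M X dX eX JX bX \<phi>X A by unfold_locales
  interpret XX: resolution_pair R M X dX eX JX bX \<phi>X M X dX eX by unfold_locales
  note id = linear_maps_id[of R M]
  obtain f where f: "\<And>i. f i \<in> linear_maps R (X i) (Y i)"
    and f0: "\<And>x. x \<in> carrier (X 0) \<Longrightarrow> eY (f 0 x) = eX x"
    and fS: "\<And>i x. x \<in> carrier (X (Suc i)) \<Longrightarrow> dY i (f (Suc i) x) = f i (dX i x)"
    using XY.chain_map_lift[OF id] by blast
  obtain g where g: "\<And>i. g i \<in> linear_maps R (Y i) (X i)"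
    and g0: "\<And>x. x \<in> carrier (Y 0) \<Longrightarrow> eX (g 0 x) = eY x"
    and gS: "\<And>i x. x \<in> carrier (Y (Suc i)) \<Longrightarrow> dX i (g (Suc i) x) = g i (dY i x)"
    using YX.chain_map_lift[OF id] by blast
  define w where "w i x = g i (f i x) \<ominus>\<^bsub>X i\<^esub> x" for i x
  note gf = linear_map_comp[OF f g]
  have w: "w i \<in> linear_maps R (X i) (X i)" for i
    unfolding w_def[abs_def] by (rule linear_maps_diffI[OF gf linear_maps_id X.modules])
  have w0: "eX (w 0 x) = \<zero>\<^bsub>M\<^esub>" if x: "x \<in> carrier (X 0)" for x
    using linear_map_diff[OF X.augmentation_linear X.modules X.M.left_module_axioms linear_map_closed[OF gf x] x]
      g0[OF linear_map_closed[OF f x]] f0[OF x] linear_map_closed[OF X.augmentation_linear x]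
    by (simp add: w_def a_minus_def X.M.M.r_neg)
  have wS: "dX i (w (Suc i) x) = w i (dX i x)" if x: "x \<in> carrier (X (Suc i))" for i x
    using linear_map_diff[OF X.boundary_linear X.modules X.modules linear_map_closed[OF gf x] x]
      gS[OF linear_map_closed[OF f x]] fS[OF x]
    by (simp add: w_def)
  obtain h where h: "\<And>i. h i \<in> linear_maps R (X i) (X (Suc i))"
    and h0: "\<And>x. x \<in> carrier (X 0) \<Longrightarrow> w 0 x = dX 0 (h 0 x)"
    and hS: "\<And>i x. x \<in> carrier (X (Suc i)) \<Longrightarrow>
      w (Suc i) x = dX (Suc i) (h (Suc i) x) \<oplus>\<^bsub>X (Suc i)\<^esub> h i (dX i x)"
    using XX.null_homotopy[OF w w0 wS] by blast
  show ?thesis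
  proof (intro exI[of _ "\<lambda>i. tensor_map R A (Y i) (f i)"] conjI allI ballI impI)
    show "tensor_map R A (Y i) (f i) \<in> hom (X.C i) (Y.C i)" for i
      by (rule tensor_functor.tensor_map_hom[OF XY.functor_XY f])
    show "tensor_map R A (Y i) (f i) z \<in> cycles Y.C Y.D i" if "z \<in> cycles X.C X.D i" for i z
      by (rule XY.tensor_chain_map_cycles[OF f fS that])
    fix i z
    assume z: "z \<in> cycles X.C X.D i" and "tensor_map R A (Y i) (f i) z \<in> Y.D i ` carrier (Y.C (Suc i))"
    then obtain s where s: "s \<in> carrier (Y.C (Suc i))" "tensor_map R A (Y i) (f i) z = Y.D i s" by blast
    interpret Ci: comm_group "X.C i" by (rule X.C_comm_group)
    have zC: "z \<in> carrier (X.C i)" by (rule X.cycles_closed[OF z])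
    let ?w = "tensor_map R A (X i) (w i) z" and ?gf = "tensor_map R A (X i) (\<lambda>x. g i (f i x)) z"
    have "?w \<in> X.B i" by (rule X.null_homotopic_cycle[OF w h h0 hS z])
    moreover have "?gf \<in> X.B i"
    proof -
      have "?gf = tensor_map R A (X i) (g i) (Y.D i s)"
        using tensor_map_comp[OF X.A.right_module_axioms X.modules Y.modules X.modules f g zC] s(2) by simp
      also have "\<dots> = X.D i (tensor_map R A (X (Suc i)) (g (Suc i)) s)"
        by (rule YX.tensor_chain_map[OF g gS s(1), symmetric])
      finally show ?thesis
        using tensor_functor.tensor_map_closed[OF YX.functor_XY g s(1)] by blast
    qed
    moreover have "?gf = ?w \<otimes>\<^bsub>X.C i\<^esub> z"
    proof -
      interpret Xi: left_module R "X i" by (rule X.modules)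
      have "g i (f i x) = w i x \<oplus>\<^bsub>X i\<^esub> x" if "x \<in> carrier (X i)" for x
        using that linear_map_closed[OF gf that] by (simp add: w_def a_minus_def Xi.a_assoc Xi.l_neg)
      then show ?thesis
        using tensor_functor.tensor_map_add[OF X.functor_at w linear_maps_id gf _ zC]
          tensor_map_id[OF X.A.right_module_axioms X.modules linear_maps_id _ zC] by simp
    qed
    ultimately have wB: "?w \<in> X.B i" and wzB: "?w \<otimes>\<^bsub>X.Z i\<^esub> z \<in> X.B i" by simp_all
    interpret Z: comm_group "X.Z i" by (rule X.Z_comm_group)
    have "?w \<in> carrier (X.Z i)" "z \<in> carrier (X.Z i)"
      using subgroup.mem_carrier[OF X.boundaries_subgroup wB] z by simp_all
    then have "z = inv\<^bsub>X.Z i\<^esub> ?w \<otimes>\<^bsub>X.Z i\<^esub> (?w \<otimes>\<^bsub>X.Z i\<^esub> z)"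
      by (simp only: Z.m_assoc[symmetric] Z.inv_closed Z.l_inv Z.l_one)
    moreover have "inv\<^bsub>X.Z i\<^esub> ?w \<otimes>\<^bsub>X.Z i\<^esub> (?w \<otimes>\<^bsub>X.Z i\<^esub> z) \<in> X.B i"
      by (intro subgroup.m_closed[OF X.boundaries_subgroup] subgroup.m_inv_closed[OF X.boundaries_subgroup] wB wzB)
    ultimately show "z \<in> X.B i" by (rule ssubst)
  qed
qed

section \<open>Integer coefficients\<close>

lemma right_module_via:
  assumes "ring R" "ring S" "\<phi> \<in> ring_hom R S"
  shows "right_module R (right_module_via S \<phi>)"
proof -
  interpret R: ring R by fact
  interpret S: ring S by fact
  interpret \<phi>: ring_hom_ring R S \<phi>
    using assms by (simp add: ring_hom_ring_def ring_hom_ring_axioms_def)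
  have ab: "abelian_group (right_module_via S \<phi>)"
    by (rule abelian_groupI) (auto simp: right_module_via_def S.a_ac intro: S.l_neg)
  show ?thesis
    by (intro right_module.intro right_module_axioms.intro ab R.ring_axioms)
      (simp_all add: right_module_via_def S.r_distr S.l_distr S.m_assoc)
qed

locale integral_tensor = finite_dual_based_tensor R P J b \<phi> "right_module_via \<Z> \<epsilon>"
  for R :: "('r, 'k) ring_scheme" (structure) and P :: "('r, 'q) module" and J :: "'j set" and b \<phi>
    and \<epsilon> :: "'r \<Rightarrow> int"
begin

abbreviation "A \<equiv> right_module_via \<Z> \<epsilon>"

lemma A_simps [simp]: "carrier A = UNIV" "x \<oplus>\<^bsub>A\<^esub> y = x + y" "\<zero>\<^bsub>A\<^esub> = 0"
  by (simp_all add: right_module_via_def)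

lemma A_pow [simp]: "x [^]\<^bsub>add_monoid A\<^esub> (n::nat) = int n * x"
  by (induction n) (simp_all add: algebra_simps nat_pow_def)

lemma p_reduced_integers:
  assumes "p > 1"
  shows "p_reduced p (add_monoid A)"
  unfolding p_reduced_def
proof (intro allI impI)
  fix D :: "nat \<Rightarrow> int"
  assume D: "\<forall>k. D k \<in> carrier (add_monoid A) \<and> D k = D (Suc k) [^]\<^bsub>add_monoid A\<^esub> p"
  have "D 0 = int p ^ k * D k" for k
  proof (induction k)
    case (Suc k)
    have "D k = int p * D (Suc k)" using D A_pow by metis
    then show ?case using Suc by simp
  qed simp
  then have "int p ^ k dvd D 0" for k by (metis dvd_triv_left)
  moreover have "\<bar>D 0\<bar> < int p ^ nat \<bar>D 0\<bar>"
  proof -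
    have "nat \<bar>D 0\<bar> < p ^ nat \<bar>D 0\<bar>" using assms by (intro power_gt_expt) simp
    then have "int (nat \<bar>D 0\<bar>) < int (p ^ nat \<bar>D 0\<bar>)" by (simp only: of_nat_less_iff)
    then show ?thesis by simp
  qed
  ultimately have "D 0 = 0" using zdvd_not_zless[of "\<bar>D 0\<bar>" "int p ^ nat \<bar>D 0\<bar>"] by fastforce
  then show "D 0 = \<one>\<^bsub>add_monoid A\<^esub>" by simp
qed

lemma pure_integer:
  assumes x: "x \<in> carrier P"
  shows "(k::int) \<otimes>\<^sub>t x = (1 \<otimes>\<^sub>t x) [^]\<^bsub>T\<^esub> k"
proof (induction k rule: int_induct[where k = 0])
  case base
  then show ?case using pure_zero_left[OF x] by simp
next
  case (step1 k)
  then show ?case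
    using pure_add_left[of k 1 x] x by (simp add: T.int_pow_mult)
next
  case (step2 k)
  have "(k - 1) \<otimes>\<^sub>t x \<otimes>\<^bsub>T\<^esub> 1 \<otimes>\<^sub>t x = (1 \<otimes>\<^sub>t x) [^]\<^bsub>T\<^esub> (k - 1) \<otimes>\<^bsub>T\<^esub> 1 \<otimes>\<^sub>t x"
    using pure_add_left[of "k - 1" 1 x] x step2 T.int_pow_mult[of "1 \<otimes>\<^sub>t x" "k - 1" 1] by simp
  then show ?case using x by simp
qed

abbreviation "e j \<equiv> 1 \<otimes>\<^sub>t b j"

lemma integral_expansion:
  assumes "t \<in> carrier T"
  shows "t = (\<Otimes>\<^bsub>T\<^esub>j\<in>J. e j [^]\<^bsub>T\<^esub> coordinate j t)"
proof -
  have "t = (\<Otimes>\<^bsub>T\<^esub>j\<in>J. coordinate j t \<otimes>\<^sub>t b j)" by (rule tensor_expansion[OF assms])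
  also have "\<dots> = (\<Otimes>\<^bsub>T\<^esub>j\<in>J. e j [^]\<^bsub>T\<^esub> coordinate j t)"
  proof (rule T.finprod_cong')
    show "coordinate j t \<otimes>\<^sub>t b j = e j [^]\<^bsub>T\<^esub> coordinate j t" if "j \<in> J" for j
      by (rule pure_integer[OF basis_closed[OF that]])
  qed auto
  finally show ?thesis .
qed

text \<open>The cokernel of \<open>1 - p u\<close> is generated by the classes of the \<open>e j\<close>, and each class is \<open>p\<close> times
  another one. Nakayama's lemma provides an annihilator that is congruent to \<open>1\<close> modulo \<open>p\<close>.\<close>

lemma almost_onto:
  assumes p: "p > 1" and u: "u \<in> hom T T"
  shows "\<exists>K. coprime K p \<and> (\<forall>t\<in>carrier T. \<exists>s\<in>carrier T. t [^]\<^bsub>T\<^esub> (K::nat) \<otimes>\<^bsub>T\<^esub> u s [^]\<^bsub>T\<^esub> p = s)"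
proof -
  let ?v = "\<lambda>t. t \<otimes>\<^bsub>T\<^esub> inv\<^bsub>T\<^esub> (u t [^]\<^bsub>T\<^esub> p)"
  have ucl: "u t \<in> carrier T" if "t \<in> carrier T" for t using hom_in_carrier[OF u that] .
  have v: "?v \<in> hom T T"
    by (rule homI) (simp_all add: ucl hom_mult[OF u] T.nat_pow_distrib T.inv_mult T.m_ac)
  then interpret v: group_hom T T ?v by (simp add: group_hom_def group_hom_axioms_def T.is_group)
  let ?S = "?v ` carrier T"
  have S: "subgroup ?S T" by (rule v.img_is_subgroup)
  let ?Q = "T Mod ?S" and ?\<pi> = "\<lambda>t. ?S #>\<^bsub>T\<^esub> t"
  interpret N: normal ?S T using S T.normal_iff_subgroup by blast
  interpret Q: comm_group ?Q by (rule T.abelian_FactGroup[OF S])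
  have \<pi>: "?\<pi> \<in> hom T ?Q" by (rule N.r_coset_hom_Mod)
  have \<pi>_cl: "?\<pi> t \<in> carrier ?Q" if "t \<in> carrier T" for t using hom_in_carrier[OF \<pi> that] .
  have \<pi>_v: "?\<pi> t = ?\<pi> (u t) [^]\<^bsub>?Q\<^esub> p" if t: "t \<in> carrier T" for t
  proof -
    have one: "?\<pi> (?v t) = \<one>\<^bsub>?Q\<^esub>" using T.coset_join2[OF _ S, of "?v t"] t by simp
    have "t = ?v t \<otimes>\<^bsub>T\<^esub> u t [^]\<^bsub>T\<^esub> p" using t ucl by (simp add: T.m_assoc)
    then have "?\<pi> t = ?\<pi> (?v t \<otimes>\<^bsub>T\<^esub> u t [^]\<^bsub>T\<^esub> p)" by (rule arg_cong)
    also have "\<dots> = ?\<pi> (?v t) \<otimes>\<^bsub>?Q\<^esub> ?\<pi> (u t [^]\<^bsub>T\<^esub> p)"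
      by (rule hom_mult[OF \<pi>]) (simp_all add: t ucl)
    also have "?\<pi> (?v t) = \<one>\<^bsub>?Q\<^esub>" by (rule one)
    also have "\<one>\<^bsub>?Q\<^esub> \<otimes>\<^bsub>?Q\<^esub> ?\<pi> (u t [^]\<^bsub>T\<^esub> p) = ?\<pi> (u t [^]\<^bsub>T\<^esub> p)"
      by (rule Q.l_one[OF \<pi>_cl]) (simp add: t ucl)
    also have "\<dots> = ?\<pi> (u t) [^]\<^bsub>?Q\<^esub> p" by (rule hom_nat_pow[OF \<pi> ucl[OF t] T.is_group Q.is_group])
    finally show ?thesis .
  qed
  have \<pi>_exp: "?\<pi> t = (\<Otimes>\<^bsub>?Q\<^esub>l\<in>J. ?\<pi> (e l) [^]\<^bsub>?Q\<^esub> coordinate l t)" if t: "t \<in> carrier T" for t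
  proof -
    have "?\<pi> t = ?\<pi> (\<Otimes>\<^bsub>T\<^esub>l\<in>J. e l [^]\<^bsub>T\<^esub> coordinate l t)"
      by (rule arg_cong[OF integral_expansion[OF t]])
    also have "\<dots> = (\<Otimes>\<^bsub>?Q\<^esub>l\<in>J. ?\<pi> (e l [^]\<^bsub>T\<^esub> coordinate l t))"
      by (rule hom_finprod[OF \<pi> tensor_comm_group Q.comm_group_axioms]) auto
    also have "\<dots> = (\<Otimes>\<^bsub>?Q\<^esub>l\<in>J. ?\<pi> (e l) [^]\<^bsub>?Q\<^esub> coordinate l t)"
      by (rule Q.finprod_cong') (auto simp: hom_int_pow[OF \<pi> _ T.is_group Q.is_group] intro!: Q.int_pow_closed \<pi>_cl)
    finally show ?thesis .
  qed
  have el: "?\<pi> (e l) \<in> carrier ?Q" if "l \<in> J" for l using that by (intro \<pi>_cl) simp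
  have "\<exists>m. int p dvd m - 1 \<and> (\<forall>j\<in>J. ?\<pi> (e j) [^]\<^bsub>?Q\<^esub> m = \<one>\<^bsub>?Q\<^esub>)"
  proof (rule Q.nakayama_elimination[OF finite_J])
    show "(\<lambda>j. ?\<pi> (e j)) \<in> J \<rightarrow> carrier ?Q" using el by auto
    fix j assume j: "j \<in> J"
    have ej: "e j \<in> carrier T" using j by simp
    have "?\<pi> (e j) [^]\<^bsub>?Q\<^esub> (1::int) = ?\<pi> (u (e j)) [^]\<^bsub>?Q\<^esub> int p"
      using \<pi>_v[OF ej] \<pi>_cl[OF ej] by (simp add: int_pow_int)
    also have "\<dots> = (\<Otimes>\<^bsub>?Q\<^esub>l\<in>J. (?\<pi> (e l) [^]\<^bsub>?Q\<^esub> coordinate l (u (e j))) [^]\<^bsub>?Q\<^esub> int p)"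
      unfolding \<pi>_exp[OF ucl[OF ej]] using el by (intro Q.int_pow_finprod) auto
    also have "\<dots> = (\<Otimes>\<^bsub>?Q\<^esub>l\<in>J. ?\<pi> (e l) [^]\<^bsub>?Q\<^esub> (int p * coordinate l (u (e j))))"
      using el by (intro Q.finprod_cong') (auto simp: Q.int_pow_pow mult.commute)
    finally show "\<exists>m c. int p dvd m - 1 \<and> ?\<pi> (e j) [^]\<^bsub>?Q\<^esub> m = (\<Otimes>\<^bsub>?Q\<^esub>l\<in>J. ?\<pi> (e l) [^]\<^bsub>?Q\<^esub> (int p * c l))"
      by (intro exI[of _ 1] exI[of _ "\<lambda>l. coordinate l (u (e j))"]) simp
  qed
  then obtain m where m: "int p dvd m - 1" "\<And>j. j \<in> J \<Longrightarrow> ?\<pi> (e j) [^]\<^bsub>?Q\<^esub> m = \<one>\<^bsub>?Q\<^esub>" by blast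
  have "coprime m (int p)"
  proof (rule coprimeI)
    fix c assume "c dvd m" "c dvd int p"
    then show "is_unit c" using dvd_diff[of c m "m - 1"] dvd_trans[OF _ m(1)] by simp
  qed
  then have "coprime (int (nat \<bar>m\<bar>)) (int p)" by simp
  then have cop: "coprime (nat \<bar>m\<bar>) p" unfolding coprime_int_iff .
  have "\<exists>s\<in>carrier T. t [^]\<^bsub>T\<^esub> nat \<bar>m\<bar> \<otimes>\<^bsub>T\<^esub> u s [^]\<^bsub>T\<^esub> p = s" if t: "t \<in> carrier T" for t
  proof -
    have "?\<pi> t [^]\<^bsub>?Q\<^esub> m = (\<Otimes>\<^bsub>?Q\<^esub>l\<in>J. (?\<pi> (e l) [^]\<^bsub>?Q\<^esub> coordinate l t) [^]\<^bsub>?Q\<^esub> m)"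
      unfolding \<pi>_exp[OF t] using el by (intro Q.int_pow_finprod) auto
    also have "\<dots> = \<one>\<^bsub>?Q\<^esub>"
    proof (rule Q.finprod_one_eqI)
      fix l assume l: "l \<in> J"
      have "(?\<pi> (e l) [^]\<^bsub>?Q\<^esub> coordinate l t) [^]\<^bsub>?Q\<^esub> m = (?\<pi> (e l) [^]\<^bsub>?Q\<^esub> m) [^]\<^bsub>?Q\<^esub> coordinate l t"
        using el[OF l] by (simp add: Q.int_pow_pow mult.commute)
      then show "(?\<pi> (e l) [^]\<^bsub>?Q\<^esub> coordinate l t) [^]\<^bsub>?Q\<^esub> m = \<one>\<^bsub>?Q\<^esub>"
        using m(2)[OF l] by (simp del: one_FactGroup)
    qed
    finally have pow_m: "?\<pi> t [^]\<^bsub>?Q\<^esub> m = \<one>\<^bsub>?Q\<^esub>" .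
    have "?\<pi> t [^]\<^bsub>?Q\<^esub> int (nat \<bar>m\<bar>) = \<one>\<^bsub>?Q\<^esub>"
    proof (cases "m \<ge> 0")
      case False
      then have "?\<pi> t [^]\<^bsub>?Q\<^esub> int (nat \<bar>m\<bar>) = inv\<^bsub>?Q\<^esub> (?\<pi> t [^]\<^bsub>?Q\<^esub> m)"
        using Q.int_pow_neg[OF \<pi>_cl[OF t], of m] by simp
      then show ?thesis unfolding pow_m by (simp del: one_FactGroup)
    qed (simp add: pow_m del: one_FactGroup)
    then have "?\<pi> t [^]\<^bsub>?Q\<^esub> nat \<bar>m\<bar> = \<one>\<^bsub>?Q\<^esub>" by (simp only: int_pow_int)
    then have "?\<pi> (t [^]\<^bsub>T\<^esub> nat \<bar>m\<bar>) = ?S"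
      using hom_nat_pow[OF \<pi> t T.is_group Q.is_group, of "nat \<bar>m\<bar>"] by (simp only: one_FactGroup)
    then have "t [^]\<^bsub>T\<^esub> nat \<bar>m\<bar> \<in> ?S" using T.coset_join1[OF _ _ S] t by blast
    then obtain s where s: "s \<in> carrier T" "t [^]\<^bsub>T\<^esub> nat \<bar>m\<bar> = ?v s" by blast
    then have "t [^]\<^bsub>T\<^esub> nat \<bar>m\<bar> \<otimes>\<^bsub>T\<^esub> u s [^]\<^bsub>T\<^esub> p = s" using ucl by (simp add: T.m_assoc)
    then show ?thesis using s(1) by blast
  qed
  then show ?thesis using cop by blast
qed

lemma torsion_free:
  assumes "t \<in> carrier T" "t [^]\<^bsub>T\<^esub> k = \<one>\<^bsub>T\<^esub>" "k > (0::nat)"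
  shows "t = \<one>\<^bsub>T\<^esub>"
proof (rule tensor_eq_one[OF assms(1)])
  fix j assume j: "j \<in> J"
  have "int k * coordinate j t = coordinate j (t [^]\<^bsub>T\<^esub> k)"
    using hom_nat_pow[OF coordinate_hom[OF j] assms(1) T.is_group A.A.a_group, of k] by (simp only: A_pow)
  also have "\<dots> = 0"
    unfolding assms(2) using hom_one[OF coordinate_hom[OF j] T.is_group A.A.a_group] by simp
  finally show "coordinate j t = \<zero>\<^bsub>A\<^esub>" using assms(3) by simp
qed

text \<open>The class of \<open>t\<close> modulo \<open>k\<close>-fold multiples, encoded by its coordinates. The value \<open>0\<close> outside \<open>J\<close>
  leaves only finitely many such functions.\<close>

definition residues :: "nat \<Rightarrow> (int \<times> 'q \<Rightarrow>\<^sub>0 int) set \<Rightarrow> 'j \<Rightarrow> int" where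
  "residues k t j = (if j \<in> J then coordinate j t mod int k else 0)"

lemma finite_residues:
  assumes "k > 0"
  shows "finite (range (residues k))"
proof (rule finite_subset)
  show "range (residues k) \<subseteq> {f. \<forall>j. (j \<in> J \<longrightarrow> f j \<in> {0..<int k}) \<and> (j \<notin> J \<longrightarrow> f j = 0)}"
    using assms by (auto simp: residues_def)
  show "finite {f. \<forall>j. (j \<in> J \<longrightarrow> f j \<in> {0..<int k}) \<and> (j \<notin> J \<longrightarrow> f j = 0)}"
    by (rule finite_set_of_finite_funs) (simp_all add: finite_J)
qed

lemma residues_eq:
  assumes "t \<in> carrier T" "t' \<in> carrier T" "residues k t = residues k t'"
  obtains c where "c \<in> carrier T" "t \<otimes>\<^bsub>T\<^esub> inv\<^bsub>T\<^esub> t' = c [^]\<^bsub>T\<^esub> k"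
proof -
  have d: "coordinate j (t \<otimes>\<^bsub>T\<^esub> inv\<^bsub>T\<^esub> t') = coordinate j t - coordinate j t'" if j: "j \<in> J" for j
  proof -
    have "t \<otimes>\<^bsub>T\<^esub> inv\<^bsub>T\<^esub> t' \<otimes>\<^bsub>T\<^esub> t' = t" using assms by (simp add: T.m_assoc)
    then have "coordinate j (t \<otimes>\<^bsub>T\<^esub> inv\<^bsub>T\<^esub> t') + coordinate j t' = coordinate j t"
      using hom_mult[OF coordinate_hom[OF j], of "t \<otimes>\<^bsub>T\<^esub> inv\<^bsub>T\<^esub> t'" t'] assms by simp
    then show ?thesis by simp
  qed
  have "int k dvd coordinate j t - coordinate j t'" if "j \<in> J" for j
    using that fun_cong[OF assms(3), of j] by (simp add: residues_def mod_eq_dvd_iff)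
  then have "\<forall>j\<in>J. \<exists>q. coordinate j t - coordinate j t' = q * int k" by (metis dvdE mult.commute)
  then obtain q where q: "\<And>j. j \<in> J \<Longrightarrow> coordinate j t - coordinate j t' = q j * int k" by metis
  let ?c = "\<Otimes>\<^bsub>T\<^esub>j\<in>J. e j [^]\<^bsub>T\<^esub> q j"
  have "t \<otimes>\<^bsub>T\<^esub> inv\<^bsub>T\<^esub> t' = (\<Otimes>\<^bsub>T\<^esub>j\<in>J. e j [^]\<^bsub>T\<^esub> coordinate j (t \<otimes>\<^bsub>T\<^esub> inv\<^bsub>T\<^esub> t'))"
    using assms by (intro integral_expansion) simp
  also have "\<dots> = (\<Otimes>\<^bsub>T\<^esub>j\<in>J. (e j [^]\<^bsub>T\<^esub> q j) [^]\<^bsub>T\<^esub> int k)"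
    by (intro T.finprod_cong') (auto simp: d q T.int_pow_pow intro!: T.int_pow_closed)
  also have "\<dots> = ?c [^]\<^bsub>T\<^esub> int k" by (rule T.int_pow_finprod[symmetric]) auto
  finally have "t \<otimes>\<^bsub>T\<^esub> inv\<^bsub>T\<^esub> t' = ?c [^]\<^bsub>T\<^esub> k" by (simp add: int_pow_int)
  moreover have "?c \<in> carrier T" by (rule T.finprod_closed) auto
  ultimately show thesis by (rule that[rotated])
qed

end

section \<open>Groups with stable powers of a prime\<close>

lemma (in comm_group) power_image_subgroup: "subgroup (power_image p i G) G"
proof -
  have "(\<lambda>x. x [^] (p ^ i)) \<in> hom G G" by (simp add: hom_def nat_pow_distrib)
  then interpret h: group_hom G G "\<lambda>x. x [^] (p ^ i)"
    by (simp add: group_hom_def group_hom_axioms_def is_group)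
  show ?thesis unfolding power_image_def by (rule h.img_is_subgroup)
qed

locale p_stable_group = comm_group G for G (structure) +
  fixes p n0 :: nat
  assumes stable: "\<And>i. i \<ge> n0 \<Longrightarrow> power_image p i G = power_image p n0 G"
begin

abbreviation "stable_part \<equiv> power_image p n0 G"

lemma stable_part_closed: "x \<in> stable_part \<Longrightarrow> x \<in> carrier G"
  by (rule subgroup.mem_carrier[OF power_image_subgroup])

lemma stable_part_divisible:
  assumes "x \<in> stable_part"
  obtains y where "y \<in> stable_part" "y [^] (p ^ k) = x"
proof -
  obtain z where z: "z \<in> carrier G" "x = z [^] (p ^ (n0 + k))"
    using assms stable[of "n0 + k"] unfolding power_image_def by auto
  then have "z [^] (p ^ n0) \<in> stable_part" "(z [^] (p ^ n0)) [^] (p ^ k) = x"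
    by (auto simp: power_image_def nat_pow_pow power_add)
  then show thesis by (rule that)
qed

lemma stable_part_root:
  assumes "x \<in> stable_part"
  obtains y where "y \<in> stable_part" "y [^] p = x"
  using stable_part_divisible[OF assms, of 1] by auto

lemma stable_part_sequence:
  assumes "x \<in> stable_part"
  obtains D where "D (0::nat) = x" "\<And>k. D k \<in> stable_part" "\<And>k. D (Suc k) [^] p = D k"
proof -
  have "\<exists>D. \<forall>k. (D k \<in> stable_part \<and> (k = 0 \<longrightarrow> D k = x)) \<and> D (Suc k) [^] p = D k"
  proof (rule dependent_nat_choice)
    fix y and k :: nat
    assume "y \<in> stable_part \<and> (k = 0 \<longrightarrow> y = x)"
    then show "\<exists>y'. (y' \<in> stable_part \<and> (Suc k = 0 \<longrightarrow> y' = x)) \<and> y' [^] p = y"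
      using stable_part_root[of y] by auto
  qed (use assms in auto)
  then show thesis using that by blast
qed

lemma torsion_subgroup: "subgroup {x \<in> carrier G. x [^] (p ^ n) = \<one>} G"
  by (rule subgroupI) (auto simp: nat_pow_inv nat_pow_distrib intro!: exI[of _ \<one>])

lemma torsion_group: "group (torsion_part p n G)"
  unfolding torsion_part_def by (rule subgroup.subgroup_is_group[OF torsion_subgroup is_group])

lemma torsion_part_simps [simp]:
  "carrier (torsion_part p n G) = {x \<in> carrier G. x [^] (p ^ n) = \<one>}"
  "x \<otimes>\<^bsub>torsion_part p n G\<^esub> y = x \<otimes> y"
  "\<one>\<^bsub>torsion_part p n G\<^esub> = \<one>"
  by (simp_all add: torsion_part_def)

lemma torsion_part_inv: "\<lbrakk>x \<in> carrier G; x [^] (p ^ n) = \<one>\<rbrakk> \<Longrightarrow> inv\<^bsub>torsion_part p n G\<^esub> x = inv x"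
  unfolding torsion_part_def by (rule m_inv_consistent[OF torsion_subgroup]) simp

lemma pow_p_torsion:
  "\<lbrakk>x \<in> carrier G; x [^] (p ^ Suc n) = \<one>\<rbrakk> \<Longrightarrow> (x [^] p) [^] (p ^ n) = \<one>"
  by (simp add: nat_pow_pow)

text \<open>In additive notation \<open>z n = y n + p y (n + 1) + \<dots> + p\<^sup>m\<^sup>-\<^sup>1 y (n + m - 1)\<close>. So modulo the image of the map that
  defines the derived limit, \<open>y\<close> equals the sequence of the \<open>p\<^sup>m y (n + m)\<close>.\<close>

lemma torsion_telescope:
  assumes "\<And>n. y n \<in> carrier G" "\<And>n. y n [^] (p ^ n) = \<one>"
  obtains z where "\<And>n. z n \<in> carrier G" "\<And>n. z n [^] (p ^ n) = \<one>"
    "\<And>n. y n \<otimes> z (Suc n) [^] p = z n \<otimes> y (n + m) [^] (p ^ m)"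
proof -
  have "\<exists>z. \<forall>n. z n \<in> carrier G \<and> z n [^] (p ^ n) = \<one> \<and> y n \<otimes> z (Suc n) [^] p = z n \<otimes> y (n + m) [^] (p ^ m)"
  proof (induction m)
    case 0
    show ?case using assms by (intro exI[of _ "\<lambda>_. \<one>"]) simp
  next
    case (Suc m)
    then obtain z where z: "\<And>n. z n \<in> carrier G" "\<And>n. z n [^] (p ^ n) = \<one>"
      "\<And>n. y n \<otimes> z (Suc n) [^] p = z n \<otimes> y (n + m) [^] (p ^ m)" by blast
    let ?z = "\<lambda>n. z n \<otimes> y (n + m) [^] (p ^ m)"
    have "y n \<otimes> ?z (Suc n) [^] p = ?z n \<otimes> y (n + Suc m) [^] (p ^ Suc m)" for n
    proof -
      have "y n \<otimes> ?z (Suc n) [^] p = (y n \<otimes> z (Suc n) [^] p) \<otimes> y (n + Suc m) [^] (p ^ Suc m)"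
        using z(1) assms(1) by (simp add: nat_pow_distrib nat_pow_pow m_assoc mult.commute)
      then show ?thesis by (simp only: z(3))
    qed
    moreover have "?z n [^] (p ^ n) = \<one>" for n
      using z(1,2) assms(1) assms(2)[of "n + m"]
      by (simp add: nat_pow_distrib nat_pow_pow power_add mult.commute)
    ultimately show ?case using z(1) assms(1) by (intro exI[of _ ?z]) simp
  qed
  then show thesis using that by blast
qed

text \<open>By telescoping with \<open>m = n0\<close> the sequence \<open>y\<close> may be replaced by a sequence \<open>y'\<close> in the stable part. There
  \<open>x (n + 1)\<close> is found from \<open>x n\<close> as a \<open>p\<close>-th root of \<open>x n - y' n\<close>, and it is torsion of the right order
  because \<open>x n\<close> and \<open>y' n\<close> are.\<close>

lemma lim1_torsion_surj:
  assumes y: "\<And>n. y n \<in> carrier G" "\<And>n. y n [^] (p ^ n) = \<one>"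
  obtains x where "\<And>n. x n \<in> carrier G" "\<And>n. x n [^] (p ^ n) = \<one>"
    "\<And>n. y n = x n \<otimes> inv (x (Suc n) [^] p)"
proof -
  obtain z where z: "\<And>n. z n \<in> carrier G" "\<And>n. z n [^] (p ^ n) = \<one>"
    "\<And>n. y n \<otimes> z (Suc n) [^] p = z n \<otimes> y (n + n0) [^] (p ^ n0)"
    using torsion_telescope[OF y, where m = n0] by blast
  define y' where "y' n = y (n + n0) [^] (p ^ n0)" for n
  have y': "y' n \<in> stable_part" "y' n \<in> carrier G" "y' n [^] (p ^ n) = \<one>" for n
    using y(1) y(2)[of "n + n0"]
    by (auto simp: y'_def power_image_def nat_pow_pow power_add mult.commute)
  have "\<exists>x. \<forall>n. (x n \<in> stable_part \<and> x n [^] (p ^ n) = \<one>) \<and> y' n \<otimes> x (Suc n) [^] p = x n"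
  proof (rule dependent_nat_choice)
    show "\<exists>x. x \<in> stable_part \<and> x [^] (p ^ 0) = \<one>"
      using subgroup.one_closed[OF power_image_subgroup] by (intro exI[of _ \<one>]) simp
    fix x n assume x: "x \<in> stable_part \<and> x [^] (p ^ n) = \<one>"
    then have xG: "x \<in> carrier G" using stable_part_closed by blast
    have "inv (y' n) \<otimes> x \<in> stable_part"
      using x y'(1) subgroup.m_closed[OF power_image_subgroup] subgroup.m_inv_closed[OF power_image_subgroup]
      by blast
    then obtain x' where x': "x' \<in> stable_part" "x' [^] p = inv (y' n) \<otimes> x"
      by (rule stable_part_root)
    have "x' [^] (p ^ Suc n) = (x' [^] p) [^] (p ^ n)"
      using stable_part_closed[OF x'(1)] by (simp add: nat_pow_pow)
    also have "\<dots> = \<one>"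
      unfolding x'(2) using x xG y' by (simp add: nat_pow_distrib nat_pow_inv)
    finally have "x' [^] (p ^ Suc n) = \<one>" .
    moreover have "y' n \<otimes> x' [^] p = x"
      unfolding x'(2) using xG y'(2) by (simp add: m_assoc[symmetric])
    ultimately show "\<exists>x'. (x' \<in> stable_part \<and> x' [^] (p ^ Suc n) = \<one>) \<and> y' n \<otimes> x' [^] p = x"
      using x'(1) by blast
  qed
  then obtain x where x: "\<And>n. x n \<in> stable_part" "\<And>n. x n [^] (p ^ n) = \<one>"
    "\<And>n. y' n \<otimes> x (Suc n) [^] p = x n" by blast
  have xG: "x n \<in> carrier G" for n using stable_part_closed[OF x(1)] .
  show thesis
  proof (rule that[of "\<lambda>n. z n \<otimes> x n"])
    show "z n \<otimes> x n \<in> carrier G" for n using z(1) xG by simp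
    show "(z n \<otimes> x n) [^] (p ^ n) = \<one>" for n using z xG x(2) by (simp add: nat_pow_distrib)
    fix n
    have "y n \<otimes> (z (Suc n) \<otimes> x (Suc n)) [^] p = (y n \<otimes> z (Suc n) [^] p) \<otimes> x (Suc n) [^] p"
      using z(1) xG y(1) by (simp add: nat_pow_distrib m_assoc)
    also have "\<dots> = z n \<otimes> (y' n \<otimes> x (Suc n) [^] p)"
      using z(1) xG y'(2) by (simp add: z(3) flip: y'_def) (simp add: m_assoc)
    also have "\<dots> = z n \<otimes> x n" by (simp only: x(3))
    finally show "y n = (z n \<otimes> x n) \<otimes> inv ((z (Suc n) \<otimes> x (Suc n)) [^] p)"
      using z(1) xG y(1) by (simp add: inv_solve_right)
  qed
qed

lemma lim1_trivial: "trivial_group (torsion_limit1 p G)"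
proof -
  let ?T = "\<lambda>n. torsion_part p n G"
  let ?\<Pi> = "product_group UNIV ?T"
  interpret P: group ?\<Pi> using torsion_group by simp
  have carrier_iff: "x \<in> carrier ?\<Pi> \<longleftrightarrow> (\<forall>n. x n \<in> carrier G \<and> x n [^] (p ^ n) = \<one>)" for x
    by (auto simp: PiE_iff)
  let ?f = "\<lambda>x n. x n \<otimes>\<^bsub>?T n\<^esub> inv\<^bsub>?T n\<^esub> (x (Suc n) [^] p)"
  have tor: "x (Suc n) [^] p \<in> carrier G \<and> (x (Suc n) [^] p) [^] (p ^ n) = \<one>" if "x \<in> carrier ?\<Pi>" for x n
    using that pow_p_torsion[of "x (Suc n)" n] unfolding carrier_iff by blast
  have f: "?f x = (\<lambda>n. x n \<otimes> inv (x (Suc n) [^] p))" if "x \<in> carrier ?\<Pi>" for x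
    using tor[OF that] by (intro ext) (simp add: torsion_part_inv)
  have "?f ` carrier ?\<Pi> = carrier ?\<Pi>"
  proof (intro equalityI subsetI)
    fix y assume "y \<in> ?f ` carrier ?\<Pi>"
    then obtain x where x: "x \<in> carrier ?\<Pi>" "y = ?f x" by blast
    have "\<forall>n. y n \<in> carrier G \<and> y n [^] (p ^ n) = \<one>"
      unfolding x(2) f[OF x(1)] using tor[OF x(1)] x(1) unfolding carrier_iff
      by (simp add: nat_pow_distrib nat_pow_inv)
    then show "y \<in> carrier ?\<Pi>" unfolding carrier_iff .
  next
    fix y assume "y \<in> carrier ?\<Pi>"
    then obtain x where x: "\<And>n. x n \<in> carrier G" "\<And>n. x n [^] (p ^ n) = \<one>"
      "\<And>n. y n = x n \<otimes> inv (x (Suc n) [^] p)"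
      using lim1_torsion_surj[of y] unfolding carrier_iff by blast
    then have "x \<in> carrier ?\<Pi>" unfolding carrier_iff by simp
    then show "y \<in> ?f ` carrier ?\<Pi>" using f x(3) by (intro image_eqI[of _ _ x]) auto
  qed
  then have *: "torsion_limit1 p G = ?\<Pi> Mod carrier ?\<Pi>"
    by (simp add: torsion_limit1_def inverse_limit1_def)
  have "group (?\<Pi> Mod carrier ?\<Pi>)" by (rule normal.factorgroup_is_group[OF P.normal_self])
  moreover have "carrier (?\<Pi> Mod carrier ?\<Pi>) = {carrier ?\<Pi>}"
    unfolding carrier_FactGroup using P.coset_join2[OF _ P.subgroup_self] P.one_closed by blast
  ultimately show ?thesis unfolding * by (simp add: trivial_group_def)
qed

text \<open>Successive \<open>p\<close>-th roots of \<open>x\<close>, preceded by the neutral element, form an element of the limit of the torsion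
  groups.\<close>

lemma lim_trivial_torsion:
  assumes lim: "trivial_group (torsion_limit p G)" and x: "x \<in> stable_part" "x [^] p = \<one>"
  shows "x = \<one>"
proof -
  obtain D where D: "D 0 = x" "\<And>k. D k \<in> stable_part" "\<And>k. D (Suc k) [^] p = D k"
    using stable_part_sequence[OF x(1)] by blast
  \<comment> \<open>The shift by one index turns \<open>p x = 0\<close> into the transition from \<open>E 1\<close> to \<open>E 0\<close>.\<close>
  define E where "E n = (case n of 0 \<Rightarrow> \<one> | Suc k \<Rightarrow> D k)" for n
  have EG: "E n \<in> carrier G" for n using stable_part_closed[OF D(2)] by (cases n) (simp_all add: E_def)
  have E: "E (Suc n) [^] p = E n" for n
    using D x(2) by (cases n) (simp_all add: E_def)
  have tor: "E n [^] (p ^ n) = \<one>" for n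
  proof (induction n)
    case (Suc n)
    have "E (Suc n) [^] (p ^ Suc n) = (E (Suc n) [^] p) [^] (p ^ n)" using EG by (simp add: nat_pow_pow)
    then show ?case using Suc by (simp only: E)
  qed (simp add: E_def)
  have "E \<in> carrier (torsion_limit p G)"
    using EG E tor by (simp add: torsion_limit_def inverse_limit_def PiE_iff)
  then have "E = \<one>\<^bsub>torsion_limit p G\<^esub>" using lim by (auto simp: trivial_group_def)
  then have "E 1 = \<one>" by (simp add: torsion_limit_def inverse_limit_def)
  then show ?thesis using D(1) by (simp add: E_def)
qed

lemma stable_part_torsion_free:
  assumes lim: "trivial_group (torsion_limit p G)"
  shows "\<lbrakk>x \<in> stable_part; x [^] (p ^ k) = \<one>\<rbrakk> \<Longrightarrow> x = \<one>"
proof (induction k arbitrary: x)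
  case 0
  then show ?case using stable_part_closed by simp
next
  case (Suc k)
  have xG: "x \<in> carrier G" using Suc.prems(1) stable_part_closed by blast
  obtain y where "y \<in> carrier G" "x = y [^] (p ^ n0)" using Suc.prems(1) by (auto simp: power_image_def)
  then have "x [^] p = (y [^] p) [^] (p ^ n0)" "y [^] p \<in> carrier G"
    by (simp_all add: nat_pow_pow mult.commute)
  then have "x [^] p \<in> stable_part" by (auto simp: power_image_def)
  moreover have "(x [^] p) [^] (p ^ k) = \<one>" using Suc.prems(2) xG by (simp add: nat_pow_pow)
  ultimately have "x [^] p = \<one>" by (rule Suc.IH)
  then show ?case by (rule lim_trivial_torsion[OF lim Suc.prems(1)])
qed

lemma stable_part_root_unique:
  assumes lim: "trivial_group (torsion_limit p G)"
    and "x \<in> stable_part" "y \<in> stable_part" "x [^] (p ^ k) = y [^] (p ^ k)"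
  shows "x = y"
proof -
  have G: "x \<in> carrier G" "y \<in> carrier G" using assms(2,3) stable_part_closed by auto
  have "x \<otimes> inv y \<in> stable_part"
    using assms(2,3) subgroup.m_closed[OF power_image_subgroup] subgroup.m_inv_closed[OF power_image_subgroup]
    by blast
  moreover have "(x \<otimes> inv y) [^] (p ^ k) = \<one>"
    using G assms(4) by (simp add: nat_pow_distrib nat_pow_inv)
  ultimately have "x \<otimes> inv y = \<one>" by (rule stable_part_torsion_free[OF lim])
  then show ?thesis using G inv_solve_right'[of \<one> x y] by simp
qed

end

text \<open>On the stable part \<open>N\<close> multiplication by \<open>p ^ (n0 + 1)\<close> is bijective, and \<open>\<psi>\<close> is the composite of \<open>p ^ n0\<close> from
  \<open>M\<close> to \<open>N\<close> with its inverse; linearity comes from the uniqueness of roots. The map \<open>p \<psi>\<close> is a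
  projection of \<open>M\<close> onto \<open>N\<close>.\<close>

lemma divided_projection:
  fixes R :: "('r, 'k) ring_scheme" and M :: "('r, 'm) module" and p n0 :: nat
  assumes "left_module R M"
    and stable: "\<And>i. i \<ge> n0 \<Longrightarrow> power_image p i (add_monoid M) = power_image p n0 (add_monoid M)"
    and lim: "trivial_group (torsion_limit p (add_monoid M))"
  obtains \<psi> where "\<psi> \<in> linear_maps R M M"
    "\<And>x. x \<in> carrier M \<Longrightarrow> [(p ^ n0)] \<cdot>\<^bsub>M\<^esub> x = [(p ^ n0)] \<cdot>\<^bsub>M\<^esub> ([p] \<cdot>\<^bsub>M\<^esub> \<psi> x)"
proof -
  interpret M: left_module R M by fact
  let ?G = "add_monoid M"
  interpret S: p_stable_group ?G p n0
    by (intro p_stable_group.intro p_stable_group_axioms.intro M.a_comm_group stable)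
  have ex: "\<exists>y. y \<in> S.stable_part \<and> y [^]\<^bsub>?G\<^esub> (p ^ Suc n0) = x [^]\<^bsub>?G\<^esub> (p ^ n0)" if "x \<in> carrier M" for x
    using S.stable_part_divisible[of "x [^]\<^bsub>?G\<^esub> (p ^ n0)" "Suc n0"] that by (auto simp: power_image_def)
  define \<psi> where "\<psi> x = (SOME y. y \<in> S.stable_part \<and> y [^]\<^bsub>?G\<^esub> (p ^ Suc n0) = x [^]\<^bsub>?G\<^esub> (p ^ n0))" for x
  have \<psi>: "\<psi> x \<in> S.stable_part" "\<psi> x [^]\<^bsub>?G\<^esub> (p ^ Suc n0) = x [^]\<^bsub>?G\<^esub> (p ^ n0)" if "x \<in> carrier M" for x
    using someI_ex[OF ex[OF that]] unfolding \<psi>_def by auto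
  have \<psi>M: "\<psi> x \<in> carrier M" if "x \<in> carrier M" for x using S.stable_part_closed[OF \<psi>(1)[OF that]] by simp
  have \<psi>_eq: "\<psi> x = y" if "x \<in> carrier M" "y \<in> S.stable_part" "y [^]\<^bsub>?G\<^esub> (p ^ Suc n0) = x [^]\<^bsub>?G\<^esub> (p ^ n0)" for x y
    using S.stable_part_root_unique[OF lim \<psi>(1)[OF that(1)] that(2), of "Suc n0"] \<psi>(2)[OF that(1)] that(3) by simp
  show thesis
  proof (rule that)
    show "\<psi> \<in> linear_maps R M M"
    proof (rule linear_mapsI)
      fix x y assume xy: "x \<in> carrier M" "y \<in> carrier M"
      show "\<psi> (x \<oplus>\<^bsub>M\<^esub> y) = \<psi> x \<oplus>\<^bsub>M\<^esub> \<psi> y"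
      proof (rule \<psi>_eq)
        show "\<psi> x \<oplus>\<^bsub>M\<^esub> \<psi> y \<in> S.stable_part"
          using subgroup.m_closed[OF comm_group.power_image_subgroup[OF M.a_comm_group] \<psi>(1)[OF xy(1)] \<psi>(1)[OF xy(2)]] by simp
        show "(\<psi> x \<oplus>\<^bsub>M\<^esub> \<psi> y) [^]\<^bsub>?G\<^esub> (p ^ Suc n0) = (x \<oplus>\<^bsub>M\<^esub> y) [^]\<^bsub>?G\<^esub> (p ^ n0)"
          using comm_monoid.nat_pow_distrib[OF M.a_comm_monoid, of "\<psi> x" "\<psi> y" "p ^ Suc n0"]
            comm_monoid.nat_pow_distrib[OF M.a_comm_monoid, of x y "p ^ n0"] xy \<psi>M
          by (simp only: monoid.simps partial_object.simps \<psi>(2))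
      qed (use xy in simp)
    next
      fix r x assume rx: "r \<in> carrier R" "x \<in> carrier M"
      have pow: "r \<odot>\<^bsub>M\<^esub> (z [^]\<^bsub>?G\<^esub> (n::nat)) = (r \<odot>\<^bsub>M\<^esub> z) [^]\<^bsub>?G\<^esub> n" if "z \<in> carrier M" for z n
        using M.smult_nat_mult[OF rx(1) that, of n] by (simp add: add_pow_def)
      show "\<psi> (r \<odot>\<^bsub>M\<^esub> x) = r \<odot>\<^bsub>M\<^esub> \<psi> x"
      proof (rule \<psi>_eq)
        obtain z where z: "z \<in> carrier M" "\<psi> x = z [^]\<^bsub>?G\<^esub> (p ^ n0)"
          using \<psi>(1)[OF rx(2)] by (auto simp: power_image_def)
        show "r \<odot>\<^bsub>M\<^esub> \<psi> x \<in> S.stable_part"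
          unfolding z(2) pow[OF z(1)] using z(1) rx(1) by (auto simp: power_image_def M.smult_closed)
        show "(r \<odot>\<^bsub>M\<^esub> \<psi> x) [^]\<^bsub>?G\<^esub> (p ^ Suc n0) = (r \<odot>\<^bsub>M\<^esub> x) [^]\<^bsub>?G\<^esub> (p ^ n0)"
          using rx \<psi>M by (simp only: pow[symmetric] \<psi>(2))
      qed (use rx in \<open>simp add: M.smult_closed\<close>)
    qed (rule \<psi>M)
    fix x assume x: "x \<in> carrier M"
    have "(\<psi> x [^]\<^bsub>?G\<^esub> p) [^]\<^bsub>?G\<^esub> (p ^ n0) = x [^]\<^bsub>?G\<^esub> (p ^ n0)"
      using monoid.nat_pow_pow[OF M.a_monoid, of "\<psi> x" p "p ^ n0"] \<psi>M[OF x] \<psi>(2)[OF x] by simp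
    then show "[(p ^ n0)] \<cdot>\<^bsub>M\<^esub> x = [(p ^ n0)] \<cdot>\<^bsub>M\<^esub> ([p] \<cdot>\<^bsub>M\<^esub> \<psi> x)"
      by (simp add: add_pow_def)
  qed
qed

section \<open>Finiteness of Tor\<close>

text \<open>The resolution \<open>P\<close> has finitely generated terms, whereas Tor is computed from the canonical resolution;
  \<open>\<Phi>\<close> compares the two. Some multiple \<open>K q\<close> with \<open>K\<close> prime to \<open>p\<close> annihilates the homology of \<open>\<int> \<otimes> P\<close>.
  If the images under \<open>\<Phi>\<close> of two cycles agree modulo \<open>K q\<close>, then they differ by \<open>K q c\<close> for some \<open>c\<close>, which
  is a cycle because the chain groups are torsion-free. So \<open>K q c\<close> is a boundary, and the two cycles are
  homologous. Hence there are at most as many classes as residues modulo \<open>K q\<close>. The bound on the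
  \<open>p\<close>-primary part follows from \<open>K\<close> being prime to \<open>p\<close>.\<close>

lemma Tor_finite:
  fixes R :: "('r, 'k) ring_scheme" and M :: "('r, 'm) module" and P :: "nat \<Rightarrow> ('r, 'q) module"
    and p q :: nat
  assumes res: "based_resolution R M P \<delta> \<eta> J b \<phi>" "\<And>i. finite (J i)"
    and \<epsilon>: "\<epsilon> \<in> ring_hom R \<Z>" and p: "p > 1" and q: "q > 0"
    and \<psi>: "\<psi> \<in> linear_maps R M M"
    and split: "\<And>x. x \<in> carrier M \<Longrightarrow> [q] \<cdot>\<^bsub>M\<^esub> x = [q] \<cdot>\<^bsub>M\<^esub> ([p] \<cdot>\<^bsub>M\<^esub> \<psi> x)"
  defines "T \<equiv> Tor R (right_module_via \<Z> \<epsilon>) M"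
  shows "finite (carrier (T i))"
    and "\<lbrakk>x \<in> carrier (T i); x [^]\<^bsub>T i\<^esub> (p ^ k) = \<one>\<^bsub>T i\<^esub>\<rbrakk> \<Longrightarrow> x [^]\<^bsub>T i\<^esub> q = \<one>\<^bsub>T i\<^esub>"
    and "carrier (P i) = {\<zero>\<^bsub>P i\<^esub>} \<Longrightarrow> trivial_group (T i)"
proof -
  let ?A = "right_module_via \<Z> \<epsilon>"
  interpret P: based_resolution R M P \<delta> \<eta> J b \<phi> by fact
  interpret F: canonical_resolution R M by unfold_locales
  interpret A: right_module R ?A
    by (rule right_module_via[OF _ _ \<epsilon>]) (simp_all add: P.M.R.ring_axioms int.ring_axioms cring.axioms(1)[OF int_is_cring])
  interpret P: finite_tensored_resolution R M P \<delta> \<eta> J b \<phi> ?A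
    using res(2) by unfold_locales
  interpret X: based_resolution R M F.F "\<lambda>_. res_boundary R" "res_augmentation R M"
    "res_basis R M" "\<lambda>_. basis_vector R" "\<lambda>_ b c. c b"
    by (rule F.free_resolution)
  interpret X: tensored_resolution R M F.F "\<lambda>_. res_boundary R" "res_augmentation R M"
    "res_basis R M" "\<lambda>_. basis_vector R" "\<lambda>_ b c. c b" ?A
    by unfold_locales
  have T: "T = X.H" by (intro ext) (simp add: T_def Tor_def)
  obtain \<Phi> where "(\<forall>i. \<Phi> i \<in> hom (X.C i) (P.C i)) \<and>
    (\<forall>i. \<forall>z\<in>cycles X.C X.D i. \<Phi> i z \<in> cycles P.C P.D i \<and> (\<Phi> i z \<in> P.B i \<longrightarrow> z \<in> X.B i))"
    using homology_comparison[OF X.tensored_resolution_axioms P.tensored_resolution_axioms] by (rule exE)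
  then have \<Phi>: "\<Phi> i \<in> hom (X.C i) (P.C i)"
    "z \<in> cycles X.C X.D i \<Longrightarrow> \<Phi> i z \<in> cycles P.C P.D i"
    "\<lbrakk>z \<in> cycles X.C X.D i; \<Phi> i z \<in> P.B i\<rbrakk> \<Longrightarrow> z \<in> X.B i" for i z
    by simp_all
  have I: "integral_tensor R (P i) (J i) (b i) (\<phi> i) \<epsilon>" for i
    unfolding integral_tensor_def by (rule P.based_tensor)
  have bounded: "\<exists>K. coprime K p \<and> (\<forall>z\<in>cycles P.C P.D i. z [^]\<^bsub>P.C i\<^esub> (K * q) \<in> P.B i)" for i
  proof (rule P.cycle_power_is_boundary[OF \<psi> split, where good = "\<lambda>K. coprime K p" and i = i])
    show "p_reduced p (add_monoid ?A)" by (rule integral_tensor.p_reduced_integers[OF I p])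
    show "\<exists>K. coprime K p \<and> (\<forall>t\<in>carrier (P.C i). \<exists>s\<in>carrier (P.C i).
        t [^]\<^bsub>P.C i\<^esub> (K::nat) \<otimes>\<^bsub>P.C i\<^esub> u s [^]\<^bsub>P.C i\<^esub> p = s)"
      if "u \<in> hom (P.C i) (P.C i)" for u
      by (rule integral_tensor.almost_onto[OF I p that])
    fix K
    assume "coprime K p" "\<And>z. z \<in> cycles P.C P.D i \<Longrightarrow> z [^]\<^bsub>P.C i\<^esub> (K * q) \<in> P.B i"
    then show ?thesis by (intro exI[of _ K] conjI ballI)
  qed
  have \<Phi>_pow: "z [^]\<^bsub>X.C i\<^esub> n \<in> X.B i"
    if z: "z \<in> cycles X.C X.D i" and B: "\<Phi> i z [^]\<^bsub>P.C i\<^esub> n \<in> P.B i" for i z and n :: nat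
  proof (rule \<Phi>(3))
    interpret Z: comm_group "X.Z i" by (rule X.Z_comm_group)
    have "z [^]\<^bsub>X.C i\<^esub> n = z [^]\<^bsub>X.Z i\<^esub> n"
      using monoid.nat_pow_consistent[OF group.is_monoid[OF X.C_group]] by blast
    then show "z [^]\<^bsub>X.C i\<^esub> n \<in> cycles X.C X.D i"
      using Z.nat_pow_closed[of z n] z by simp
    show "\<Phi> i (z [^]\<^bsub>X.C i\<^esub> n) \<in> P.B i"
      using B hom_nat_pow[OF \<Phi>(1) X.cycles_closed[OF z] X.C_group P.C_group] by simp
  qed
  show "finite (carrier (T i))"
  proof -
    obtain K where K: "coprime K p" "\<And>z. z \<in> cycles P.C P.D i \<Longrightarrow> z [^]\<^bsub>P.C i\<^esub> (K * q) \<in> P.B i"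
      using bounded by blast
    have "K > 0" using K(1) p by (cases K) auto
    then have N: "K * q > 0" using q by simp
    \<comment> \<open>A map on cycles with finitely many values that determines the homology class.\<close>
    let ?code = "\<lambda>z. integral_tensor.residues (J i) (\<phi> i) \<epsilon> (K * q) (\<Phi> i z)"
    have code: "X.cls i z = X.cls i z'"
      if z: "z \<in> cycles X.C X.D i" "z' \<in> cycles X.C X.D i" and eq: "?code z = ?code z'" for z z'
    proof (rule X.class_eq[OF z])
      interpret Xi: comm_group "X.C i" by (rule X.C_comm_group)
      interpret Pi: comm_group "P.C i" by (rule P.C_comm_group)
      let ?d = "z \<otimes>\<^bsub>X.C i\<^esub> inv\<^bsub>X.C i\<^esub> z'"
      have cl: "z \<in> carrier (X.C i)" "z' \<in> carrier (X.C i)" using X.cycles_closed z by auto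
      have d_cyc: "?d \<in> cycles X.C X.D i"
        using z by (intro subgroup.m_closed[OF X.cycles_subgroup] subgroup.m_inv_closed[OF X.cycles_subgroup])
      interpret \<Phi>: group_hom "X.C i" "P.C i" "\<Phi> i"
        by (simp add: group_hom_def group_hom_axioms_def \<Phi>(1) X.C_group P.C_group)
      obtain c where c: "c \<in> carrier (P.C i)" "\<Phi> i z \<otimes>\<^bsub>P.C i\<^esub> inv\<^bsub>P.C i\<^esub> \<Phi> i z' = c [^]\<^bsub>P.C i\<^esub> (K * q)"
        using integral_tensor.residues_eq[OF I \<Phi>.hom_closed[OF cl(1)] \<Phi>.hom_closed[OF cl(2)] eq] by blast
      have \<Phi>d: "\<Phi> i ?d = c [^]\<^bsub>P.C i\<^esub> (K * q)" using c(2) cl by simp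
      have "c \<in> cycles P.C P.D i"
      proof (cases i)
        case 0
        then show ?thesis using c(1) by (simp add: cycles_def)
      next
        case (Suc j)
        have c': "c \<in> carrier (P.C (Suc j))" using c(1) Suc by simp
        have "P.D j c [^]\<^bsub>P.C j\<^esub> (K * q) = P.D j (\<Phi> i ?d)"
          unfolding \<Phi>d using hom_nat_pow[OF P.D_hom c' P.C_group P.C_group] Suc by simp
        also have "\<dots> = \<one>\<^bsub>P.C j\<^esub>" using \<Phi>(2)[OF d_cyc] Suc by (simp add: P.cycles_Suc)
        finally have "P.D j c = \<one>\<^bsub>P.C j\<^esub>" by (rule integral_tensor.torsion_free[OF I P.D_closed[OF c'] _ N])
        then show ?thesis using c' Suc by (simp add: P.cycles_Suc)
      qed
      then have "\<Phi> i ?d \<in> P.B i" unfolding \<Phi>d by (rule K(2))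
      then show "?d \<in> X.B i" by (rule \<Phi>(3)[OF d_cyc])
    qed
    have "finite (?code ` cycles X.C X.D i)"
      by (rule finite_subset[OF _ integral_tensor.finite_residues[OF I N]]) auto
    moreover have "X.cls i ` cycles X.C X.D i =
      (\<lambda>c. X.cls i (SOME z. z \<in> cycles X.C X.D i \<and> ?code z = c)) ` ?code ` cycles X.C X.D i"
    proof -
      have "X.cls i z = X.cls i (SOME z'. z' \<in> cycles X.C X.D i \<and> ?code z' = ?code z)"
        if z: "z \<in> cycles X.C X.D i" for z
        using someI[of "\<lambda>z'. z' \<in> cycles X.C X.D i \<and> ?code z' = ?code z" z] z by (intro code) auto
      then show ?thesis by (simp add: image_image cong: image_cong)
    qed
    ultimately show ?thesis unfolding T X.carrier_homology by simp
  qed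
  show "x [^]\<^bsub>T i\<^esub> q = \<one>\<^bsub>T i\<^esub>" if x: "x \<in> carrier (T i)" "x [^]\<^bsub>T i\<^esub> (p ^ k) = \<one>\<^bsub>T i\<^esub>"
  proof -
    obtain K where K: "coprime K p" "\<And>z. z \<in> cycles P.C P.D i \<Longrightarrow> z [^]\<^bsub>P.C i\<^esub> (K * q) \<in> P.B i"
      using bounded by blast
    obtain z where z: "z \<in> cycles X.C X.D i" "x = X.cls i z"
      using x(1) unfolding T X.carrier_homology by blast
    interpret H: comm_group "X.H i" by (rule X.homology_comm_group)
    have xH: "x \<in> carrier (X.H i)" using x(1) T by simp
    have "x [^]\<^bsub>X.H i\<^esub> (K * q) = \<one>\<^bsub>X.H i\<^esub>"
      unfolding z(2) X.class_pow[OF z(1)] by (rule X.class_boundary[OF \<Phi>_pow[OF z(1) K(2)[OF \<Phi>(2)[OF z(1)]]]])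
    then have "(x [^]\<^bsub>X.H i\<^esub> q) [^]\<^bsub>X.H i\<^esub> K = \<one>\<^bsub>X.H i\<^esub>"
      using xH by (simp add: H.nat_pow_pow mult.commute)
    moreover have "(x [^]\<^bsub>X.H i\<^esub> q) [^]\<^bsub>X.H i\<^esub> (p ^ k) = \<one>\<^bsub>X.H i\<^esub>"
    proof -
      have "(x [^]\<^bsub>X.H i\<^esub> q) [^]\<^bsub>X.H i\<^esub> (p ^ k) = (x [^]\<^bsub>X.H i\<^esub> (p ^ k)) [^]\<^bsub>X.H i\<^esub> q"
        using xH by (simp only: H.nat_pow_pow mult.commute)
      then show ?thesis using x(2) T H.nat_pow_one by metis
    qed
    moreover have xq: "x [^]\<^bsub>X.H i\<^esub> q \<in> carrier (X.H i)" using xH by simp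
    ultimately have ord_dvd: "H.ord (x [^]\<^bsub>X.H i\<^esub> q) dvd K" "H.ord (x [^]\<^bsub>X.H i\<^esub> q) dvd p ^ k"
      using H.pow_eq_id[OF xq] by simp_all
    have "coprime K (p ^ k)" using K(1) by simp
    then have "H.ord (x [^]\<^bsub>X.H i\<^esub> q) = 1"
      using coprime_common_divisor[OF _ ord_dvd] by simp
    then show ?thesis using H.pow_eq_id[OF xq, of 1] xq T by simp
  qed
  show "trivial_group (T i)" if zero: "carrier (P i) = {\<zero>\<^bsub>P i\<^esub>}"
    unfolding T
  proof (rule X.homology_trivial, rule subsetI)
    fix z assume z: "z \<in> cycles X.C X.D i"
    have "\<Phi> i z = \<one>\<^bsub>P.C i\<^esub>"
      by (rule tensor_product.trivial_tensor[OF P.product zero P.cycles_closed[OF \<Phi>(2)[OF z]]])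
    then have "\<Phi> i z = P.D i \<one>\<^bsub>P.C (Suc i)\<^esub>" using hom_one[OF P.D_hom P.C_group P.C_group] by simp
    moreover have "\<one>\<^bsub>P.C (Suc i)\<^esub> \<in> carrier (P.C (Suc i))" using monoid.one_closed[OF group.is_monoid[OF P.C_group]] .
    ultimately have "\<Phi> i z \<in> P.B i" by blast
    then show "z \<in> X.B i" by (rule \<Phi>(3)[OF z])
  qed
qed

section \<open>The p-adic completion of an abelian group\<close>

locale padic = comm_group G for G (structure) +
  fixes p :: nat
begin

abbreviation "I n \<equiv> power_image p n G"
abbreviation "G_hat \<equiv> padic_completion p G"

text \<open>Sequences of representatives of the elements of the completion. They reduce computations with cosets
  to computations in \<open>G\<close>.\<close>

definition coherent :: "(nat \<Rightarrow> 'a) \<Rightarrow> bool" where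
  "coherent r \<longleftrightarrow> (\<forall>n. r n \<in> carrier G) \<and> (\<forall>n. I n #> r (Suc n) = I n #> r n)"

definition limit :: "(nat \<Rightarrow> 'a) \<Rightarrow> nat \<Rightarrow> 'a set" where
  "limit r = (\<lambda>n. I n #> r n)"

lemma I_normal: "I n \<lhd> G"
  using normal_iff_subgroup power_image_subgroup by blast

lemma I_closed: "x \<in> I n \<Longrightarrow> x \<in> carrier G"
  by (rule subgroup.mem_carrier[OF power_image_subgroup])

lemma I_0: "I 0 = carrier G"
  by (auto simp: power_image_def)

lemma I_pow: "x \<in> I n \<Longrightarrow> x [^] p \<in> I (Suc n)"
  by (auto simp: power_image_def nat_pow_pow mult.commute)

lemma I_antimono: "I (Suc n) \<subseteq> I n"
proof
  fix x assume "x \<in> I (Suc n)"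
  then obtain y where "y \<in> carrier G" "x = (y [^] p) [^] (p ^ n)"
    by (auto simp: power_image_def nat_pow_pow)
  then show "x \<in> I n" by (auto simp: power_image_def)
qed

lemma coset_eq_iff:
  assumes "x \<in> carrier G" "y \<in> carrier G"
  shows "I n #> x = I n #> y \<longleftrightarrow> x \<otimes> inv y \<in> I n"
proof
  assume "I n #> x = I n #> y"
  then have "I n #> (x \<otimes> inv y) = I n"
    using assms coset_mult_inv2[OF _ _ _ subgroup.subset[OF power_image_subgroup]] by blast
  then show "x \<otimes> inv y \<in> I n" using assms coset_join1[OF _ _ power_image_subgroup] by blast
next
  assume "x \<otimes> inv y \<in> I n"
  then have "I n #> (x \<otimes> inv y) = I n" using assms coset_join2[OF _ power_image_subgroup] by simp
  then show "I n #> x = I n #> y"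
    using assms coset_mult_inv1[OF _ _ _ subgroup.subset[OF power_image_subgroup]] by blast
qed

lemma coset_mult:
  "\<lbrakk>x \<in> carrier G; y \<in> carrier G\<rbrakk> \<Longrightarrow> (I n #> x) <#> (I n #> y) = I n #> (x \<otimes> y)"
  by (rule normal.rcos_sum[OF I_normal])

lemma coset_cong_mult:
  assumes "x \<in> carrier G" "x' \<in> carrier G" "y \<in> carrier G" "y' \<in> carrier G"
    "I n #> x = I n #> x'" "I n #> y = I n #> y'"
  shows "I n #> (x \<otimes> y) = I n #> (x' \<otimes> y')"
  using coset_mult[of x y n] coset_mult[of x' y' n] assms by simp

lemma coset_cong_inv:
  assumes "x \<in> carrier G" "y \<in> carrier G" "I n #> x = I n #> y"
  shows "I n #> inv x = I n #> inv y"
proof -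
  have "inv (x \<otimes> inv y) \<in> I n"
    using assms coset_eq_iff subgroup.m_inv_closed[OF power_image_subgroup] by blast
  then show ?thesis using assms by (simp add: coset_eq_iff inv_mult)
qed

lemma coset_cong_pow:
  assumes "x \<in> carrier G" "y \<in> carrier G" "I n #> x = I n #> y"
  shows "I n #> x [^] (k::nat) = I n #> y [^] k"
  by (induction k) (use assms coset_cong_mult in simp_all)

lemma coset_cong_p_pow:
  assumes "x \<in> carrier G" "y \<in> carrier G" "I n #> x = I n #> y"
  shows "I (Suc n) #> x [^] p = I (Suc n) #> y [^] p"
  using assms I_pow[of "x \<otimes> inv y" n] by (simp add: coset_eq_iff nat_pow_distrib nat_pow_inv)

lemma coset_cong_antimono:
  assumes "x \<in> carrier G" "y \<in> carrier G" "I (Suc n) #> x = I (Suc n) #> y"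
  shows "I n #> x = I n #> y"
  using assms I_antimono by (auto simp: coset_eq_iff)

lemma transition:
  assumes x: "x \<in> carrier G"
  shows "I n <#> (I (Suc n) #> x) = I n #> x"
proof -
  have "I n <#> I (Suc n) = I n"
  proof
    show "I n <#> I (Suc n) \<subseteq> I n"
      by (auto simp: set_mult_def intro!: subgroup.m_closed[OF power_image_subgroup] dest: subsetD[OF I_antimono])
    show "I n \<subseteq> I n <#> I (Suc n)"
    proof
      fix a assume a: "a \<in> I n"
      have "a = a \<otimes> \<one>" using I_closed[OF a] by simp
      then show "a \<in> I n <#> I (Suc n)"
        using a subgroup.one_closed[OF power_image_subgroup] unfolding set_mult_def by blast
    qed
  qed
  then show ?thesis
    using setmult_rcos_assoc[OF _ _ x, of "I n" "I (Suc n)"] I_closed by (simp add: subsetI)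
qed

lemma carrier_completion: "carrier G_hat = limit ` {r. coherent r}"
proof (intro equalityI subsetI)
  fix e assume "e \<in> carrier G_hat"
  then have e: "\<And>n. e n \<in> carrier (G Mod I n)" "\<And>n. I n <#> e (Suc n) = e n"
    by (auto simp: padic_completion_def inverse_limit_def PiE_iff)
  then have "\<forall>n. \<exists>x. x \<in> carrier G \<and> e n = I n #> x" unfolding carrier_FactGroup by blast
  then obtain r where r: "\<And>n. r n \<in> carrier G" "\<And>n. e n = I n #> r n" by metis
  have "I n #> r (Suc n) = I n #> r n" for n
    using e(2)[of n] r transition by simp
  then have "coherent r" using r(1) by (simp add: coherent_def)
  moreover have "e = limit r" using r(2) by (auto simp: limit_def)
  ultimately show "e \<in> limit ` {r. coherent r}" by blast
next
  fix e assume "e \<in> limit ` {r. coherent r}"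
  then obtain r where r: "coherent r" "e = limit r" by blast
  then show "e \<in> carrier G_hat"
    by (auto simp: padic_completion_def inverse_limit_def PiE_iff carrier_FactGroup limit_def coherent_def transition)
qed

lemma limit_closed: "coherent r \<Longrightarrow> limit r \<in> carrier G_hat"
  by (simp add: carrier_completion)

lemma completionE:
  assumes "e \<in> carrier G_hat"
  obtains r where "coherent r" "e = limit r"
  using assms unfolding carrier_completion by blast

lemma coherent_closed: "coherent r \<Longrightarrow> r n \<in> carrier G"
  by (simp add: coherent_def)

lemma coherent_mult: "\<lbrakk>coherent r; coherent s\<rbrakk> \<Longrightarrow> coherent (\<lambda>n. r n \<otimes> s n)"
  unfolding coherent_def by (intro conjI allI coset_cong_mult) simp_all

lemma coherent_inv: "coherent r \<Longrightarrow> coherent (\<lambda>n. inv (r n))"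
  unfolding coherent_def by (intro conjI allI coset_cong_inv) simp_all

lemma coherent_pow: "coherent r \<Longrightarrow> coherent (\<lambda>n. r n [^] (k::nat))"
  unfolding coherent_def by (intro conjI allI coset_cong_pow) simp_all

lemma coherent_const: "x \<in> carrier G \<Longrightarrow> coherent (\<lambda>_. x)"
  by (simp add: coherent_def)

lemma limit_mult:
  "\<lbrakk>coherent r; coherent s\<rbrakk> \<Longrightarrow> limit r \<otimes>\<^bsub>G_hat\<^esub> limit s = limit (\<lambda>n. r n \<otimes> s n)"
  by (auto simp: padic_completion_def inverse_limit_def limit_def coset_mult coherent_closed)

lemma limit_one: "\<one>\<^bsub>G_hat\<^esub> = limit (\<lambda>_. \<one>)"
  using coset_mult_one[OF subgroup.subset[OF power_image_subgroup]]
  by (auto simp: padic_completion_def inverse_limit_def limit_def)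

lemma completion_comm_group: "comm_group G_hat"
proof (rule comm_groupI)
  fix e f assume "e \<in> carrier G_hat" "f \<in> carrier G_hat"
  then obtain r s where rs: "coherent r" "e = limit r" "coherent s" "f = limit s" by (metis completionE)
  show "e \<otimes>\<^bsub>G_hat\<^esub> f \<in> carrier G_hat"
    using rs by (simp add: limit_mult limit_closed coherent_mult)
  show "e \<otimes>\<^bsub>G_hat\<^esub> f = f \<otimes>\<^bsub>G_hat\<^esub> e"
    using rs by (simp add: limit_mult m_comm coherent_closed)
  fix g assume "g \<in> carrier G_hat"
  then obtain t where t: "coherent t" "g = limit t" by (rule completionE)
  show "e \<otimes>\<^bsub>G_hat\<^esub> f \<otimes>\<^bsub>G_hat\<^esub> g = e \<otimes>\<^bsub>G_hat\<^esub> (f \<otimes>\<^bsub>G_hat\<^esub> g)"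
    using rs t by (simp add: limit_mult coherent_mult m_assoc coherent_closed)
next
  show "\<one>\<^bsub>G_hat\<^esub> \<in> carrier G_hat" by (simp add: limit_one limit_closed coherent_const)
next
  fix e assume "e \<in> carrier G_hat"
  then obtain r where r: "coherent r" "e = limit r" by (rule completionE)
  show "\<one>\<^bsub>G_hat\<^esub> \<otimes>\<^bsub>G_hat\<^esub> e = e"
    using r by (simp add: limit_one limit_mult coherent_const coherent_closed)
  show "\<exists>f\<in>carrier G_hat. f \<otimes>\<^bsub>G_hat\<^esub> e = \<one>\<^bsub>G_hat\<^esub>"
    using r by (intro bexI[of _ "limit (\<lambda>n. inv (r n))"])
      (simp_all add: limit_one limit_mult coherent_inv coherent_closed limit_closed)
qed

sublocale hat: comm_group G_hat by (rule completion_comm_group)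

lemma limit_pow: "coherent r \<Longrightarrow> limit r [^]\<^bsub>G_hat\<^esub> (k::nat) = limit (\<lambda>n. r n [^] k)"
  by (induction k) (simp_all add: limit_one limit_mult coherent_pow)

text \<open>At level \<open>n\<close> the element \<open>D 0 = p\<^sup>n D n\<close> is trivial.\<close>

lemma completion_p_reduced: "p_reduced p G_hat"
  unfolding p_reduced_def
proof (intro allI impI)
  fix D assume D: "\<forall>k. D k \<in> carrier G_hat \<and> D k = D (Suc k) [^]\<^bsub>G_hat\<^esub> p"
  have pow: "D 0 = D k [^]\<^bsub>G_hat\<^esub> (p ^ k)" for k
  proof (induction k)
    case 0
    have "D 0 \<in> carrier G_hat" using D by blast
    then show ?case by simp
  next
    case (Suc k)
    have Dk: "D (Suc k) \<in> carrier G_hat" and Dp: "D k = D (Suc k) [^]\<^bsub>G_hat\<^esub> p" using D by blast+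
    have "D 0 = (D (Suc k) [^]\<^bsub>G_hat\<^esub> p) [^]\<^bsub>G_hat\<^esub> (p ^ k)" unfolding Suc by (rule arg_cong[OF Dp])
    also have "\<dots> = D (Suc k) [^]\<^bsub>G_hat\<^esub> (p ^ Suc k)" using hat.nat_pow_pow[OF Dk] by simp
    finally show ?case .
  qed
  have "D 0 n = limit (\<lambda>_. \<one>) n" for n
  proof -
    have "D n \<in> carrier G_hat" using D by blast
    then obtain r where r: "coherent r" "D n = limit r" by (rule completionE)
    have "D 0 n = I n #> r n [^] (p ^ n)"
      unfolding pow[of n] r(2) limit_pow[OF r(1)] by (simp add: limit_def)
    also have "r n [^] (p ^ n) \<in> I n" using coherent_closed[OF r(1)] by (auto simp: power_image_def)
    then have "I n #> r n [^] (p ^ n) = I n #> \<one>"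
      using coherent_closed[OF r(1)] by (simp add: coset_eq_iff)
    finally show ?thesis by (simp add: limit_def)
  qed
  then show "D 0 = \<one>\<^bsub>G_hat\<^esub>" unfolding limit_one by (rule ext)
qed

text \<open>In additive notation \<open>partial_sum r k m n = r k n + p r (k + 1) n + \<dots> + p\<^sup>m\<^sup>-\<^sup>1 r (k + m - 1) n\<close>, by Horner's
  rule, for representatives at level \<open>n\<close>.\<close>

fun partial_sum :: "(nat \<Rightarrow> nat \<Rightarrow> 'a) \<Rightarrow> nat \<Rightarrow> nat \<Rightarrow> nat \<Rightarrow> 'a" where
  "partial_sum r k 0 n = \<one>"
| "partial_sum r k (Suc m) n = r k n \<otimes> partial_sum r (Suc k) m n [^] p"

text \<open>At level \<open>n\<close> only the first \<open>n\<close> terms of the series matter, so the diagonal partial sums \<open>w k n\<close> represent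
  its value.\<close>

lemma completion_p_summable: "p_summable p G_hat"
  unfolding p_summable_def
proof (intro allI impI)
  fix e assume "\<forall>k::nat. e k \<in> carrier G_hat"
  then have "\<forall>k. \<exists>r. coherent r \<and> e k = limit r" by (metis completionE)
  then obtain r where r: "\<And>k. coherent (r k)" "\<And>k. e k = limit (r k)" by metis
  note rG = coherent_closed[OF r(1)]
  let ?Q = "partial_sum r"
  have QG: "?Q k m n \<in> carrier G" for k m n by (induction m arbitrary: k) (simp_all add: rG)
  have Q_Suc: "I m #> ?Q k (Suc m) n = I m #> ?Q k m n" for k m n
  proof (induction m arbitrary: k)
    case 0
    show ?case by (subst coset_eq_iff) (simp_all add: I_0 rG)
  next
    case (Suc m)
    have "I (Suc m) #> (r k n \<otimes> ?Q (Suc k) (Suc m) n [^] p) = I (Suc m) #> (r k n \<otimes> ?Q (Suc k) m n [^] p)"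
      using QG rG by (intro coset_cong_mult coset_cong_p_pow Suc refl nat_pow_closed)
    then show ?case by (simp only: partial_sum.simps)
  qed
  have Q_level: "I n #> ?Q k m (Suc n) = I n #> ?Q k m n" for k m n
  proof (induction m arbitrary: k)
    case (Suc m)
    have "I n #> r k (Suc n) = I n #> r k n" using r(1)[of k] by (simp add: coherent_def)
    then show ?case using QG rG by (simp del: nat_pow_Suc) (intro coset_cong_mult coset_cong_pow Suc nat_pow_closed)
  qed simp
  define w where "w k n = ?Q k n n" for k n
  have w: "coherent (w k)" for k
    unfolding coherent_def w_def
    using QG Q_Suc[of _ k] Q_level coset_cong_antimono by (metis (no_types))
  have "limit (w k) = e k \<otimes>\<^bsub>G_hat\<^esub> limit (w (Suc k)) [^]\<^bsub>G_hat\<^esub> p" for k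
  proof -
    have "e k \<otimes>\<^bsub>G_hat\<^esub> limit (w (Suc k)) [^]\<^bsub>G_hat\<^esub> p = limit (\<lambda>n. r k n \<otimes> w (Suc k) n [^] p)"
      unfolding r(2) using r(1) w by (simp add: limit_pow limit_mult coherent_pow)
    also have "\<dots> = limit (\<lambda>n. ?Q k (Suc n) n)" by (simp add: w_def)
    also have "\<dots> = limit (w k)" unfolding limit_def Q_Suc by (simp add: w_def)
    finally show ?thesis by simp
  qed
  then show "\<exists>w. \<forall>k. w k \<in> carrier G_hat \<and> w k = e k \<otimes>\<^bsub>G_hat\<^esub> w (Suc k) [^]\<^bsub>G_hat\<^esub> p"
    by (intro exI[of _ "\<lambda>k. limit (w k)"] allI conjI limit_closed w)
qed

text \<open>If \<open>a\<close> represents \<open>e\<close> and \<open>a (n + 1) - a n = p\<^sup>n c n\<close>, then \<open>e = a m + p\<^sup>m \<Sum>\<^sub>i p\<^sup>i c (m + i)\<close>. The point is that the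
  kernel of the projection to \<open>G / p\<^sup>m G\<close> consists of \<open>p\<^sup>m\<close>-fold multiples, with no finiteness condition on
  \<open>G\<close>; summability provides the quotient by \<open>p\<^sup>m\<close>.\<close>

lemma completion_split:
  assumes "e \<in> carrier G_hat"
  obtains x w where "x \<in> carrier G" "w \<in> carrier G_hat"
    "e = limit (\<lambda>_. x) \<otimes>\<^bsub>G_hat\<^esub> w [^]\<^bsub>G_hat\<^esub> (p ^ m)"
proof -
  obtain a where a: "coherent a" "e = limit a" using assms by (rule completionE)
  note aG = coherent_closed[OF a(1)]
  have "\<exists>c. c \<in> carrier G \<and> a (Suc n) = a n \<otimes> c [^] (p ^ n)" for n
  proof -
    have "a (Suc n) \<otimes> inv (a n) \<in> I n" using a(1) aG by (simp add: coherent_def coset_eq_iff)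
    then obtain c where c: "c \<in> carrier G" "a (Suc n) \<otimes> inv (a n) = c [^] (p ^ n)"
      by (auto simp: power_image_def)
    then have "a (Suc n) = a n \<otimes> c [^] (p ^ n)"
      using aG inv_solve_right'[of "c [^] (p ^ n)" "a (Suc n)" "a n"] by (simp add: m_comm)
    then show ?thesis using c(1) by blast
  qed
  then obtain c where c: "\<And>n. c n \<in> carrier G" "\<And>n. a (Suc n) = a n \<otimes> c n [^] (p ^ n)" by metis
  let ?c = "\<lambda>x. limit (\<lambda>_. x)"
  have cc: "?c x \<in> carrier G_hat" if "x \<in> carrier G" for x using that by (simp add: limit_closed coherent_const)
  obtain w where w: "\<And>k. w k \<in> carrier G_hat" "\<And>k. w k = ?c (c k) \<otimes>\<^bsub>G_hat\<^esub> w (Suc k) [^]\<^bsub>G_hat\<^esub> p"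
    using p_summableE[OF completion_p_summable, of "\<lambda>k. ?c (c k)"] cc c(1) by blast
  \<comment> \<open>The right-hand side does not depend on \<open>k\<close>; comparing its components with those of \<open>e\<close> uses \<open>k = n\<close>.\<close>
  have const: "?c (a k) \<otimes>\<^bsub>G_hat\<^esub> w k [^]\<^bsub>G_hat\<^esub> (p ^ k) = ?c (a 0) \<otimes>\<^bsub>G_hat\<^esub> w 0" for k
  proof (induction k)
    case 0
    show ?case using w(1) by simp
  next
    case (Suc k)
    have split_a: "?c (a (Suc k)) = ?c (a k) \<otimes>\<^bsub>G_hat\<^esub> ?c (c k) [^]\<^bsub>G_hat\<^esub> (p ^ k)"
      unfolding c(2)[of k] using aG c(1) by (simp add: limit_pow limit_mult coherent_const)
    have "w k [^]\<^bsub>G_hat\<^esub> (p ^ k) = (?c (c k) \<otimes>\<^bsub>G_hat\<^esub> w (Suc k) [^]\<^bsub>G_hat\<^esub> p) [^]\<^bsub>G_hat\<^esub> (p ^ k)"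
      by (rule arg_cong[OF w(2)])
    also have "\<dots> = ?c (c k) [^]\<^bsub>G_hat\<^esub> (p ^ k) \<otimes>\<^bsub>G_hat\<^esub> w (Suc k) [^]\<^bsub>G_hat\<^esub> (p ^ Suc k)"
      using cc[OF c(1)] w(1) by (simp add: hat.nat_pow_distrib hat.nat_pow_pow)
    finally have split_w: "w k [^]\<^bsub>G_hat\<^esub> (p ^ k) =
      ?c (c k) [^]\<^bsub>G_hat\<^esub> (p ^ k) \<otimes>\<^bsub>G_hat\<^esub> w (Suc k) [^]\<^bsub>G_hat\<^esub> (p ^ Suc k)" .
    have "?c (a (Suc k)) \<otimes>\<^bsub>G_hat\<^esub> w (Suc k) [^]\<^bsub>G_hat\<^esub> (p ^ Suc k) =
      ?c (a k) \<otimes>\<^bsub>G_hat\<^esub> w k [^]\<^bsub>G_hat\<^esub> (p ^ k)"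
      unfolding split_a split_w
      by (intro hat.m_assoc hat.nat_pow_closed cc w(1) c(1) aG)
    then show ?case using Suc by simp
  qed
  have "e n = (?c (a 0) \<otimes>\<^bsub>G_hat\<^esub> w 0) n" for n
  proof -
    obtain s where s: "coherent s" "w n = limit s" using w(1) by (rule completionE)
    have "(?c (a n) \<otimes>\<^bsub>G_hat\<^esub> w n [^]\<^bsub>G_hat\<^esub> (p ^ n)) n = I n #> (a n \<otimes> s n [^] (p ^ n))"
      unfolding s(2) using s(1) aG by (simp add: limit_pow limit_mult coherent_const coherent_pow) (simp add: limit_def)
    also have "\<dots> = I n #> a n"
    proof -
      have "a n \<otimes> s n [^] (p ^ n) \<otimes> inv (a n) = s n [^] (p ^ n)"
        using aG coherent_closed[OF s(1)] by (simp add: m_comm[of "a n"] m_assoc)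
      moreover have "s n [^] (p ^ n) \<in> I n" using coherent_closed[OF s(1)] by (auto simp: power_image_def)
      ultimately show ?thesis using aG coherent_closed[OF s(1)] by (simp add: coset_eq_iff)
    qed
    finally show ?thesis unfolding const a(2) by (simp add: limit_def)
  qed
  then have "e = ?c (a m) \<otimes>\<^bsub>G_hat\<^esub> w m [^]\<^bsub>G_hat\<^esub> (p ^ m)" unfolding const by (rule ext)
  then show thesis by (rule that[OF aG w(1)])
qed

lemma coherent_le:
  assumes "coherent r" "n \<le> m"
  shows "I n #> r m = I n #> r n"
  using assms(2)
proof (induction m rule: dec_induct)
  case (step m)
  have "I n #> r (Suc m) = I n #> r m"
    using step.hyps(1)
  proof (induction n rule: inc_induct)
    case base
    show ?case using assms(1) by (simp add: coherent_def)
  next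
    case (step n)
    then show ?case using coset_cong_antimono coherent_closed[OF assms(1)] by blast
  qed
  then show ?case using step.IH by simp
qed simp

end

text \<open>From level \<open>n0\<close> on all quotients are the same.\<close>

lemma (in p_stable_group) completion_iso:
  "(\<lambda>x. x n0) \<in> iso (padic_completion p G) (G Mod stable_part)"
proof -
  interpret padic G p by unfold_locales
  have det: "limit r n = limit s n" if r: "coherent r" "coherent s" and eq: "limit r n0 = limit s n0" for r s n
  proof (cases "n \<le> n0")
    case True
    have "I n #> r n0 = I n #> s n0"
      using True eq
    proof (induction n rule: inc_induct)
      case base
      then show ?case by (simp add: limit_def)
    next
      case (step n)
      then show ?case using coset_cong_antimono coherent_closed[OF r(1)] coherent_closed[OF r(2)] by blast
    qed
    then show ?thesis using coherent_le[OF r(1) True] coherent_le[OF r(2) True] by (simp add: limit_def)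
  next
    case False
    then have n: "n0 \<le> n" by simp
    have "I n = I n0" by (rule stable[OF n])
    then show ?thesis
      using eq coherent_le[OF r(1) n] coherent_le[OF r(2) n] unfolding limit_def by simp
  qed
  show ?thesis
  proof (intro isoI homI bij_betwI')
    show "e n0 \<in> carrier (G Mod stable_part)" if "e \<in> carrier G_hat" for e
      using that by (auto simp: carrier_completion limit_def carrier_FactGroup coherent_closed)
    then show "e n0 \<in> carrier (G Mod stable_part)" if "e \<in> carrier G_hat" for e
      using that .
  next
    fix e f assume "e \<in> carrier G_hat" "f \<in> carrier G_hat"
    then obtain r s where rs: "coherent r" "e = limit r" "coherent s" "f = limit s" by (metis completionE)
    show "(e \<otimes>\<^bsub>G_hat\<^esub> f) n0 = e n0 \<otimes>\<^bsub>G Mod stable_part\<^esub> f n0"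
      unfolding rs(2,4) limit_mult[OF rs(1,3)] using rs(1,3)
      by (simp add: limit_def coset_mult coherent_closed)
    show "(e n0 = f n0) = (e = f)"
      using det[OF rs(1,3)] rs(2,4) by blast
  next
    fix X assume "X \<in> carrier (G Mod stable_part)"
    then obtain x where "x \<in> carrier G" "X = stable_part #> x" by (auto simp: carrier_FactGroup)
    then show "\<exists>e\<in>carrier G_hat. X = e n0"
      by (intro bexI[of _ "limit (\<lambda>_. x)"]) (simp_all add: limit_closed coherent_const, simp add: limit_def)
  qed
qed

section \<open>The completed ring as a right module\<close>

text \<open>The completion occurs as a group and as the additive group of a ring or module. These records agree in
  carrier, operation and neutral element, but are not equal.\<close>

lemma p_reduced_cong:
  assumes "carrier G = carrier H" "monoid.mult G = monoid.mult H" "\<one>\<^bsub>G\<^esub> = \<one>\<^bsub>H\<^esub>"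
  shows "p_reduced p G \<longleftrightarrow> p_reduced p H"
  unfolding p_reduced_def nat_pow_def by (simp only: assms)

lemma p_summable_cong:
  assumes "carrier G = carrier H" "monoid.mult G = monoid.mult H" "\<one>\<^bsub>G\<^esub> = \<one>\<^bsub>H\<^esub>"
  shows "p_summable p G \<longleftrightarrow> p_summable p H"
  unfolding p_summable_def nat_pow_def by (simp only: assms)

lemma nat_pow_cong:
  assumes "monoid.mult G = monoid.mult H" "\<one>\<^bsub>G\<^esub> = \<one>\<^bsub>H\<^esub>"
  shows "x [^]\<^bsub>G\<^esub> (k::nat) = x [^]\<^bsub>H\<^esub> k"
  unfolding nat_pow_def using assms by simp

lemma comm_group_cong:
  assumes "comm_group H" "carrier G = carrier H" "monoid.mult G = monoid.mult H" "\<one>\<^bsub>G\<^esub> = \<one>\<^bsub>H\<^esub>"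
  shows "comm_group G"
proof -
  interpret H: comm_group H by fact
  show ?thesis
    by (rule comm_groupI) (use assms(2-4) H.l_inv_ex in \<open>auto simp: H.m_assoc intro: H.m_comm\<close>)
qed

lemma (in ring) power_image_ideal: "ideal (power_image p n (add_monoid R)) R"
proof (rule idealI)
  show "ring R" by (rule ring_axioms)
  show "subgroup (power_image p n (add_monoid R)) (add_monoid R)"
    by (rule comm_group.power_image_subgroup[OF a_comm_group])
  fix a x assume "a \<in> power_image p n (add_monoid R)" "x \<in> carrier R"
  then obtain b where b: "b \<in> carrier R" "a = [(p ^ n)] \<cdot> b"
    by (auto simp: power_image_def add_pow_def)
  have "x \<otimes> a = [(p ^ n)] \<cdot> (x \<otimes> b)" "a \<otimes> x = [(p ^ n)] \<cdot> (b \<otimes> x)"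
    using b \<open>x \<in> carrier R\<close> by (simp_all add: add_pow_rdistr add_pow_ldistr)
  then show "x \<otimes> a \<in> power_image p n (add_monoid R)" "a \<otimes> x \<in> power_image p n (add_monoid R)"
    using b \<open>x \<in> carrier R\<close> by (auto simp: power_image_def add_pow_def)
qed

locale completed_ring = ring R
  for R :: "('r, 'k) ring_scheme" (structure) +
  fixes p :: nat
begin

sublocale Rp: padic "add_monoid R" p by (intro padic.intro a_comm_group)

abbreviation "A \<equiv> completed_ring_module p R"
abbreviation "clim \<equiv> padic.limit (add_monoid R) p"
abbreviation "coh \<equiv> padic.coherent (add_monoid R) p"

lemma A_simps:
  "carrier A = carrier (padic_completion p (add_monoid R))"
  "add A = monoid.mult (padic_completion p (add_monoid R))"
  "\<zero>\<^bsub>A\<^esub> = \<one>\<^bsub>padic_completion p (add_monoid R)\<^esub>"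
  by (simp_all add: completed_ring_module_def right_module_via_def padic_completion_ring_def)

lemma A_comm_group: "comm_group (add_monoid A)"
  by (rule comm_group_cong[OF Rp.completion_comm_group]) (simp_all add: A_simps)

lemma A_p_reduced: "p_reduced p (add_monoid A)"
  using Rp.completion_p_reduced p_reduced_cong[of "add_monoid A" "padic_completion p (add_monoid R)" p]
  by (simp add: A_simps)

lemma A_p_summable: "p_summable p (add_monoid A)"
  using Rp.completion_p_summable p_summable_cong[of "add_monoid A" "padic_completion p (add_monoid R)" p]
  by (simp add: A_simps)

lemma A_pow: "x [^]\<^bsub>add_monoid A\<^esub> (k::nat) = x [^]\<^bsub>padic_completion p (add_monoid R)\<^esub> k"
  by (rule nat_pow_cong) (simp_all add: A_simps)

lemma lim_closed: "coh r \<Longrightarrow> clim r \<in> carrier A"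
  by (simp add: A_simps Rp.limit_closed)

lemma A_E:
  assumes "e \<in> carrier A"
  obtains a where "coh a" "e = clim a"
  using assms Rp.completionE[of e] by (simp add: A_simps) blast

lemma coh_closed: "coh a \<Longrightarrow> a n \<in> carrier R"
  using Rp.coherent_closed[of a n] by simp

lemma coh_add: "\<lbrakk>coh a; coh b\<rbrakk> \<Longrightarrow> coh (\<lambda>n. a n \<oplus> b n)"
  using Rp.coherent_mult[of a b] by simp

lemma coh_const: "r \<in> carrier R \<Longrightarrow> coh (\<lambda>_. r)"
  using Rp.coherent_const[of r] by simp

lemma lim_add: "\<lbrakk>coh a; coh b\<rbrakk> \<Longrightarrow> clim a \<oplus>\<^bsub>A\<^esub> clim b = clim (\<lambda>n. a n \<oplus> b n)"
  using Rp.limit_mult[of a b] by (simp add: A_simps)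

lemma rcoset_mult_limit:
  assumes "a \<in> carrier R" "r \<in> carrier R"
  shows "rcoset_mult R (Rp.I n) (Rp.I n #>\<^bsub>add_monoid R\<^esub> a) (Rp.I n #>\<^bsub>add_monoid R\<^esub> r) =
    Rp.I n #>\<^bsub>add_monoid R\<^esub> (a \<otimes> r)"
  using ideal.rcoset_mult_add[OF power_image_ideal assms] by (simp add: a_r_coset_def)

lemma coh_act:
  assumes "coh a" "r \<in> carrier R"
  shows "coh (\<lambda>n. a n \<otimes> r)"
  unfolding Rp.coherent_def
proof (intro conjI allI)
  fix n
  show "a n \<otimes> r \<in> carrier (add_monoid R)" using assms coh_closed by simp
  have "Rp.I n #>\<^bsub>add_monoid R\<^esub> a (Suc n) = Rp.I n #>\<^bsub>add_monoid R\<^esub> a n"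
    using assms(1) unfolding Rp.coherent_def by blast
  then show "Rp.I n #>\<^bsub>add_monoid R\<^esub> (a (Suc n) \<otimes> r) = Rp.I n #>\<^bsub>add_monoid R\<^esub> (a n \<otimes> r)"
    using rcoset_mult_limit[OF coh_closed[OF assms(1)] assms(2)] by metis
qed

lemma act_lim:
  assumes "coh a" "r \<in> carrier R"
  shows "r \<odot>\<^bsub>A\<^esub> clim a = clim (\<lambda>n. a n \<otimes> r)"
proof -
  have "r \<odot>\<^bsub>A\<^esub> clim a = (\<lambda>n. rcoset_mult R (Rp.I n) (clim a n) (Rp.I n #>\<^bsub>add_monoid R\<^esub> r))"
    by (simp add: completed_ring_module_def right_module_via_def padic_completion_ring_def
        completion_map_def a_r_coset_def)
  then show ?thesis
    using rcoset_mult_limit[OF coh_closed[OF assms(1)] assms(2)] by (simp add: Rp.limit_def)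
qed

lemma right_module_A: "right_module R A"
proof (intro right_module.intro right_module_axioms.intro)
  show "ring R" by (rule ring_axioms)
  show "abelian_group A" by (rule comm_group_abelian_groupI[OF A_comm_group])
  fix r e assume r: "r \<in> carrier R" and "e \<in> carrier A"
  from this(2) obtain a where a: "coh a" "e = clim a" by (rule A_E)
  show "r \<odot>\<^bsub>A\<^esub> e \<in> carrier A" using r a by (simp add: act_lim lim_closed coh_act)
  show "(r \<otimes> s) \<odot>\<^bsub>A\<^esub> e = s \<odot>\<^bsub>A\<^esub> (r \<odot>\<^bsub>A\<^esub> e)" if "s \<in> carrier R" for s
    using r a that by (simp add: act_lim coh_act m_assoc[symmetric] coh_closed)
  show "(r \<oplus> s) \<odot>\<^bsub>A\<^esub> e = r \<odot>\<^bsub>A\<^esub> e \<oplus>\<^bsub>A\<^esub> s \<odot>\<^bsub>A\<^esub> e" if "s \<in> carrier R" for s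
    using r a that by (simp add: act_lim coh_act lim_add r_distr coh_closed)
  fix f assume "f \<in> carrier A"
  then obtain b where b: "coh b" "f = clim b" by (rule A_E)
  show "r \<odot>\<^bsub>A\<^esub> (e \<oplus>\<^bsub>A\<^esub> f) = r \<odot>\<^bsub>A\<^esub> e \<oplus>\<^bsub>A\<^esub> r \<odot>\<^bsub>A\<^esub> f"
    using r a b by (simp add: act_lim coh_act lim_add coh_add l_distr coh_closed)
next
  fix e assume "e \<in> carrier A"
  then obtain a where a: "coh a" "e = clim a" by (rule A_E)
  then show "\<one> \<odot>\<^bsub>A\<^esub> e = e" by (simp add: act_lim coh_closed)
qed

lemma A_split:
  assumes "e \<in> carrier A"
  obtains r w where "r \<in> carrier R" "w \<in> carrier A"
    "e = r \<odot>\<^bsub>A\<^esub> clim (\<lambda>_. \<one>) \<oplus>\<^bsub>A\<^esub> w [^]\<^bsub>add_monoid A\<^esub> (p ^ m)"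
proof -
  have "e \<in> carrier (padic_completion p (add_monoid R))" using assms by (simp add: A_simps)
  then obtain r w where rw: "r \<in> carrier (add_monoid R)" "w \<in> carrier (padic_completion p (add_monoid R))"
    "e = clim (\<lambda>_. r) \<otimes>\<^bsub>padic_completion p (add_monoid R)\<^esub> w [^]\<^bsub>padic_completion p (add_monoid R)\<^esub> (p ^ m)"
    by (rule Rp.completion_split)
  have "e = r \<odot>\<^bsub>A\<^esub> clim (\<lambda>_. \<one>) \<oplus>\<^bsub>A\<^esub> w [^]\<^bsub>add_monoid A\<^esub> (p ^ m)"
    using rw(1) by (subst rw(3), subst A_pow) (simp add: act_lim coh_const A_simps(2))
  then show thesis using rw(1,2) by (intro that) (simp_all add: A_simps)
qed

end

text \<open>Over the completed ring \<open>1 - p u\<close> is bijective, so \<open>K = 1\<close> in \<open>cycle_power_is_boundary\<close>.\<close>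

lemma completed_ring_cycle_power:
  fixes R :: "('r, 'k) ring_scheme" and P :: "nat \<Rightarrow> ('r, 'q) module" and p q :: nat
  assumes "based_resolution R M P \<delta> \<eta> J b \<phi>" "\<And>i. finite (J i)"
    and \<psi>: "\<psi> \<in> linear_maps R M M"
    and split: "\<And>x. x \<in> carrier M \<Longrightarrow> [q] \<cdot>\<^bsub>M\<^esub> x = [q] \<cdot>\<^bsub>M\<^esub> ([p] \<cdot>\<^bsub>M\<^esub> \<psi> x)"
  defines "C \<equiv> \<lambda>i. tensor R (completed_ring_module p R) (P i)"
    and "D \<equiv> \<lambda>i. tensor_map R (completed_ring_module p R) (P i) (\<delta> i)"
  assumes z: "z \<in> cycles C D i"
  shows "z [^]\<^bsub>C i\<^esub> q \<in> D i ` carrier (C (Suc i))"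
proof -
  interpret P: based_resolution R M P \<delta> \<eta> J b \<phi> by fact
  interpret A: completed_ring R p by (intro completed_ring.intro P.M.R.ring_axioms)
  interpret P: finite_tensored_resolution R M P \<delta> \<eta> J b \<phi> A.A
    by (intro finite_tensored_resolution.intro tensored_resolution.intro finite_tensored_resolution_axioms.intro
        assms(1,2) A.right_module_A)
  show ?thesis
  proof (rule P.cycle_power_is_boundary[OF \<psi> split A.A_p_reduced, where good = "\<lambda>K. K = 1" and i = i])
    fix u assume u: "u \<in> hom (P.C i) (P.C i)"
    interpret Ci: comm_group "P.C i" by (rule P.C_comm_group)
    have "\<exists>s\<in>carrier (P.C i). t [^]\<^bsub>P.C i\<^esub> (1::nat) \<otimes>\<^bsub>P.C i\<^esub> u s [^]\<^bsub>P.C i\<^esub> p = s" if t: "t \<in> carrier (P.C i)" for t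
    proof (rule Ci.one_minus_p_surjective[OF _ _ u t])
      show "p_reduced p (P.C i)" by (rule finite_dual_based_tensor.tensor_p_reduced[OF P.based_tensor A.A_p_reduced])
      show "p_summable p (P.C i)" by (rule finite_dual_based_tensor.tensor_p_summable[OF P.based_tensor A.A_p_summable])
      fix s assume "s \<in> carrier (P.C i)" "s = t \<otimes>\<^bsub>P.C i\<^esub> u s [^]\<^bsub>P.C i\<^esub> p"
      then show ?thesis using t Ci.nat_pow_eone[OF t] by (intro bexI[of _ s]) (simp_all only: sym)
    qed
    then show "\<exists>K. K = 1 \<and> (\<forall>t\<in>carrier (P.C i). \<exists>s\<in>carrier (P.C i).
        t [^]\<^bsub>P.C i\<^esub> (K::nat) \<otimes>\<^bsub>P.C i\<^esub> u s [^]\<^bsub>P.C i\<^esub> p = s)" by blast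
  next
    fix K assume "K = 1" "\<And>z. z \<in> cycles P.C P.D i \<Longrightarrow> z [^]\<^bsub>P.C i\<^esub> (K * q) \<in> P.B i"
    then show ?thesis using z unfolding C_def D_def by simp
  qed
qed

section \<open>The completion of a module\<close>

text \<open>Let \<open>D k\<close> be successive \<open>p\<close>-th roots of \<open>x\<close>, \<open>q k\<close> lifts of them to \<open>P\<^sub>0\<close>, and \<open>s k\<close> elements of \<open>P\<^sub>1\<close> with
  boundary \<open>q k - p q (k + 1)\<close>. The tails \<open>w k\<close> of the series \<open>\<Sum>\<^sub>k p\<^sup>k (e \<otimes> s k)\<close> satisfy, after taking
  boundaries, the same recursion as the elements \<open>e \<otimes> q k\<close>. So the differences of the two are successive
  \<open>p\<close>-th roots, and the first one vanishes: \<open>e \<otimes> q 0\<close> is a boundary, and its image \<open>e \<otimes> x\<close> is zero.\<close>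

lemma completion_tensor_kills_stable_part:
  fixes R :: "('r, 'k) ring_scheme" and M :: "('r, 'm) module" and P :: "nat \<Rightarrow> ('r, 'q) module"
  assumes res: "based_resolution R M P \<delta> \<eta> J b \<phi>" "\<And>i. finite (J i)"
    and stable: "p_stable_group (add_monoid M) p n0"
    and e: "e \<in> carrier (completed_ring_module p R)" and x: "x \<in> power_image p n0 (add_monoid M)"
  shows "pure_tensor R (completed_ring_module p R) M e x = \<one>\<^bsub>tensor R (completed_ring_module p R) M\<^esub>"
proof -
  interpret P: based_resolution R M P \<delta> \<eta> J b \<phi> by fact
  interpret A: completed_ring R p by (intro completed_ring.intro P.M.R.ring_axioms)
  interpret P: finite_tensored_resolution R M P \<delta> \<eta> J b \<phi> A.A
    by (intro finite_tensored_resolution.intro tensored_resolution.intro finite_tensored_resolution_axioms.intro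
        assms(1,2) A.right_module_A)
  interpret S: p_stable_group "add_monoid M" p n0 by fact
  let ?T = "tensor R A.A M"
  interpret C0: comm_group "P.C 0" by (rule P.C_comm_group)
  interpret P0: left_module R "P 0" by (rule P.modules)
  interpret PM: tensor_functor R A.A "P 0" M
    by (intro tensor_functor.intro A.right_module_A P.modules P.M.left_module_axioms)
  interpret P1: tensor_product R A.A "P (Suc 0)" by (rule P.product)
  interpret D0: group_hom "P.C (Suc 0)" "P.C 0" "P.D 0"
    by (intro group_hom.intro group_hom_axioms.intro P.C_group P.D_hom)
  obtain D where D: "D 0 = x" "\<And>k. D k \<in> S.stable_part"
    "\<And>k. D (Suc k) [^]\<^bsub>add_monoid M\<^esub> p = D k"
    using S.stable_part_sequence[OF x] by blast
  have DM: "D k \<in> carrier M" for k using S.stable_part_closed[OF D(2)] by simp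
  have "\<forall>k. \<exists>y. y \<in> carrier (P 0) \<and> \<eta> y = D k"
    using DM P.augmentation_surj by (metis imageE)
  then obtain q where q: "\<And>k. q k \<in> carrier (P 0)" "\<And>k. \<eta> (q k) = D k" by metis
  let ?y = "\<lambda>k. q k \<ominus>\<^bsub>P 0\<^esub> [p] \<cdot>\<^bsub>P 0\<^esub> q (Suc k)"
  have y: "?y k \<in> carrier (P 0)" for k using q(1) by simp
  have "\<forall>k. \<exists>s. s \<in> carrier (P (Suc 0)) \<and> \<delta> 0 s = ?y k"
  proof
    fix k
    have "\<eta> ([p] \<cdot>\<^bsub>P 0\<^esub> q (Suc k)) = D k"
      using linear_map_nat_mult[OF P.augmentation_linear P.modules P.M.left_module_axioms q(1), of p "Suc k"]
        D(3)[of k] q(2) by (simp add: add_pow_def)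
    then have "\<eta> (?y k) = D k \<ominus>\<^bsub>M\<^esub> D k"
      using linear_map_diff[OF P.augmentation_linear P.modules P.M.left_module_axioms q(1)[of k],
          of "[p] \<cdot>\<^bsub>P 0\<^esub> q (Suc k)"] q by simp
    then have "\<eta> (?y k) = \<zero>\<^bsub>M\<^esub>" using DM by (simp add: a_minus_def P.M.M.r_neg)
    then have "?y k \<in> {x \<in> carrier (P 0). \<eta> x = \<zero>\<^bsub>M\<^esub>}" using y[of k] by simp
    then have "?y k \<in> \<delta> 0 ` carrier (P (Suc 0))" unfolding P.exact_zero .
    then show "\<exists>s. s \<in> carrier (P (Suc 0)) \<and> \<delta> 0 s = ?y k" by (elim imageE) (intro exI conjI, auto)
  qed
  from choice[OF this] obtain s where "\<forall>k. s k \<in> carrier (P (Suc 0)) \<and> \<delta> 0 (s k) = ?y k" by (rule exE)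
  then have s: "s k \<in> carrier (P (Suc 0))" "\<delta> 0 (s k) = ?y k" for k by simp_all
  let ?p0 = "\<lambda>x. pure_tensor R A.A (P 0) e x" and ?p1 = "\<lambda>x. pure_tensor R A.A (P (Suc 0)) e x"
  have summable: "p_summable p (P.C (Suc 0))"
    by (rule finite_dual_based_tensor.tensor_p_summable[OF P.based_tensor A.A_p_summable])
  have "?p1 (s k) \<in> carrier (P.C (Suc 0))" for k by (rule P1.pure_closed[OF e s(1)])
  then obtain w where w: "\<And>k. w k \<in> carrier (P.C (Suc 0))"
    "\<And>k. w k = ?p1 (s k) \<otimes>\<^bsub>P.C (Suc 0)\<^esub> w (Suc k) [^]\<^bsub>P.C (Suc 0)\<^esub> p"
    using p_summableE[OF summable, of "\<lambda>k. ?p1 (s k)"] by blast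
  have W: "P.D 0 (w k) \<in> carrier (P.C 0)" for k by (rule P.D_closed[OF w(1)])
  have X: "?p0 (q k) \<in> carrier (P.C 0)" and Y: "?p0 (?y k) \<in> carrier (P.C 0)" for k
    using e q(1) y by (auto intro!: PM.TM.pure_closed)
  have Dw: "P.D 0 (w k) = ?p0 (?y k) \<otimes>\<^bsub>P.C 0\<^esub> P.D 0 (w (Suc k)) [^]\<^bsub>P.C 0\<^esub> p" for k
  proof -
    have "P.D 0 (?p1 (s k)) = ?p0 (?y k)"
      using tensor_functor.tensor_map_pure[OF P.functor_at P.boundary_linear e s(1)] s(2) by simp
    then show ?thesis
      using w(1) P1.pure_closed[OF e s(1)] by (subst w(2)) (simp add: D0.hom_nat_pow)
  qed
  have pq: "?p0 (q k) = ?p0 (?y k) \<otimes>\<^bsub>P.C 0\<^esub> ?p0 (q (Suc k)) [^]\<^bsub>P.C 0\<^esub> p" for k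
  proof -
    have "q k = ?y k \<oplus>\<^bsub>P 0\<^esub> [p] \<cdot>\<^bsub>P 0\<^esub> q (Suc k)"
      using q(1) by (simp add: a_minus_def P0.a_assoc P0.l_neg)
    then have "?p0 (q k) = ?p0 (?y k \<oplus>\<^bsub>P 0\<^esub> [p] \<cdot>\<^bsub>P 0\<^esub> q (Suc k))" by (rule arg_cong)
    also have "\<dots> = ?p0 (?y k) \<otimes>\<^bsub>P.C 0\<^esub> ?p0 ([p] \<cdot>\<^bsub>P 0\<^esub> q (Suc k))"
      using y q(1) e by (intro PM.TM.pure_add_right) simp_all
    also have "?p0 ([p] \<cdot>\<^bsub>P 0\<^esub> q (Suc k)) = ?p0 (q (Suc k)) [^]\<^bsub>P.C 0\<^esub> p"
      using hom_nat_pow[OF PM.TM.pure_hom_right[OF e], of "q (Suc k)" p] q(1)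
      by (simp add: add_pow_def P0.M.a_group C0.is_group)
    finally show ?thesis .
  qed
  let ?E = "\<lambda>k. ?p0 (q k) \<otimes>\<^bsub>P.C 0\<^esub> inv\<^bsub>P.C 0\<^esub> P.D 0 (w k)"
  have "?E k = ?E (Suc k) [^]\<^bsub>P.C 0\<^esub> p" for k
    by (subst pq, subst Dw, rule C0.cancel_common_factor) (rule X Y W)+
  moreover have "?E k \<in> carrier (P.C 0)" for k using X W by simp
  ultimately have "?E 0 = \<one>\<^bsub>P.C 0\<^esub>"
    using p_reducedD[OF finite_dual_based_tensor.tensor_p_reduced[OF P.based_tensor A.A_p_reduced], of ?E] by blast
  then have "?p0 (q 0) = P.D 0 (w 0)"
    using X[of 0] W[of 0] C0.inv_solve_right'[of "\<one>\<^bsub>P.C 0\<^esub>" "?p0 (q 0)" "P.D 0 (w 0)"] by simp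
  then have "tensor_map R A.A M \<eta> (?p0 (q 0)) = tensor_map R A.A M (\<lambda>x. \<eta> (\<delta> 0 x)) (w 0)"
    using tensor_map_comp[OF A.right_module_A P.modules P.modules P.M.left_module_axioms
        P.boundary_linear P.augmentation_linear w(1)] by simp
  also have "\<dots> = \<one>\<^bsub>?T\<^esub>"
  proof -
    interpret f: tensor_functor R A.A "P (Suc 0)" M
      by (intro tensor_functor.intro A.right_module_A P.modules P.M.left_module_axioms)
    show ?thesis
      by (rule f.tensor_map_zero[OF linear_map_comp[OF P.boundary_linear P.augmentation_linear]
            P.augmentation_boundary w(1)])
  qed
  also have "tensor_map R A.A M \<eta> (?p0 (q 0)) = pure_tensor R A.A M e x"
    using PM.tensor_map_pure[OF P.augmentation_linear e q(1)] q(2) D(1) by simp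
  finally show ?thesis .
qed

text \<open>Every element of the tensor product has the form \<open>1 \<otimes> x\<close>: write \<open>e = r + p ^ n0 w\<close> with \<open>r\<close> from \<open>R\<close>; then
  \<open>p ^ n0 w \<otimes> x = w \<otimes> p ^ n0 x\<close> vanishes. If the image of \<open>1 \<otimes> x\<close> in the completion is trivial, then level \<open>n0\<close>
  shows that \<open>x\<close> lies in the stable part, so that \<open>1 \<otimes> x = 0\<close>.\<close>

lemma completion_tensor_iso:
  fixes R :: "('r, 'k) ring_scheme" and M :: "('r, 'm) module" and P :: "nat \<Rightarrow> ('r, 'q) module"
  assumes res: "based_resolution R M P \<delta> \<eta> J b \<phi>" "\<And>i. finite (J i)"
    and stable: "p_stable_group (add_monoid M) p n0"
  shows "completion_tensor_map p R M
    \<in> iso (tensor R (completed_ring_module p R) M) (padic_completion p (add_monoid M))"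
proof -
  interpret P: based_resolution R M P \<delta> \<eta> J b \<phi> by fact
  interpret A: completed_ring R p by (intro completed_ring.intro P.M.R.ring_axioms)
  interpret T: tensor_product R A.A M
    by (intro tensor_product.intro A.right_module_A P.M.left_module_axioms)
  interpret S: p_stable_group "add_monoid M" p n0 by fact
  interpret Mp: padic "add_monoid M" p by (intro padic.intro P.M.a_comm_group)
  let ?\<phi> = "\<lambda>e x n. \<Union>r\<in>e n. power_image p n (add_monoid M) +>\<^bsub>M\<^esub> (r \<odot>\<^bsub>M\<^esub> x)"
  have \<phi>: "?\<phi> (A.clim a) x = Mp.limit (\<lambda>n. a n \<odot>\<^bsub>M\<^esub> x)" if a: "A.coh a" and x: "x \<in> carrier M" for a x
  proof
    fix n
    let ?I = "power_image p n (add_monoid R)" and ?J = "power_image p n (add_monoid M)"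
    have aR: "a n \<in> carrier R" by (rule A.coh_closed[OF a])
    have "?J +>\<^bsub>M\<^esub> (r \<odot>\<^bsub>M\<^esub> x) = ?J #>\<^bsub>add_monoid M\<^esub> (a n \<odot>\<^bsub>M\<^esub> x)" if r: "r \<in> A.clim a n" for r
    proof -
      obtain s where s: "s \<in> carrier R" "r = [(p ^ n)] \<cdot>\<^bsub>R\<^esub> s \<oplus>\<^bsub>R\<^esub> a n"
        using r by (auto simp: A.Rp.limit_def r_coset_def power_image_def add_pow_def)
      have sx: "s \<odot>\<^bsub>M\<^esub> x \<in> carrier M" "a n \<odot>\<^bsub>M\<^esub> x \<in> carrier M" using s x aR by (auto intro: P.M.smult_closed)
      have "([(p ^ n)] \<cdot>\<^bsub>R\<^esub> s) \<odot>\<^bsub>M\<^esub> x = [(p ^ n)] \<cdot>\<^bsub>M\<^esub> (s \<odot>\<^bsub>M\<^esub> x)"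
        using hom_nat_pow[OF P.M.smult_hom_left[OF x], of s "p ^ n"] s(1)
        by (simp add: add_pow_def P.M.R.a_group P.M.M.a_group)
      then have "r \<odot>\<^bsub>M\<^esub> x = [(p ^ n)] \<cdot>\<^bsub>M\<^esub> (s \<odot>\<^bsub>M\<^esub> x) \<oplus>\<^bsub>M\<^esub> a n \<odot>\<^bsub>M\<^esub> x"
        unfolding s(2) using s(1) aR x by (simp add: P.M.smult_l_distr)
      moreover have "[(p ^ n)] \<cdot>\<^bsub>M\<^esub> (s \<odot>\<^bsub>M\<^esub> x) \<in> ?J"
        using sx by (auto simp: power_image_def add_pow_def)
      ultimately have "r \<odot>\<^bsub>M\<^esub> x \<in> ?J #>\<^bsub>add_monoid M\<^esub> (a n \<odot>\<^bsub>M\<^esub> x)"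
        by (auto simp: r_coset_def)
      then show ?thesis
        using group.repr_independence[OF P.M.M.a_group _ _ comm_group.power_image_subgroup[OF P.M.a_comm_group]] sx(2)
        by (simp add: a_r_coset_def)
    qed
    moreover have "A.clim a n \<noteq> {}"
      using group.rcos_self[OF P.M.R.a_group _ comm_group.power_image_subgroup[OF P.M.R.a_comm_group], of "a n"] aR
      by (auto simp: A.Rp.limit_def)
    ultimately show "?\<phi> (A.clim a) x n = Mp.limit (\<lambda>n. a n \<odot>\<^bsub>M\<^esub> x) n"
      by (auto simp: Mp.limit_def)
  qed
  have \<phi>_coh: "Mp.coherent (\<lambda>n. a n \<odot>\<^bsub>M\<^esub> x)" if a: "A.coh a" and x: "x \<in> carrier M" for a x
    unfolding Mp.coherent_def
  proof (intro conjI allI)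
    fix n
    have aR: "a n \<in> carrier R" "a (Suc n) \<in> carrier R" using A.coh_closed[OF a] by auto
    show "a n \<odot>\<^bsub>M\<^esub> x \<in> carrier (add_monoid M)" using aR x by (simp add: P.M.smult_closed)
    have "A.Rp.I n #>\<^bsub>add_monoid R\<^esub> a (Suc n) = A.Rp.I n #>\<^bsub>add_monoid R\<^esub> a n"
      using a by (simp add: A.Rp.coherent_def)
    then have "a (Suc n) \<otimes>\<^bsub>add_monoid R\<^esub> inv\<^bsub>add_monoid R\<^esub> a n \<in> A.Rp.I n"
      using A.Rp.coset_eq_iff[of "a (Suc n)" "a n" n] aR by simp
    then obtain s where s: "s \<in> carrier R" "a (Suc n) \<ominus>\<^bsub>R\<^esub> a n = [(p ^ n)] \<cdot>\<^bsub>R\<^esub> s"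
      by (auto simp: power_image_def add_pow_def a_minus_def a_inv_def)
    have "(a (Suc n) \<ominus>\<^bsub>R\<^esub> a n) \<odot>\<^bsub>M\<^esub> x = [(p ^ n)] \<cdot>\<^bsub>M\<^esub> (s \<odot>\<^bsub>M\<^esub> x)"
      unfolding s(2) using hom_nat_pow[OF P.M.smult_hom_left[OF x], of s "p ^ n"] s(1)
      by (simp add: add_pow_def P.M.R.a_group P.M.M.a_group)
    moreover have mem: "[(p ^ n)] \<cdot>\<^bsub>M\<^esub> (s \<odot>\<^bsub>M\<^esub> x) \<in> Mp.I n"
      using P.M.smult_closed[OF s(1) x] by (auto simp: power_image_def add_pow_def)
    moreover have "(a (Suc n) \<ominus>\<^bsub>R\<^esub> a n) \<odot>\<^bsub>M\<^esub> x = a (Suc n) \<odot>\<^bsub>M\<^esub> x \<ominus>\<^bsub>M\<^esub> a n \<odot>\<^bsub>M\<^esub> x"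
    proof -
      interpret h: group_hom "add_monoid R" "add_monoid M" "\<lambda>r. r \<odot>\<^bsub>M\<^esub> x"
        by (intro group_hom.intro group_hom_axioms.intro P.M.R.a_group P.M.M.a_group P.M.smult_hom_left x)
      show ?thesis
        using h.hom_inv[of "a n"] aR x P.M.smult_l_distr[of "a (Suc n)" "\<ominus>\<^bsub>R\<^esub> a n" x]
        by (simp add: a_minus_def a_inv_def)
    qed
    ultimately have "a (Suc n) \<odot>\<^bsub>M\<^esub> x \<otimes>\<^bsub>add_monoid M\<^esub> inv\<^bsub>add_monoid M\<^esub> (a n \<odot>\<^bsub>M\<^esub> x) \<in> Mp.I n"
      using mem by (simp add: a_minus_def a_inv_def)
    then show "Mp.I n #>\<^bsub>add_monoid M\<^esub> (a (Suc n) \<odot>\<^bsub>M\<^esub> x) = Mp.I n #>\<^bsub>add_monoid M\<^esub> (a n \<odot>\<^bsub>M\<^esub> x)"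
      using Mp.coset_eq_iff[of "a (Suc n) \<odot>\<^bsub>M\<^esub> x" "a n \<odot>\<^bsub>M\<^esub> x" n] aR x by (simp add: P.M.smult_closed)
  qed
  have bal: "balanced R A.A M (padic_completion p (add_monoid M)) ?\<phi>"
  proof (rule balancedI)
    fix e x assume "e \<in> carrier A.A" and x: "x \<in> carrier M"
    from this(1) obtain a where a: "A.coh a" "e = A.clim a" by (rule A.A_E)
    show "?\<phi> e x \<in> carrier (padic_completion p (add_monoid M))"
      unfolding a(2) \<phi>[OF a(1) x] by (rule Mp.limit_closed[OF \<phi>_coh[OF a(1) x]])
    show "?\<phi> e (x \<oplus>\<^bsub>M\<^esub> x') = ?\<phi> e x \<otimes>\<^bsub>padic_completion p (add_monoid M)\<^esub> ?\<phi> e x'" if x': "x' \<in> carrier M" for x'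
      unfolding a(2) \<phi>[OF a(1) x] \<phi>[OF a(1) x'] \<phi>[OF a(1) P.M.M.a_closed[OF x x']]
        Mp.limit_mult[OF \<phi>_coh[OF a(1) x] \<phi>_coh[OF a(1) x']]
      using P.M.smult_r_distr[OF A.coh_closed[OF a(1)] x x'] by simp
    show "?\<phi> (r \<odot>\<^bsub>A.A\<^esub> e) x = ?\<phi> e (r \<odot>\<^bsub>M\<^esub> x)" if r: "r \<in> carrier R" for r
      unfolding a(2) A.act_lim[OF a(1) r] \<phi>[OF A.coh_act[OF a(1) r] x] \<phi>[OF a(1) P.M.smult_closed[OF r x]]
      using P.M.smult_assoc1[OF A.coh_closed[OF a(1)] r x] by simp
    fix f assume "f \<in> carrier A.A"
    then obtain c where c: "A.coh c" "f = A.clim c" by (rule A.A_E)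
    show "?\<phi> (e \<oplus>\<^bsub>A.A\<^esub> f) x = ?\<phi> e x \<otimes>\<^bsub>padic_completion p (add_monoid M)\<^esub> ?\<phi> f x"
      unfolding a(2) c(2) A.lim_add[OF a(1) c(1)] \<phi>[OF a(1) x] \<phi>[OF c(1) x] \<phi>[OF A.coh_add[OF a(1) c(1)] x]
        Mp.limit_mult[OF \<phi>_coh[OF a(1) x] \<phi>_coh[OF c(1) x]]
      using P.M.smult_l_distr[OF A.coh_closed[OF a(1)] A.coh_closed[OF c(1)] x] by simp
  qed
  let ?\<Lambda> = "completion_tensor_map p R M"
  have \<Lambda>_hom: "?\<Lambda> \<in> hom T.T (padic_completion p (add_monoid M))"
    unfolding completion_tensor_map_def by (rule T.tensor_lift_hom[OF Mp.completion_comm_group bal])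
  let ?c = "\<lambda>x. T.pure (A.clim (\<lambda>_. \<one>\<^bsub>R\<^esub>)) x"
  have one_A: "A.clim (\<lambda>_. \<one>\<^bsub>R\<^esub>) \<in> carrier A.A" by (intro A.lim_closed A.coh_const) simp
  have \<Lambda>_c: "?\<Lambda> (?c x) = Mp.limit (\<lambda>_. x)" if x: "x \<in> carrier M" for x
    unfolding completion_tensor_map_def T.tensor_lift_pure[OF Mp.completion_comm_group bal one_A x]
    using \<phi>[OF A.coh_const[OF P.M.R.one_closed] x] P.M.smult_one[OF x] by simp
  have pure_N: "T.pure e x = \<one>\<^bsub>T.T\<^esub>" if "e \<in> carrier A.A" "x \<in> S.stable_part" for e x
    by (rule completion_tensor_kills_stable_part[OF res stable that])
  have rep: "\<exists>x\<in>carrier M. t = ?c x" if "t \<in> carrier T.T" for t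
    using that
  proof (induction t rule: T.tensor_induct)
    case zero
    show ?case using T.pure_zero_right[OF one_A] by (intro bexI[of _ "\<zero>\<^bsub>M\<^esub>"]) simp_all
  next
    case (pure e x)
    obtain r w where rw: "r \<in> carrier R" "w \<in> carrier A.A"
      "e = r \<odot>\<^bsub>A.A\<^esub> A.clim (\<lambda>_. \<one>\<^bsub>R\<^esub>) \<oplus>\<^bsub>A.A\<^esub> w [^]\<^bsub>add_monoid A.A\<^esub> (p ^ n0)"
      using A.A_split[OF pure(1), of n0] by blast
    have AG: "group (add_monoid A.A)" using A.A_comm_group comm_group.axioms(2) by blast
    have wp: "w [^]\<^bsub>add_monoid A.A\<^esub> (p ^ n0) \<in> carrier A.A"
      using monoid.nat_pow_closed[OF group.is_monoid[OF AG], of w] rw(2) by simp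
    have "T.pure (w [^]\<^bsub>add_monoid A.A\<^esub> (p ^ n0)) x = T.pure w x [^]\<^bsub>T.T\<^esub> (p ^ n0)"
      using hom_nat_pow[OF T.pure_hom_left[OF pure(2)] _ AG T.T.is_group, of w "p ^ n0"] rw(2) by simp
    also have "\<dots> = T.pure w (x [^]\<^bsub>add_monoid M\<^esub> (p ^ n0))"
      using hom_nat_pow[OF T.pure_hom_right[OF rw(2)] _ P.M.M.a_group T.T.is_group, of x "p ^ n0"] pure(2) by simp
    also have "\<dots> = \<one>\<^bsub>T.T\<^esub>"
      using pure(2) by (intro pure_N rw(2)) (auto simp: power_image_def)
    finally have w1: "T.pure (w [^]\<^bsub>add_monoid A.A\<^esub> (p ^ n0)) x = \<one>\<^bsub>T.T\<^esub>" .
    have r1: "r \<odot>\<^bsub>A.A\<^esub> A.clim (\<lambda>_. \<one>\<^bsub>R\<^esub>) \<in> carrier A.A" by (rule T.A.act_closed[OF rw(1) one_A])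
    have "T.pure e x = ?c (r \<odot>\<^bsub>M\<^esub> x)"
      unfolding rw(3) T.pure_add_left[OF r1 wp pure(2)] w1 T.pure_balanced[OF rw(1) one_A pure(2)]
      using T.pure_closed[OF one_A P.M.smult_closed[OF rw(1) pure(2)]] by simp
    then show ?case using P.M.smult_closed[OF rw(1) pure(2)] by blast
  next
    case (add s t)
    then obtain x y where "x \<in> carrier M" "s = ?c x" "y \<in> carrier M" "t = ?c y" by blast
    then show ?case using T.pure_add_right[OF one_A] by (intro bexI[of _ "x \<oplus>\<^bsub>M\<^esub> y"]) simp_all
  qed
  interpret \<Lambda>: group_hom T.T "padic_completion p (add_monoid M)" ?\<Lambda>
    by (intro group_hom.intro group_hom_axioms.intro T.T.is_group comm_group.axioms(2)[OF Mp.completion_comm_group] \<Lambda>_hom)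
  have inj: "inj_on ?\<Lambda> (carrier T.T)"
  proof (rule \<Lambda>.trivial_ker_imp_inj, intro equalityI subsetI)
    fix t assume "t \<in> kernel T.T (padic_completion p (add_monoid M)) ?\<Lambda>"
    then have t: "t \<in> carrier T.T" "?\<Lambda> t = \<one>\<^bsub>padic_completion p (add_monoid M)\<^esub>" by (auto simp: kernel_def)
    obtain x where x: "x \<in> carrier M" "t = ?c x" using rep[OF t(1)] by blast
    have "Mp.limit (\<lambda>_. x) = Mp.limit (\<lambda>_. \<one>\<^bsub>add_monoid M\<^esub>)"
      using t(2) \<Lambda>_c[OF x(1)] x(2) Mp.limit_one by simp
    then have "Mp.limit (\<lambda>_. x) n0 = Mp.limit (\<lambda>_. \<one>\<^bsub>add_monoid M\<^esub>) n0" by simp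
    then have "x \<in> S.stable_part"
      using Mp.coset_eq_iff[of x "\<zero>\<^bsub>M\<^esub>" n0] x(1) by (simp add: Mp.limit_def)
    then show "t \<in> {\<one>\<^bsub>T.T\<^esub>}" using pure_N[OF one_A] x(2) by simp
  next
    fix t assume "t \<in> {\<one>\<^bsub>T.T\<^esub>}"
    then show "t \<in> kernel T.T (padic_completion p (add_monoid M)) ?\<Lambda>" by (simp add: kernel_def)
  qed
  have "y \<in> ?\<Lambda> ` carrier T.T" if y: "y \<in> carrier (padic_completion p (add_monoid M))" for y
  proof -
    obtain s where s: "Mp.coherent s" "y = Mp.limit s" using y by (rule Mp.completionE)
    have sM: "s n0 \<in> carrier M" using Mp.coherent_closed[OF s(1), of n0] by simp
    have cl: "Mp.limit (\<lambda>_. s n0) \<in> carrier (padic_completion p (add_monoid M))"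
      by (intro Mp.limit_closed Mp.coherent_const) (simp add: sM)
    have "inj_on (\<lambda>x. x n0) (carrier (padic_completion p (add_monoid M)))"
      using S.completion_iso by (simp add: iso_def bij_betw_def)
    moreover have "Mp.limit (\<lambda>_. s n0) n0 = y n0" by (simp add: s(2) Mp.limit_def)
    ultimately have "Mp.limit (\<lambda>_. s n0) = y" using cl y by (meson inj_onD)
    then show ?thesis using \<Lambda>_c[OF sM] T.pure_closed[OF one_A sM] by (intro image_eqI[of _ _ "?c (s n0)"]) simp_all
  qed
  then show ?thesis
    using \<Lambda>_hom inj \<Lambda>.hom_closed by (auto simp: iso_def bij_betw_def)
qed

section \<open>Rational coefficients\<close>

lemma int_right_module:
  assumes "abelian_group S"
  shows "right_module \<Z> (int_module S)"
proof -
  interpret S: abelian_group S by fact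
  have "comm_group (add_monoid (int_module S))"
    by (rule comm_group_cong[OF S.a_comm_group]) (simp_all add: int_module_def)
  then have ab: "abelian_group (int_module S)" by (rule comm_group_abelian_groupI)
  show ?thesis
    by (intro right_module.intro right_module_axioms.intro ab cring.axioms(1)[OF int_is_cring])
      (simp_all add: int_module_def S.add.int_pow_mult S.add.int_pow_distrib S.add.int_pow_pow mult.commute)
qed

lemma int_left_module:
  assumes "abelian_group S"
  shows "left_module \<Z> (int_module S)"
proof -
  interpret S: abelian_group S by fact
  have "comm_group (add_monoid (int_module S))"
    by (rule comm_group_cong[OF S.a_comm_group]) (simp_all add: int_module_def)
  then have ab: "abelian_group (int_module S)" by (rule comm_group_abelian_groupI)
  show ?thesis
    by (intro left_module.intro left_module_axioms.intro ab cring.axioms(1)[OF int_is_cring])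
      (simp_all add: int_module_def S.add.int_pow_mult S.add.int_pow_distrib S.add.int_pow_pow mult.commute)
qed

lemma rat_abelian_group: "abelian_group rat_ring"
  by (rule abelian_groupI) (auto simp: rat_ring_def intro: exI[of _ "- _"])

abbreviation "Q_module \<equiv> int_module rat_ring"

lemma rat_pow: "x [^]\<^bsub>add_monoid rat_ring\<^esub> (n::nat) = of_nat n * x"
  by (induction n) (simp_all add: rat_ring_def nat_pow_def algebra_simps)

lemma rat_int_mult: "[(k::int)] \<cdot>\<^bsub>rat_ring\<^esub> x = of_int k * x"
proof -
  interpret Q: abelian_group rat_ring by (rule rat_abelian_group)
  have neg: "inv\<^bsub>add_monoid rat_ring\<^esub> y = - y" for y
    by (rule Q.add.inv_equality[unfolded a_inv_def]) (simp_all add: rat_ring_def)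
  show ?thesis
    unfolding add_pow_def int_pow_def2 rat_pow neg by (simp add: of_nat_nat)
qed

lemma Q_module_simps [simp]:
  "carrier Q_module = UNIV" "x \<oplus>\<^bsub>Q_module\<^esub> y = x + y" "\<zero>\<^bsub>Q_module\<^esub> = 0"
  "k \<odot>\<^bsub>Q_module\<^esub> x = of_int k * x"
  by (simp_all add: int_module_def rat_int_mult) (simp_all add: rat_ring_def)

locale rationalization = E: abelian_group S for S :: "('a, 'l) ring_scheme" (structure)
begin

abbreviation "E_module \<equiv> int_module S"

lemma E_simps [simp]:
  "carrier E_module = carrier S" "x \<oplus>\<^bsub>E_module\<^esub> y = x \<oplus> y" "\<zero>\<^bsub>E_module\<^esub> = \<zero>"
  "k \<odot>\<^bsub>E_module\<^esub> x = [k] \<cdot> x"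
  by (simp_all add: int_module_def)

sublocale EQ: tensor_product \<Z> E_module Q_module
  by (intro tensor_product.intro int_right_module int_left_module rat_abelian_group E.abelian_group_axioms)

notation EQ.pure (infixl \<open>\<otimes>\<^sub>Q\<close> 75)

lemma pure_int: "e \<in> carrier S \<Longrightarrow> ([(k::int)] \<cdot> e) \<otimes>\<^sub>Q q = e \<otimes>\<^sub>Q (of_int k * q)"
  using EQ.pure_balanced[of k e q] by simp

lemma pure_pow: "e \<in> carrier S \<Longrightarrow> (e \<otimes>\<^sub>Q q) [^]\<^bsub>EQ.T\<^esub> (n::nat) = e \<otimes>\<^sub>Q (of_nat n * q)"
proof (induction n)
  case 0
  then show ?case using EQ.pure_zero_right[of e] by simp
next
  case (Suc n)
  then show ?case using EQ.pure_add_right[of e "of_nat n * q" q] by (simp add: algebra_simps)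
qed

text \<open>On \<open>e \<otimes> q\<close> this is \<open>L q\<close> times \<open>e\<close>, provided that \<open>L\<close> is a multiple of the denominator of \<open>q\<close>. For other \<open>L\<close> the
  value is meaningless, but the floor makes the map a homomorphism on the whole free group.\<close>

definition clear_denominators :: "int \<Rightarrow> ('a \<times> rat \<Rightarrow>\<^sub>0 int) \<Rightarrow> 'a" where
  "clear_denominators L = comm_group.frag_eval (add_monoid S) (\<lambda>k. [\<lfloor>of_int L * snd k\<rfloor>] \<cdot> fst k)"

lemma common_denominator: "\<exists>L>0. \<exists>k. of_int L * (q::rat) = of_int k"
proof -
  obtain a b where "quotient_of q = (a, b)" by (cases "quotient_of q")
  then have "q = of_int a / of_int b" "b > 0" using quotient_of_div quotient_of_denom_pos by blast+
  then show ?thesis by (intro exI[of _ b] conjI exI[of _ a]) simp_all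
qed

text \<open>Consider the combinations that are annihilated by \<open>clear_denominators\<close> for all multiples of some positive
  \<open>L\<close>. They form a subgroup, because any two such \<open>L\<close> have a common multiple, and it contains the defining
  relations, because each of these involves finitely many denominators. So \<open>e \<otimes> 1 = 0\<close> implies
  \<open>L e = 0\<close>.\<close>

lemma pure_one_zero_imp_torsion:
  assumes e: "e \<in> carrier S" and zero: "e \<otimes>\<^sub>Q 1 = \<one>\<^bsub>EQ.T\<^esub>"
  obtains L :: nat where "L > 0" "[L] \<cdot> e = \<zero>"
proof -
  let ?G = "add_monoid S"
  let ?X = "carrier S \<times> (UNIV :: rat set)"
  let ?f = "\<lambda>L k. [\<lfloor>of_int L * snd k\<rfloor>] \<cdot> fst k"
  have f: "?f L \<in> ?X \<rightarrow> carrier ?G" for L :: int by auto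
  interpret \<sigma>: group_hom EQ.FA ?G "clear_denominators L" for L
    unfolding clear_denominators_def
    using comm_group.frag_eval_hom[OF E.a_comm_group f[of L]] by (intro group_hom.intro group_hom_axioms.intro) (simp_all add: E.a_group)
  have of: "clear_denominators L (frag_of k) = ?f L k" if "fst k \<in> carrier S" for L k
    unfolding clear_denominators_def using that by (intro comm_group.frag_eval_of[OF E.a_comm_group]) simp
  have diff: "clear_denominators L (c - d) = clear_denominators L c \<oplus> (\<ominus> clear_denominators L d)"
    "c - d \<in> carrier EQ.FA"
    if "c \<in> carrier EQ.FA" "d \<in> carrier EQ.FA" for L c d
    unfolding clear_denominators_def
    using comm_group.frag_eval_diff[OF E.a_comm_group f[of L], of c d] that keys_diff[of c d] by (auto simp: a_inv_def)
  have diff3: "clear_denominators L (c - d - e) =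
      clear_denominators L c \<oplus> (\<ominus> clear_denominators L d) \<oplus> (\<ominus> clear_denominators L e)"
    if "c \<in> carrier EQ.FA" "d \<in> carrier EQ.FA" "e \<in> carrier EQ.FA" for L c d e
    by (simp only: diff(1)[OF diff(2)[OF that(1,2)] that(3)] diff(1)[OF that(1,2)])
  \<comment> \<open>The quantifier over the multiples of \<open>L\<close> makes this set closed under addition.\<close>
  let ?K = "{c \<in> carrier EQ.FA. \<exists>L>0. \<forall>M>0. clear_denominators (L * M) c = \<zero>}"
  have K: "subgroup ?K EQ.FA"
  proof (rule group.subgroupI)
    show "group EQ.FA" by simp
    show "?K \<noteq> {}" using \<sigma>.hom_one by (auto intro!: exI[of _ 0] exI[of _ 1])
    show "?K \<subseteq> carrier EQ.FA" by blast
    fix c assume c: "c \<in> ?K"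
    then obtain L where L: "L > 0" "\<And>M. M > 0 \<Longrightarrow> clear_denominators (L * M) c = \<zero>" by blast
    show "inv\<^bsub>EQ.FA\<^esub> c \<in> ?K"
      using c L \<sigma>.hom_inv[of c] by (auto simp del: inv_free_Abelian_group carrier_free_Abelian_group_iff
          intro!: exI[of _ L])
    fix d assume d: "d \<in> ?K"
    then obtain L' where L': "L' > 0" "\<And>M. M > 0 \<Longrightarrow> clear_denominators (L' * M) d = \<zero>" by blast
    have "clear_denominators (L * L' * M) (c \<otimes>\<^bsub>EQ.FA\<^esub> d) = \<zero>" if "M > 0" for M
      using \<sigma>.hom_mult[of c d "L * L' * M"] L(2)[of "L' * M"] L'(2)[of "L * M"] L(1) L'(1) that c d
      by (simp add: mult.assoc mult.left_commute del: mult_free_Abelian_group)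
    then show "c \<otimes>\<^bsub>EQ.FA\<^esub> d \<in> ?K"
      using c d L(1) L'(1) group.is_monoid[OF group_free_Abelian_group]
      by (auto simp del: mult_free_Abelian_group carrier_free_Abelian_group_iff
          intro!: monoid.m_closed exI[of _ "L * L'"])
  qed
  have floor: "\<lfloor>of_int (L * M) * q\<rfloor> = k * M" if "of_int L * (q::rat) = of_int k" for L M k q
  proof -
    have "of_int (L * M) * q = of_int (k * M)" using that by (simp add: mult.commute mult.left_commute)
    then show ?thesis by (simp only: floor_of_int)
  qed
  have add_neg: "x \<oplus> y \<oplus> (\<ominus> x) \<oplus> (\<ominus> y) = \<zero>" if "x \<in> carrier S" "y \<in> carrier S" for x y
    using that by (simp add: E.a_assoc E.a_lcomm[of y] E.r_neg)
  have "tensor_relations \<Z> E_module Q_module \<subseteq> ?K"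
  proof
    fix c assume c: "c \<in> tensor_relations \<Z> E_module Q_module"
    then have cF: "c \<in> carrier EQ.FA" using EQ.relations_closed by blast
    have in_F: "frag_of (a, q) \<in> carrier EQ.FA" if "a \<in> carrier S" for a and q :: rat using that by simp
    from c show "c \<in> ?K"
      unfolding tensor_relations_def
    proof (elim UnE CollectE exE conjE)
      fix a a' q assume c: "c = frag_of (a \<oplus>\<^bsub>E_module\<^esub> a', q) - frag_of (a, q) - frag_of (a', q)"
        and "a \<in> carrier E_module" "a' \<in> carrier E_module"
      then have a: "a \<in> carrier S" "a' \<in> carrier S" by simp_all
      have "clear_denominators L c = \<zero>" for L
        unfolding c E_simps(2) diff3[OF in_F[OF E.a_closed[OF a]] in_F[OF a(1)] in_F[OF a(2)]]
        using a add_neg[of "[\<lfloor>of_int L * q\<rfloor>] \<cdot> a" "[\<lfloor>of_int L * q\<rfloor>] \<cdot> a'"]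
        by (simp add: of E.add.int_pow_distrib)
      then show ?thesis using cF by (auto intro!: exI[of _ 1])
    next
      fix a q q' assume c: "c = frag_of (a, q \<oplus>\<^bsub>Q_module\<^esub> q') - frag_of (a, q) - frag_of (a, q')"
        and "a \<in> carrier E_module"
      then have a: "a \<in> carrier S" by simp
      obtain L k where L: "L > 0" "of_int L * q = of_int k" using common_denominator by blast
      obtain L' k' where L': "L' > 0" "of_int L' * q' = of_int k'" using common_denominator by blast
      have "clear_denominators (L * L' * M) c = \<zero>" for M
      proof -
        have 1: "\<lfloor>of_int (L * L' * M) * q\<rfloor> = k * (L' * M)"
          using floor[OF L(2), of "L' * M"] by (simp add: mult.assoc)
        have 2: "\<lfloor>of_int (L * L' * M) * q'\<rfloor> = k' * (L * M)"
          using floor[OF L'(2), of "L * M"] by (simp add: mult.assoc mult.left_commute)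
        have "of_int (L * L') * (q + q') = of_int (k * L' + k' * L)"
          using L(2) L'(2) by (simp add: algebra_simps)
        from floor[OF this, of M] have 3: "\<lfloor>of_int (L * L' * M) * (q + q')\<rfloor> = k * (L' * M) + k' * (L * M)"
          by (simp add: algebra_simps)
        show ?thesis
          unfolding c Q_module_simps(2) diff3[OF in_F[OF a] in_F[OF a] in_F[OF a]]
          using a add_neg[of "[(k * (L' * M))] \<cdot> a" "[(k' * (L * M))] \<cdot> a"]
          by (simp add: of 1 2 3 E.add.int_pow_mult del: of_int_mult)
      qed
      then show ?thesis using cF L(1) L'(1) by (auto intro!: exI[of _ "L * L'"])
    next
      fix r a q assume c: "c = frag_of (r \<odot>\<^bsub>E_module\<^esub> a, q) - frag_of (a, r \<odot>\<^bsub>Q_module\<^esub> q)"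
        and "a \<in> carrier E_module"
      then have a: "a \<in> carrier S" by simp
      obtain L k where L: "L > 0" "of_int L * q = of_int k" using common_denominator by blast
      have "clear_denominators (L * M) c = \<zero>" for M
      proof -
        have 1: "\<lfloor>of_int (L * M) * q\<rfloor> = k * M" by (rule floor[OF L(2)])
        have "of_int L * (of_int r * q) = of_int (r * k)" using L(2) by (simp add: mult.left_commute)
        from floor[OF this, of M] have 2: "\<lfloor>of_int (L * M) * (of_int r * q)\<rfloor> = r * k * M" .
        show ?thesis
          unfolding c E_simps(4) Q_module_simps(4) diff(1)[OF in_F[OF E.add.int_pow_closed[OF a]] in_F[OF a]]
          using a by (simp add: of 1 2 E.add.int_pow_pow E.r_neg mult.assoc del: of_int_mult)
      qed
      then show ?thesis using cF L(1) by (auto intro!: exI[of _ L])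
    qed
  qed
  then have "EQ.K \<subseteq> ?K"
    unfolding tensor_kernel_def by (intro group.generate_subgroup_incl K) simp_all
  moreover have "frag_of (e, 1) \<in> EQ.K"
    using zero group.coset_join1[OF group_free_Abelian_group _ _ EQ.kernel_subgroup, of "frag_of (e, 1)"] e
    by (simp add: pure_tensor_def tensor_def)
  ultimately have "frag_of (e, 1) \<in> ?K" by (rule subsetD)
  then have "\<exists>L>0. \<forall>M>0. clear_denominators (L * M) (frag_of (e, 1)) = \<zero>"
    unfolding mem_Collect_eq by (rule conjunct2)
  then obtain L where "L > 0 \<and> (\<forall>M>0. clear_denominators (L * M) (frag_of (e, 1)) = \<zero>)" by (rule exE)
  then have L: "L > 0" "clear_denominators (L * 1) (frag_of (e, 1)) = \<zero>"
    using zero_less_one by (blast, blast)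
  then have "[L] \<cdot> e = \<zero>" using of[of "(e, 1)" L] e by simp
  moreover have "[(nat L)] \<cdot> e = [L] \<cdot> e"
    unfolding add_pow_def int_pow_int[symmetric] using L(1) by (simp only: int_nat_eq less_imp_le if_True)
  ultimately have "[(nat L)] \<cdot> e = \<zero>" by (rule trans[rotated])
  moreover have "nat L > 0" using L(1) by simp
  ultimately show thesis by (rule that[rotated])
qed

lemma rational_form:
  assumes "t \<in> carrier EQ.T"
  obtains e L where "e \<in> carrier S" "L > (0::nat)" "t = e \<otimes>\<^sub>Q (1 / of_nat L)"
proof -
  have "\<exists>e\<in>carrier S. \<exists>L>(0::nat). t = e \<otimes>\<^sub>Q (1 / of_nat L)"
    using assms
  proof (induction t rule: EQ.tensor_induct)
    case zero
    show ?case using EQ.pure_zero_left[of 1] by (intro bexI[of _ \<zero>] exI[of _ 1]) simp_all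
  next
    case (pure e q)
    then have e: "e \<in> carrier S" by simp
    obtain L k where L: "L > 0" "of_int L * q = of_int k" using common_denominator by blast
    then have "of_int k * (1 / of_nat (nat L)) = q" by (simp add: field_simps of_nat_nat)
    then have "e \<otimes>\<^sub>Q q = ([k] \<cdot> e) \<otimes>\<^sub>Q (1 / of_nat (nat L))" using pure_int[OF e, of k "1 / of_nat (nat L)"] by simp
    then show ?case using e L(1) by (intro bexI[of _ "[k] \<cdot> e"] exI[of _ "nat L"]) simp_all
  next
    case (add s t)
    then obtain e L f L' where s: "e \<in> carrier S" "L > (0::nat)" "s = e \<otimes>\<^sub>Q (1 / of_nat L)"
      and t: "f \<in> carrier S" "L' > (0::nat)" "t = f \<otimes>\<^sub>Q (1 / of_nat L')" by blast
    have "s = ([(int L')] \<cdot> e) \<otimes>\<^sub>Q (1 / of_nat (L * L'))" "t = ([(int L)] \<cdot> f) \<otimes>\<^sub>Q (1 / of_nat (L * L'))"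
      unfolding pure_int[OF s(1)] pure_int[OF t(1)] s(3) t(3) using s(2) t(2) by (simp_all add: field_simps)
    then have "s \<otimes>\<^bsub>EQ.T\<^esub> t = ([(int L')] \<cdot> e \<oplus> [(int L)] \<cdot> f) \<otimes>\<^sub>Q (1 / of_nat (L * L'))"
      using EQ.pure_add_left[of "[(int L')] \<cdot> e" "[(int L)] \<cdot> f" "1 / of_nat (L * L')"] s(1) t(1) by simp
    then show ?case
      using s t by (intro bexI[of _ "[(int L')] \<cdot> e \<oplus> [(int L)] \<cdot> f"] exI[of _ "L * L'"]) simp_all
  qed
  then show thesis using that by blast
qed

lemma rational_torsion_free:
  assumes t: "t \<in> carrier EQ.T" and k: "t [^]\<^bsub>EQ.T\<^esub> k = \<one>\<^bsub>EQ.T\<^esub>" "k > (0::nat)"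
  shows "t = \<one>\<^bsub>EQ.T\<^esub>"
proof -
  obtain e L where e: "e \<in> carrier S" "L > (0::nat)" "t = e \<otimes>\<^sub>Q (1 / of_nat L)" using t by (rule rational_form)
  have "([(int k)] \<cdot> e) \<otimes>\<^sub>Q 1 = (t [^]\<^bsub>EQ.T\<^esub> k) [^]\<^bsub>EQ.T\<^esub> L"
    unfolding e(3) using e(1,2) by (simp add: pure_pow pure_int)
  also have "\<dots> = \<one>\<^bsub>EQ.T\<^esub>" unfolding k(1) by simp
  finally have "([(int k)] \<cdot> e) \<otimes>\<^sub>Q 1 = \<one>\<^bsub>EQ.T\<^esub>" .
  then obtain N :: nat where N: "N > 0" "[N] \<cdot> ([(int k)] \<cdot> e) = \<zero>"
    using pure_one_zero_imp_torsion[of "[(int k)] \<cdot> e"] e(1) by auto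
  have N': "[(int N)] \<cdot> ([(int k)] \<cdot> e) = \<zero>" using N(2) by (simp add: add_pow_def int_pow_int)
  have "t = ([(int N)] \<cdot> ([(int k)] \<cdot> e)) \<otimes>\<^sub>Q (1 / of_nat (N * k * L))"
    unfolding e(3) using e(1,2) N(1) k(2) by (simp add: pure_int)
  then show ?thesis unfolding N' using EQ.pure_zero_left by simp
qed

lemma rational_divisible:
  assumes "t \<in> carrier EQ.T" "k > (0::nat)"
  obtains s where "s \<in> carrier EQ.T" "s [^]\<^bsub>EQ.T\<^esub> k = t"
proof -
  obtain e L where e: "e \<in> carrier S" "L > (0::nat)" "t = e \<otimes>\<^sub>Q (1 / of_nat L)" using assms(1) by (rule rational_form)
  then have "(e \<otimes>\<^sub>Q (1 / of_nat (k * L))) [^]\<^bsub>EQ.T\<^esub> k = t" using assms(2) by (simp add: pure_pow)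
  then show thesis using e(1) by (intro that[of "e \<otimes>\<^sub>Q (1 / of_nat (k * L))"]) simp_all
qed

end

section \<open>The rationalization of the completed ring\<close>

context completed_ring
begin

abbreviation "S \<equiv> padic_completion_ring p R"
abbreviation "A_Q \<equiv> rational_completed_ring_module p R"

lemma S_simps: "carrier S = carrier A" "add S = add A" "\<zero>\<^bsub>S\<^esub> = \<zero>\<^bsub>A\<^esub>"
  by (simp_all add: completed_ring_module_def right_module_via_def)

lemma S_abelian_group: "abelian_group S"
  by (rule comm_group_abelian_groupI, rule comm_group_cong[OF A_comm_group]) (simp_all add: S_simps)

sublocale Q: rationalization S
  by (intro rationalization.intro S_abelian_group)

sublocale A: right_module R A
  by (rule right_module_A)

notation Q.EQ.pure (infixl \<open>\<otimes>\<^sub>Q\<close> 75)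

lemma A_Q_simps:
  "carrier A_Q = carrier Q.EQ.T" "add A_Q = monoid.mult Q.EQ.T" "\<zero>\<^bsub>A_Q\<^esub> = \<one>\<^bsub>Q.EQ.T\<^esub>"
  "r \<odot>\<^bsub>A_Q\<^esub> t = tensor_lift Q.EQ.T (\<lambda>e q. (r \<odot>\<^bsub>A\<^esub> e) \<otimes>\<^sub>Q q) t"
  by (simp_all add: rational_completed_ring_module_def Let_def)

lemma act_int_mult:
  assumes "r \<in> carrier R" "e \<in> carrier A"
  shows "r \<odot>\<^bsub>A\<^esub> ([(k::int)] \<cdot>\<^bsub>S\<^esub> e) = [k] \<cdot>\<^bsub>S\<^esub> (r \<odot>\<^bsub>A\<^esub> e)"
proof -
  have "(\<lambda>e. r \<odot>\<^bsub>A\<^esub> e) \<in> hom (add_monoid S) (add_monoid S)"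
    using assms(1) by (simp add: hom_def S_simps A.act_closed A.act_add)
  then show ?thesis
    using hom_int_pow[of _ "add_monoid S" "add_monoid S" e k] assms(2) abelian_group.a_group[OF S_abelian_group]
    by (simp add: add_pow_def S_simps)
qed

lemma act_balanced:
  assumes r: "r \<in> carrier R"
  shows "balanced \<Z> Q.E_module Q_module Q.EQ.T (\<lambda>e q. (r \<odot>\<^bsub>A\<^esub> e) \<otimes>\<^sub>Q q)"
proof (rule balancedI)
  fix e q assume "e \<in> carrier Q.E_module"
  then have e: "e \<in> carrier A" and re: "r \<odot>\<^bsub>A\<^esub> e \<in> carrier S" using r by (simp_all add: S_simps A.act_closed)
  show "(r \<odot>\<^bsub>A\<^esub> e) \<otimes>\<^sub>Q q \<in> carrier Q.EQ.T" using re by simp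
  show "(r \<odot>\<^bsub>A\<^esub> e) \<otimes>\<^sub>Q (q \<oplus>\<^bsub>Q_module\<^esub> q') = (r \<odot>\<^bsub>A\<^esub> e) \<otimes>\<^sub>Q q \<otimes>\<^bsub>Q.EQ.T\<^esub> (r \<odot>\<^bsub>A\<^esub> e) \<otimes>\<^sub>Q q'" for q'
    using re by (intro Q.EQ.pure_add_right) simp_all
  show "(r \<odot>\<^bsub>A\<^esub> (k \<odot>\<^bsub>Q.E_module\<^esub> e)) \<otimes>\<^sub>Q q = (r \<odot>\<^bsub>A\<^esub> e) \<otimes>\<^sub>Q (k \<odot>\<^bsub>Q_module\<^esub> q)" for k
    using act_int_mult[OF r e, of k] Q.pure_int[OF re, of k q] by simp
  fix f assume "f \<in> carrier Q.E_module"
  then have f: "f \<in> carrier A" and rf: "r \<odot>\<^bsub>A\<^esub> f \<in> carrier S" using r by (simp_all add: S_simps A.act_closed)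
  show "(r \<odot>\<^bsub>A\<^esub> (e \<oplus>\<^bsub>Q.E_module\<^esub> f)) \<otimes>\<^sub>Q q = (r \<odot>\<^bsub>A\<^esub> e) \<otimes>\<^sub>Q q \<otimes>\<^bsub>Q.EQ.T\<^esub> (r \<odot>\<^bsub>A\<^esub> f) \<otimes>\<^sub>Q q"
    using Q.EQ.pure_add_left[of "r \<odot>\<^bsub>A\<^esub> e" "r \<odot>\<^bsub>A\<^esub> f" q] re rf A.act_add[OF r e f] by (simp add: S_simps)
qed

lemma A_Q_act_hom: "r \<in> carrier R \<Longrightarrow> (\<lambda>t. r \<odot>\<^bsub>A_Q\<^esub> t) \<in> hom Q.EQ.T Q.EQ.T"
  unfolding A_Q_simps(4) using Q.EQ.tensor_lift_hom[OF Q.EQ.tensor_comm_group act_balanced] .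

lemma A_Q_act_pure:
  "\<lbrakk>r \<in> carrier R; e \<in> carrier A\<rbrakk> \<Longrightarrow> r \<odot>\<^bsub>A_Q\<^esub> (e \<otimes>\<^sub>Q q) = (r \<odot>\<^bsub>A\<^esub> e) \<otimes>\<^sub>Q q"
  unfolding A_Q_simps(4)
  by (rule Q.EQ.tensor_lift_pure[OF Q.EQ.tensor_comm_group act_balanced]) (simp_all add: S_simps)

lemma A_Q_comm_group: "comm_group (add_monoid A_Q)"
  by (rule comm_group_cong[OF Q.EQ.tensor_comm_group]) (simp_all add: A_Q_simps)

lemma right_module_A_Q: "right_module R A_Q"
proof (intro right_module.intro right_module_axioms.intro)
  show "ring R" by (rule ring_axioms)
  show "abelian_group A_Q" by (rule comm_group_abelian_groupI[OF A_Q_comm_group])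
  note G = Q.EQ.T.is_group
  have e_cl: "e \<in> carrier Q.E_module \<Longrightarrow> e \<in> carrier A" for e by (simp add: S_simps)
  fix r t assume r: "r \<in> carrier R" and t: "t \<in> carrier A_Q"
  have t': "t \<in> carrier Q.EQ.T" using t by (simp add: A_Q_simps)
  show "r \<odot>\<^bsub>A_Q\<^esub> t \<in> carrier A_Q" using hom_in_carrier[OF A_Q_act_hom[OF r] t'] by (simp add: A_Q_simps(1))
  show "r \<odot>\<^bsub>A_Q\<^esub> (t \<oplus>\<^bsub>A_Q\<^esub> u) = r \<odot>\<^bsub>A_Q\<^esub> t \<oplus>\<^bsub>A_Q\<^esub> r \<odot>\<^bsub>A_Q\<^esub> u" if "u \<in> carrier A_Q" for u
    using hom_mult[OF A_Q_act_hom[OF r] t', of u] that by (simp add: A_Q_simps(1,2))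
  fix s assume s: "s \<in> carrier R"
  show "(r \<oplus> s) \<odot>\<^bsub>A_Q\<^esub> t = r \<odot>\<^bsub>A_Q\<^esub> t \<oplus>\<^bsub>A_Q\<^esub> s \<odot>\<^bsub>A_Q\<^esub> t"
    unfolding A_Q_simps(2)
  proof (rule Q.EQ.hom_eqI[OF A_Q_act_hom hom_multI[OF A_Q_act_hom[OF r] A_Q_act_hom[OF s] Q.EQ.tensor_comm_group] G _ t'])
    show "r \<oplus> s \<in> carrier R" using r s by simp
    fix e q assume e: "e \<in> carrier Q.E_module"
    show "(r \<oplus> s) \<odot>\<^bsub>A_Q\<^esub> (e \<otimes>\<^sub>Q q) = (r \<odot>\<^bsub>A_Q\<^esub> (e \<otimes>\<^sub>Q q)) \<otimes>\<^bsub>Q.EQ.T\<^esub> (s \<odot>\<^bsub>A_Q\<^esub> (e \<otimes>\<^sub>Q q))"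
      using Q.EQ.pure_add_left[of "r \<odot>\<^bsub>A\<^esub> e" "s \<odot>\<^bsub>A\<^esub> e" q] r s e_cl[OF e]
      by (simp add: A_Q_act_pure A.act_add_scalar S_simps A.act_closed)
  qed
  have comp: "(\<lambda>t. s \<odot>\<^bsub>A_Q\<^esub> (r \<odot>\<^bsub>A_Q\<^esub> t)) \<in> hom Q.EQ.T Q.EQ.T"
    using hom_compose[OF A_Q_act_hom[OF r] A_Q_act_hom[OF s]] by (simp add: comp_def)
  show "(r \<otimes> s) \<odot>\<^bsub>A_Q\<^esub> t = s \<odot>\<^bsub>A_Q\<^esub> (r \<odot>\<^bsub>A_Q\<^esub> t)"
  proof (rule Q.EQ.hom_eqI[OF A_Q_act_hom comp G _ t'])
    show "r \<otimes> s \<in> carrier R" using r s by simp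
    fix e q assume e: "e \<in> carrier Q.E_module"
    show "(r \<otimes> s) \<odot>\<^bsub>A_Q\<^esub> (e \<otimes>\<^sub>Q q) = s \<odot>\<^bsub>A_Q\<^esub> (r \<odot>\<^bsub>A_Q\<^esub> (e \<otimes>\<^sub>Q q))"
      using r s e_cl[OF e] by (simp add: A_Q_act_pure A.act_mult A.act_closed)
  qed
next
  fix t assume "t \<in> carrier A_Q"
  then have t': "t \<in> carrier Q.EQ.T" by (simp add: A_Q_simps)
  show "\<one> \<odot>\<^bsub>A_Q\<^esub> t = t"
  proof (rule Q.EQ.hom_eqI[OF A_Q_act_hom[OF one_closed] _ Q.EQ.T.is_group _ t'])
    show "(\<lambda>t. t) \<in> hom Q.EQ.T Q.EQ.T" by (simp add: hom_def)
    show "\<one> \<odot>\<^bsub>A_Q\<^esub> (e \<otimes>\<^sub>Q q) = e \<otimes>\<^sub>Q q" if "e \<in> carrier Q.E_module" for e q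
      using that by (simp add: A_Q_act_pure A.act_one S_simps)
  qed
qed

lemma A_Q_pow: "t [^]\<^bsub>add_monoid A_Q\<^esub> (k::nat) = t [^]\<^bsub>Q.EQ.T\<^esub> k"
  by (rule nat_pow_cong) (simp_all add: A_Q_simps)

end

section \<open>Clearing denominators in tensor products\<close>

locale completed_tensor = completed_ring R p + finite_dual_based_tensor R P J b \<phi> "completed_ring_module p R"
  for R :: "('r, 'k) ring_scheme" (structure) and p :: nat and P :: "('r, 'q) module"
    and J :: "'j set" and b \<phi>
begin

sublocale PQ: finite_dual_based_tensor R P J b \<phi> A_Q
  by (intro finite_dual_based_tensor.intro dual_based_module_axioms right_module_A_Q
      finite_dual_based_tensor_axioms.intro finite_J)

abbreviation "T_Q \<equiv> tensor R A_Q P"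

definition rationalize :: "((nat \<Rightarrow> 'r set) \<times> 'q \<Rightarrow>\<^sub>0 int) set \<Rightarrow>
    (((nat \<Rightarrow> 'r set) \<times> rat \<Rightarrow>\<^sub>0 int) set \<times> 'q \<Rightarrow>\<^sub>0 int) set" where
  "rationalize = tensor_lift T_Q (\<lambda>e x. PQ.pure (e \<otimes>\<^sub>Q 1) x)"

lemma pure_one_closed: "e \<in> carrier A \<Longrightarrow> e \<otimes>\<^sub>Q 1 \<in> carrier A_Q"
  by (simp add: A_Q_simps(1) S_simps)

lemma rationalize_balanced: "balanced R A P T_Q (\<lambda>e x. PQ.pure (e \<otimes>\<^sub>Q 1) x)"
proof (rule balancedI)
  fix e x assume e: "e \<in> carrier A" and x: "x \<in> carrier P"
  show "PQ.pure (e \<otimes>\<^sub>Q 1) x \<in> carrier T_Q" by (rule PQ.pure_closed[OF pure_one_closed[OF e] x])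
  show "PQ.pure (e \<otimes>\<^sub>Q 1) (x \<oplus>\<^bsub>P\<^esub> y) = PQ.pure (e \<otimes>\<^sub>Q 1) x \<otimes>\<^bsub>T_Q\<^esub> PQ.pure (e \<otimes>\<^sub>Q 1) y"
    if "y \<in> carrier P" for y
    by (rule PQ.pure_add_right[OF pure_one_closed[OF e] x that])
  show "PQ.pure ((r \<odot>\<^bsub>A\<^esub> e) \<otimes>\<^sub>Q 1) x = PQ.pure (e \<otimes>\<^sub>Q 1) (r \<odot>\<^bsub>P\<^esub> x)" if "r \<in> carrier R" for r
    using PQ.pure_balanced[OF that pure_one_closed[OF e] x] A_Q_act_pure[OF that e] by simp
  fix f assume f: "f \<in> carrier A"
  have "(e \<oplus>\<^bsub>A\<^esub> f) \<otimes>\<^sub>Q 1 = e \<otimes>\<^sub>Q 1 \<oplus>\<^bsub>A_Q\<^esub> f \<otimes>\<^sub>Q 1"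
    using Q.EQ.pure_add_left[of e f 1] e f by (simp add: S_simps A_Q_simps(2))
  then show "PQ.pure ((e \<oplus>\<^bsub>A\<^esub> f) \<otimes>\<^sub>Q 1) x = PQ.pure (e \<otimes>\<^sub>Q 1) x \<otimes>\<^bsub>T_Q\<^esub> PQ.pure (f \<otimes>\<^sub>Q 1) x"
    using PQ.pure_add_left[OF pure_one_closed[OF e] pure_one_closed[OF f] x] by simp
qed

lemma rationalize_hom: "rationalize \<in> hom T T_Q"
  and rationalize_pure: "\<lbrakk>e \<in> carrier A; x \<in> carrier P\<rbrakk> \<Longrightarrow> rationalize (pure e x) = PQ.pure (e \<otimes>\<^sub>Q 1) x"
  unfolding rationalize_def
  using tensor_lift[OF PQ.tensor_comm_group rationalize_balanced] by auto

lemma rationalize_clear: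
  assumes "t \<in> carrier T_Q"
  shows "\<exists>L>(0::nat). \<exists>w\<in>carrier T. t [^]\<^bsub>T_Q\<^esub> L = rationalize w"
  using assms
proof (induction t rule: PQ.tensor_induct)
  case zero
  show ?case
    using hom_one[OF rationalize_hom T.is_group PQ.T.is_group] by (intro exI[of _ 1] conjI bexI[of _ "\<one>\<^bsub>T\<^esub>"]) simp_all
next
  case (pure a x)
  then have a: "a \<in> carrier Q.EQ.T" by (simp add: A_Q_simps)
  obtain e L where e: "e \<in> carrier S" "L > (0::nat)" "a = e \<otimes>\<^sub>Q (1 / of_nat L)" using a by (rule Q.rational_form)
  have "PQ.pure a x [^]\<^bsub>T_Q\<^esub> L = PQ.pure (a [^]\<^bsub>add_monoid A_Q\<^esub> L) x"
    using hom_nat_pow[OF PQ.pure_hom_left[OF pure(2)], of a L] pure(1) comm_group.axioms(2)[OF A_Q_comm_group] PQ.T.is_group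
    by simp
  also have "a [^]\<^bsub>add_monoid A_Q\<^esub> L = e \<otimes>\<^sub>Q 1"
    unfolding A_Q_pow e(3) using e(1,2) by (simp add: Q.pure_pow)
  also have "PQ.pure (e \<otimes>\<^sub>Q 1) x = rationalize (pure_tensor R A P e x)"
    using rationalize_pure[of e x] e(1) pure(2) by (simp add: S_simps)
  finally show ?case
    using e(1,2) pure(2) by (intro exI[of _ L] conjI bexI[of _ "pure_tensor R A P e x"]) (simp_all add: S_simps)
next
  case (add s t)
  then obtain L w L' w' where s: "L > (0::nat)" "w \<in> carrier T" "s [^]\<^bsub>T_Q\<^esub> L = rationalize w"
    and t: "L' > (0::nat)" "w' \<in> carrier T" "t [^]\<^bsub>T_Q\<^esub> L' = rationalize w'" by blast
  have pow: "rationalize (w [^]\<^bsub>T\<^esub> n) = rationalize w [^]\<^bsub>T_Q\<^esub> n" if "w \<in> carrier T" for w and n :: nat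
    by (rule hom_nat_pow[OF rationalize_hom that T.is_group PQ.T.is_group])
  have "(s \<otimes>\<^bsub>T_Q\<^esub> t) [^]\<^bsub>T_Q\<^esub> (L * L') = (s [^]\<^bsub>T_Q\<^esub> L) [^]\<^bsub>T_Q\<^esub> L' \<otimes>\<^bsub>T_Q\<^esub> (t [^]\<^bsub>T_Q\<^esub> L') [^]\<^bsub>T_Q\<^esub> L"
    using add.hyps by (simp add: PQ.T.nat_pow_distrib PQ.T.nat_pow_pow mult.commute)
  also have "\<dots> = rationalize (w [^]\<^bsub>T\<^esub> L' \<otimes>\<^bsub>T\<^esub> w' [^]\<^bsub>T\<^esub> L)"
    using s t by (simp add: pow hom_mult[OF rationalize_hom])
  finally show ?case
    using s t by (intro exI[of _ "L * L'"] conjI bexI[of _ "w [^]\<^bsub>T\<^esub> L' \<otimes>\<^bsub>T\<^esub> w' [^]\<^bsub>T\<^esub> L"]) simp_all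
qed

lemma coordinate_rationalize:
  assumes j: "j \<in> J" and w: "w \<in> carrier T"
  shows "PQ.coordinate j (rationalize w) = coordinate j w \<otimes>\<^sub>Q 1"
proof (rule hom_eqI[where G = "add_monoid A_Q", OF _ _ comm_group.axioms(2)[OF A_Q_comm_group] _ w])
  show "(\<lambda>w. PQ.coordinate j (rationalize w)) \<in> hom T (add_monoid A_Q)"
    using hom_compose[OF rationalize_hom PQ.coordinate_hom[OF j]] by (simp add: comp_def)
  have "(\<lambda>e. e \<otimes>\<^sub>Q 1) \<in> hom (add_monoid A) (add_monoid A_Q)"
    using Q.EQ.pure_add_left[of _ _ 1] by (auto simp: hom_def pure_one_closed S_simps A_Q_simps(2))
  from hom_compose[OF coordinate_hom[OF j] this]
  show "(\<lambda>w. coordinate j w \<otimes>\<^sub>Q 1) \<in> hom T (add_monoid A_Q)" by (simp add: comp_def)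
  fix e x assume e: "e \<in> carrier A" and x: "x \<in> carrier P"
  show "PQ.coordinate j (rationalize (pure e x)) = coordinate j (pure e x) \<otimes>\<^sub>Q 1"
    unfolding rationalize_pure[OF e x] PQ.coordinate_pure[OF j pure_one_closed[OF e] x] coordinate_pure[OF j e x]
    by (rule A_Q_act_pure[OF coord_closed[OF j x] e])
qed

text \<open>In each of the finitely many coordinates the kernel is torsion; the product of the exponents serves
  for all of them.\<close>

lemma rationalize_kernel:
  assumes w: "w \<in> carrier T" and zero: "rationalize w = \<one>\<^bsub>T_Q\<^esub>"
  shows "\<exists>L>(0::nat). w [^]\<^bsub>T\<^esub> L = \<one>\<^bsub>T\<^esub>"
proof -
  have AG: "group (add_monoid A)" using A_comm_group comm_group.axioms(2) by blast
  have SA: "x [^]\<^bsub>add_monoid S\<^esub> (k::nat) = x [^]\<^bsub>add_monoid A\<^esub> k" for x k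
    by (rule nat_pow_cong) (simp_all add: S_simps)
  have "\<exists>L>(0::nat). coordinate j w [^]\<^bsub>add_monoid A\<^esub> L = \<zero>\<^bsub>A\<^esub>" if j: "j \<in> J" for j
  proof -
    have "coordinate j w \<otimes>\<^sub>Q 1 = PQ.coordinate j \<one>\<^bsub>T_Q\<^esub>" using coordinate_rationalize[OF j w] zero by simp
    also have "\<dots> = \<one>\<^bsub>Q.EQ.T\<^esub>"
      using hom_one[OF PQ.coordinate_hom[OF j] PQ.T.is_group comm_group.axioms(2)[OF A_Q_comm_group]]
      by (simp add: A_Q_simps(3))
    finally obtain L :: nat where L: "L > 0" "[L] \<cdot>\<^bsub>S\<^esub> coordinate j w = \<zero>\<^bsub>S\<^esub>"
      using Q.pure_one_zero_imp_torsion[of "coordinate j w"] coordinate_closed[OF j w] by (auto simp: S_simps)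
    have "coordinate j w [^]\<^bsub>add_monoid A\<^esub> L = [L] \<cdot>\<^bsub>S\<^esub> coordinate j w"
      unfolding add_pow_def by (rule SA[symmetric])
    also have "\<dots> = \<zero>\<^bsub>A\<^esub>" by (rule trans[OF L(2) S_simps(3)])
    finally show ?thesis using L(1) by (intro exI conjI)
  qed
  then obtain L where L: "\<And>j. j \<in> J \<Longrightarrow> L j > (0::nat)"
    "\<And>j. j \<in> J \<Longrightarrow> coordinate j w [^]\<^bsub>add_monoid A\<^esub> L j = \<zero>\<^bsub>A\<^esub>" by metis
  let ?N = "\<Prod>j\<in>J. L j"
  have "w [^]\<^bsub>T\<^esub> ?N = \<one>\<^bsub>T\<^esub>"
  proof (rule tensor_eq_one)
    show "w [^]\<^bsub>T\<^esub> ?N \<in> carrier T" using w by simp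
    fix j assume j: "j \<in> J"
    obtain m where m: "?N = L j * m" using dvd_prodI[OF finite_J j, of L] by (auto elim: dvdE)
    have "coordinate j (w [^]\<^bsub>T\<^esub> ?N) = (coordinate j w [^]\<^bsub>add_monoid A\<^esub> L j) [^]\<^bsub>add_monoid A\<^esub> m"
      using hom_nat_pow[OF coordinate_hom[OF j] w T.is_group AG, of ?N] coordinate_closed[OF j w]
        monoid.nat_pow_pow[OF group.is_monoid[OF AG], of "coordinate j w" "L j" m] by (simp add: m)
    then show "coordinate j (w [^]\<^bsub>T\<^esub> ?N) = \<zero>\<^bsub>A\<^esub>"
      using monoid.nat_pow_one[OF group.is_monoid[OF AG], of m] L(2)[OF j] by simp
  qed
  moreover have "?N > 0" using L(1) by (simp add: prod_pos)
  ultimately show ?thesis by blast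
qed

lemma T_Q_torsion_free:
  assumes t: "t \<in> carrier T_Q" "t [^]\<^bsub>T_Q\<^esub> k = \<one>\<^bsub>T_Q\<^esub>" "k > (0::nat)"
  shows "t = \<one>\<^bsub>T_Q\<^esub>"
proof (rule PQ.tensor_eq_one[OF t(1)])
  fix j assume j: "j \<in> J"
  note G = PQ.T.is_group comm_group.axioms(2)[OF A_Q_comm_group]
  have "PQ.coordinate j t [^]\<^bsub>Q.EQ.T\<^esub> k = PQ.coordinate j (t [^]\<^bsub>T_Q\<^esub> k)"
    using hom_nat_pow[OF PQ.coordinate_hom[OF j] t(1) G, of k] unfolding A_Q_pow by simp
  also have "\<dots> = \<one>\<^bsub>Q.EQ.T\<^esub>"
    unfolding t(2) using hom_one[OF PQ.coordinate_hom[OF j] G] by (simp add: A_Q_simps(3))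
  finally show "PQ.coordinate j t = \<zero>\<^bsub>A_Q\<^esub>"
    using Q.rational_torsion_free[OF _ _ t(3)] PQ.coordinate_closed[OF j t(1)] by (simp add: A_Q_simps(1,3))
qed

lemma T_Q_divisible:
  assumes "t \<in> carrier T_Q" "k > (0::nat)"
  shows "\<exists>s\<in>carrier T_Q. s [^]\<^bsub>T_Q\<^esub> k = t"
  using assms(1)
proof (induction t rule: PQ.tensor_induct)
  case zero
  show ?case by (intro bexI[of _ "\<one>\<^bsub>T_Q\<^esub>"]) simp_all
next
  case (pure a x)
  then obtain c where c: "c \<in> carrier Q.EQ.T" "c [^]\<^bsub>Q.EQ.T\<^esub> k = a"
    using Q.rational_divisible[of a k] assms(2) by (auto simp: A_Q_simps(1))
  have "PQ.pure c x [^]\<^bsub>T_Q\<^esub> k = PQ.pure (c [^]\<^bsub>add_monoid A_Q\<^esub> k) x"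
    using hom_nat_pow[OF PQ.pure_hom_left[OF pure(2)], of c k] c(1) comm_group.axioms(2)[OF A_Q_comm_group] PQ.T.is_group
    by (simp add: A_Q_simps(1))
  then show ?case
    using c pure(2) unfolding A_Q_pow by (intro bexI[of _ "PQ.pure c x"]) (simp_all add: A_Q_simps(1))
next
  case (add s t)
  then obtain s' t' where "s' \<in> carrier T_Q" "s' [^]\<^bsub>T_Q\<^esub> k = s" "t' \<in> carrier T_Q" "t' [^]\<^bsub>T_Q\<^esub> k = t" by blast
  then show ?case by (intro bexI[of _ "s' \<otimes>\<^bsub>T_Q\<^esub> t'"]) (auto simp: PQ.T.nat_pow_distrib)
qed

end

section \<open>Exactness after completion\<close>

text \<open>Clear denominators: \<open>L z\<close> is the image of some \<open>w\<close> over the completed ring. The boundary of \<open>w\<close> becomes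
  zero rationally, so it is torsion and \<open>N w\<close> is a cycle. Then \<open>q N w\<close> is a boundary, and its rational image
  \<open>L N q z\<close> is so too. Finally \<open>L N q\<close> can be divided out, since the rational chain groups are divisible
  and torsion-free.\<close>

lemma rational_cycle_is_boundary:
  fixes R :: "('r, 'k) ring_scheme" and P :: "nat \<Rightarrow> ('r, 'q) module" and p q :: nat
  assumes res: "based_resolution R M P \<delta> \<eta> J b \<phi>" "\<And>i. finite (J i)" and q: "q > 0"
  defines "C \<equiv> \<lambda>i. tensor R (completed_ring_module p R) (P i)"
    and "D \<equiv> \<lambda>i. tensor_map R (completed_ring_module p R) (P i) (\<delta> i)"
    and "C_Q \<equiv> \<lambda>i. tensor R (rational_completed_ring_module p R) (P i)"
    and "D_Q \<equiv> \<lambda>i. tensor_map R (rational_completed_ring_module p R) (P i) (\<delta> i)"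
  assumes bounded: "\<And>i z. z \<in> cycles C D i \<Longrightarrow> z [^]\<^bsub>C i\<^esub> q \<in> D i ` carrier (C (Suc i))"
    and z: "z \<in> cycles C_Q D_Q i"
  shows "z \<in> D_Q i ` carrier (C_Q (Suc i))"
proof -
  interpret P: based_resolution R M P \<delta> \<eta> J b \<phi> by fact
  interpret A: completed_ring R p by (intro completed_ring.intro P.M.R.ring_axioms)
  interpret X: finite_tensored_resolution R M P \<delta> \<eta> J b \<phi> A.A
    by (intro finite_tensored_resolution.intro tensored_resolution.intro finite_tensored_resolution_axioms.intro
        res A.right_module_A)
  interpret Y: finite_tensored_resolution R M P \<delta> \<eta> J b \<phi> A.A_Q
    by (intro finite_tensored_resolution.intro tensored_resolution.intro finite_tensored_resolution_axioms.intro
        res A.right_module_A_Q)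
  have C: "C = X.C" "D = X.D" "C_Q = Y.C" "D_Q = Y.D" by (simp_all add: C_def D_def C_Q_def D_Q_def)
  have ct: "completed_tensor R p (P i) (J i) (b i) (\<phi> i)" for i
    using X.based_tensor A.completed_ring_axioms by (simp add: completed_tensor_def)
  let ?\<iota> = "\<lambda>i. completed_tensor.rationalize R p (P i)"
  note \<iota>_hom = completed_tensor.rationalize_hom[OF ct]
  have \<iota>_D: "?\<iota> i (X.D i w) = Y.D i (?\<iota> (Suc i) w)" if w: "w \<in> carrier (X.C (Suc i))" for i w
  proof (rule tensor_product.hom_eqI[OF X.product _ _ Y.C_group _ w])
    show "(\<lambda>w. ?\<iota> i (X.D i w)) \<in> hom (X.C (Suc i)) (Y.C i)"
      using hom_compose[OF X.D_hom \<iota>_hom] by (simp add: comp_def)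
    show "(\<lambda>w. Y.D i (?\<iota> (Suc i) w)) \<in> hom (X.C (Suc i)) (Y.C i)"
      using hom_compose[OF \<iota>_hom Y.D_hom] by (simp add: comp_def)
    fix e x assume e: "e \<in> carrier A.A" and x: "x \<in> carrier (P (Suc i))"
    note \<delta>x = linear_map_closed[OF P.boundary_linear x]
    show "?\<iota> i (X.D i (pure_tensor R A.A (P (Suc i)) e x)) = Y.D i (?\<iota> (Suc i) (pure_tensor R A.A (P (Suc i)) e x))"
      unfolding tensor_functor.tensor_map_pure[OF X.functor_at P.boundary_linear e x]
        completed_tensor.rationalize_pure[OF ct e \<delta>x] completed_tensor.rationalize_pure[OF ct e x]
      using tensor_functor.tensor_map_pure[OF Y.functor_at P.boundary_linear completed_tensor.pure_one_closed[OF ct e] x]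
      by simp
  qed
  have zY: "z \<in> cycles Y.C Y.D i" using z by (simp add: C)
  have zC: "z \<in> carrier (Y.C i)" by (rule Y.cycles_closed[OF zY])
  interpret Ci: comm_group "Y.C i" by (rule Y.C_comm_group)
  obtain L w where L: "L > (0::nat)" "w \<in> carrier (X.C i)" "z [^]\<^bsub>Y.C i\<^esub> L = ?\<iota> i w"
    using completed_tensor.rationalize_clear[OF ct zC] by blast
  have "\<exists>N>(0::nat). w [^]\<^bsub>X.C i\<^esub> N \<in> cycles X.C X.D i"
  proof (cases i)
    case 0
    then show ?thesis
      using L(2) monoid.nat_pow_closed[OF group.is_monoid[OF X.C_group], of w 0 1]
      by (intro exI[of _ 1]) (simp add: cycles_def)
  next
    case (Suc j)
    have w': "w \<in> carrier (X.C (Suc j))" and z': "z \<in> carrier (Y.C (Suc j))" "Y.D j z = \<one>\<^bsub>Y.C j\<^esub>"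
      using L(2) zY Suc by (auto simp: Y.cycles_Suc)
    have "?\<iota> j (X.D j w) = Y.D j (z [^]\<^bsub>Y.C (Suc j)\<^esub> L)" using \<iota>_D[OF w'] L(3) Suc by simp
    also have "\<dots> = \<one>\<^bsub>Y.C j\<^esub>"
      using hom_nat_pow[OF Y.D_hom z'(1) Y.C_group Y.C_group, of L] z'(2)
        monoid.nat_pow_one[OF group.is_monoid[OF Y.C_group]] by simp
    finally obtain N where N: "N > (0::nat)" "X.D j w [^]\<^bsub>X.C j\<^esub> N = \<one>\<^bsub>X.C j\<^esub>"
      using completed_tensor.rationalize_kernel[OF ct X.D_closed[OF w']] by blast
    then have "X.D j (w [^]\<^bsub>X.C (Suc j)\<^esub> N) = \<one>\<^bsub>X.C j\<^esub>"
      using hom_nat_pow[OF X.D_hom w' X.C_group X.C_group, of N] by simp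
    then show ?thesis
      using N(1) monoid.nat_pow_closed[OF group.is_monoid[OF X.C_group] w'] Suc
      by (intro exI[of _ N]) (simp add: X.cycles_Suc)
  qed
  then obtain N where N: "N > (0::nat)" "w [^]\<^bsub>X.C i\<^esub> N \<in> cycles X.C X.D i" by blast
  obtain v where v: "v \<in> carrier (X.C (Suc i))" "(w [^]\<^bsub>X.C i\<^esub> N) [^]\<^bsub>X.C i\<^esub> q = X.D i v"
    using bounded[of "w [^]\<^bsub>X.C i\<^esub> N" i] N(2) unfolding C by blast
  let ?m = "L * N * q"
  have m: "?m > 0" using L(1) N(1) q by simp
  have \<iota>v: "?\<iota> (Suc i) v \<in> carrier (Y.C (Suc i))" by (rule hom_in_carrier[OF \<iota>_hom v(1)])
  obtain v' where v': "v' \<in> carrier (Y.C (Suc i))" "v' [^]\<^bsub>Y.C (Suc i)\<^esub> ?m = ?\<iota> (Suc i) v"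
    using completed_tensor.T_Q_divisible[OF ct \<iota>v m] by blast
  have "Y.D i v' [^]\<^bsub>Y.C i\<^esub> ?m = Y.D i (?\<iota> (Suc i) v)"
    using hom_nat_pow[OF Y.D_hom v'(1) Y.C_group Y.C_group, of ?m] v'(2) by simp
  also have "\<dots> = ?\<iota> i ((w [^]\<^bsub>X.C i\<^esub> N) [^]\<^bsub>X.C i\<^esub> q)" using \<iota>_D[OF v(1)] v(2) by simp
  also have "\<dots> = (?\<iota> i w [^]\<^bsub>Y.C i\<^esub> N) [^]\<^bsub>Y.C i\<^esub> q"
    using L(2) monoid.nat_pow_closed[OF group.is_monoid[OF X.C_group] L(2)]
    by (simp add: hom_nat_pow[OF \<iota>_hom _ X.C_group Y.C_group])
  also have "\<dots> = z [^]\<^bsub>Y.C i\<^esub> ?m"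
    unfolding L(3)[symmetric] using zC by (simp add: Ci.nat_pow_pow)
  finally have eq: "Y.D i v' [^]\<^bsub>Y.C i\<^esub> ?m = z [^]\<^bsub>Y.C i\<^esub> ?m" .
  have Dv: "Y.D i v' \<in> carrier (Y.C i)" by (rule Y.D_closed[OF v'(1)])
  have "(Y.D i v' \<otimes>\<^bsub>Y.C i\<^esub> inv\<^bsub>Y.C i\<^esub> z) [^]\<^bsub>Y.C i\<^esub> ?m = \<one>\<^bsub>Y.C i\<^esub>"
    using Dv zC eq by (simp add: Ci.nat_pow_distrib Ci.nat_pow_inv)
  then have "Y.D i v' \<otimes>\<^bsub>Y.C i\<^esub> inv\<^bsub>Y.C i\<^esub> z = \<one>\<^bsub>Y.C i\<^esub>"
    using completed_tensor.T_Q_torsion_free[OF ct _ _ m] Dv zC by simp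
  then have "z = Y.D i v'" using Dv zC Ci.inv_solve_right'[of "\<one>\<^bsub>Y.C i\<^esub>" "Y.D i v'" z] by simp
  then show ?thesis unfolding C using v'(1) by blast
qed

lemma exact_complex_of_extension:
  fixes R :: "('r, 'k) ring_scheme" and P P' :: "nat \<Rightarrow> ('r, 'q) module"
  assumes A: "right_module R A" and res: "based_resolution R M P' \<delta>' \<eta> J b \<phi>"
    and ext: "\<And>i. i \<le> d \<Longrightarrow> P' i = P i" "\<And>i. i < d \<Longrightarrow> \<delta>' i = \<delta> i"
      "\<And>i. d < i \<Longrightarrow> carrier (P' i) = {\<zero>\<^bsub>P' i\<^esub>}"
    and exact: "\<And>i z. z \<in> cycles (\<lambda>i. tensor R A (P' i)) (\<lambda>i. tensor_map R A (P' i) (\<delta>' i)) i \<Longrightarrow>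
      z \<in> tensor_map R A (P' i) (\<delta>' i) ` carrier (tensor R A (P' (Suc i)))"
  shows "exact_complex d (\<lambda>i. tensor R A (P i)) (\<lambda>i. tensor_map R A (P i) (\<delta> i))"
proof -
  interpret X: tensored_resolution R M P' \<delta>' \<eta> J b \<phi> A by (intro tensored_resolution.intro res A)
  show ?thesis
  proof (rule exact_complexI[where C' = X.C and D' = X.D])
    show "X.D i ` carrier (X.C (Suc i)) \<subseteq> cycles X.C X.D i" for i using X.boundary_in_cycles by blast
    show "carrier (X.C (Suc d)) = {\<one>\<^bsub>X.C (Suc d)\<^esub>}"
      using tensor_product.trivial_tensor[OF X.product ext(3)[of "Suc d"]]
        monoid.one_closed[OF group.is_monoid[OF X.C_group]] by blast
    show "z \<in> X.D i ` carrier (X.C (Suc i))" if "z \<in> cycles X.C X.D i" for i z by (rule exact[OF that])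
  qed (simp_all add: X.C_comm_group X.D_hom ext)
qed

theorem theorem2p4:
  fixes R :: "'r ring" and M :: "('r, 'm) module" and p n0 :: nat
  assumes "Factorial_Ring.prime p"
    and "ring R"
    and "inj_on (\<lambda>r. [p] \<cdot>\<^bsub>R\<^esub> r) (carrier R)"
    and "left_module R M"
    and "type_FP TYPE('f) R M"
    and "\<forall>i\<ge>n0. power_image p i (add_monoid M) = power_image p n0 (add_monoid M)"
  shows
    "(trivial_group (torsion_limit1 p (add_monoid M)) \<and>
      completion_tensor_map p R M
        \<in> iso (tensor R (completed_ring_module p R) M) (padic_completion p (add_monoid M)) \<and>
      (\<lambda>x. x n0)
        \<in> iso (padic_completion p (add_monoid M))
            (add_monoid M Mod power_image p n0 (add_monoid M))) \<and>
     (\<forall>\<epsilon>. \<epsilon> \<in> ring_hom R \<Z> \<and> trivial_group (torsion_limit p (add_monoid M)) \<longrightarrow>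
       (let Z = right_module_via \<Z> \<epsilon>; T = Tor R Z M
        in (\<forall>i. finite (carrier (T i)) \<and>
              (\<forall>x\<in>carrier (T i). (\<exists>k::nat. x [^]\<^bsub>T i\<^esub> (p ^ k) = \<one>\<^bsub>T i\<^esub>) \<longrightarrow>
                 x [^]\<^bsub>T i\<^esub> (p ^ n0) = \<one>\<^bsub>T i\<^esub>)) \<and>
           (\<forall>d (P :: nat \<Rightarrow> ('r, 'q) module) \<delta> \<eta>.
              fg_projective_resolution R M d P \<delta> \<eta> \<longrightarrow> (\<forall>i>d. trivial_group (T i))) \<and>
           finite {i. order (T i) \<noteq> 1} \<and>
           (\<forall>d (P :: nat \<Rightarrow> ('r, 'q) module) \<delta> \<eta>.
              fg_projective_resolution R M d P \<delta> \<eta> \<longrightarrow>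
              mult_Euler_char R Z M = (\<Prod>i\<le>d. of_nat (order (T i)) powi ((-1) ^ i)))) \<and>
       (\<forall>d (P :: nat \<Rightarrow> ('r, 'q) module) \<delta> \<eta>.
          fg_projective_resolution R M d P \<delta> \<eta> \<longrightarrow>
          exact_complex d (\<lambda>i. tensor R (rational_completed_ring_module p R) (P i))
            (\<lambda>i. tensor_map R (rational_completed_ring_module p R) (P i) (\<delta> i)) \<and>
          (n0 = 0 \<or> (\<lambda>x. [p] \<cdot>\<^bsub>M\<^esub> x) ` carrier M = carrier M \<longrightarrow>
           exact_complex d (\<lambda>i. tensor R (completed_ring_module p R) (P i))
             (\<lambda>i. tensor_map R (completed_ring_module p R) (P i) (\<delta> i)))))"
proof -
  let ?G = "add_monoid M"
  have p: "p > 1" by (rule prime_gt_1_nat[OF assms(1)])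
  interpret M: left_module R M by fact
  interpret S: p_stable_group ?G p n0
    by (intro p_stable_group.intro p_stable_group_axioms.intro M.a_comm_group) (use assms(6) in blast)
  interpret A: completed_ring R p by (intro completed_ring.intro assms(2))
  obtain d0 and P0 :: "nat \<Rightarrow> ('r, 'f) module" and \<delta>0 \<eta>0 where "fg_projective_resolution R M d0 P0 \<delta>0 \<eta>0"
    using assms(5) unfolding type_FP_def by blast
  then obtain F :: "nat \<Rightarrow> ('r, 'f) module" and \<delta>F J\<^sub>F \<phi>\<^sub>F
    where F: "based_resolution R M F \<delta>F \<eta>0 J\<^sub>F (\<lambda>_ x. x) \<phi>\<^sub>F" "\<And>i. finite (J\<^sub>F i)"
      "\<And>i. i \<le> d0 \<Longrightarrow> F i = P0 i" "\<And>i. i < d0 \<Longrightarrow> \<delta>F i = \<delta>0 i"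
      "\<And>i. d0 < i \<Longrightarrow> carrier (F i) = {\<zero>\<^bsub>F i\<^esub>}"
    by (rule fg_projective_resolution_extend[OF _ assms(4)]) (rule that, assumption+)
  have a: "trivial_group (torsion_limit1 p ?G) \<and>
      completion_tensor_map p R M \<in> iso (tensor R (completed_ring_module p R) M) (padic_completion p ?G) \<and>
      (\<lambda>x. x n0) \<in> iso (padic_completion p ?G) (?G Mod power_image p n0 ?G)"
    by (intro conjI S.lim1_trivial completion_tensor_iso[OF F(1,2) S.p_stable_group_axioms] S.completion_iso)
  show ?thesis (is "_ \<and> (\<forall>\<epsilon>. ?hypotheses \<epsilon> \<longrightarrow> ?bc \<epsilon>)")
  proof (rule conjI[OF a], rule allI, rule impI)
    fix \<epsilon> assume "?hypotheses \<epsilon>"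
    then have \<epsilon>: "\<epsilon> \<in> ring_hom R \<Z>" and lim: "trivial_group (torsion_limit p ?G)" by simp_all
    let ?T = "Tor R (right_module_via \<Z> \<epsilon>) M" and ?q = "p ^ n0"
    obtain \<psi> where \<psi>: "\<psi> \<in> linear_maps R M M"
      "\<And>x. x \<in> carrier M \<Longrightarrow> [?q] \<cdot>\<^bsub>M\<^esub> x = [?q] \<cdot>\<^bsub>M\<^esub> ([p] \<cdot>\<^bsub>M\<^esub> \<psi> x)"
      by (rule divided_projection[OF assms(4) S.stable lim], assumption) (rule that, assumption+)
    have q: "?q > 0" using p by simp
    have fin_Tor: "finite (carrier (?T i))" for i
      by (rule Tor_finite(1)[OF F(1,2) \<epsilon> p q \<psi>])
    have Tor_torsion: "x [^]\<^bsub>?T i\<^esub> ?q = \<one>\<^bsub>?T i\<^esub>"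
      if "x \<in> carrier (?T i)" "x [^]\<^bsub>?T i\<^esub> (p ^ k) = \<one>\<^bsub>?T i\<^esub>" for i x k
      by (rule Tor_finite(2)[OF F(1,2) \<epsilon> p q \<psi> that])
    have high: "trivial_group (?T i)" if res: "fg_projective_resolution R M d P \<delta> \<eta>" and di: "d < i"
      for d i \<delta> \<eta> and P :: "nat \<Rightarrow> ('r, 'q) module"
    proof -
      obtain P' \<delta>' J \<phi> where P': "based_resolution R M P' \<delta>' \<eta> J (\<lambda>_ x. x) \<phi>" "\<And>i. finite (J i)"
        "\<And>i. i \<le> d \<Longrightarrow> P' i = P i" "\<And>i. i < d \<Longrightarrow> \<delta>' i = \<delta> i"
        "\<And>i. d < i \<Longrightarrow> carrier (P' i) = {\<zero>\<^bsub>P' i\<^esub>}"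
        by (rule fg_projective_resolution_extend[OF res assms(4)]) (rule that, assumption+)
      show ?thesis by (rule Tor_finite(3)[OF P'(1,2) \<epsilon> p q \<psi> P'(5)[OF di]])
    qed
    have order_one: "order (?T i) = 1" if "trivial_group (?T i)" for i
      using that by (simp add: trivial_group_def order_def)
    have fin: "finite {i. order (?T i) \<noteq> 1}"
    proof (rule finite_subset)
      show "{i. order (?T i) \<noteq> 1} \<subseteq> {..d0}"
        using order_one Tor_finite(3)[OF F(1,2) \<epsilon> p q \<psi> F(5)] by (auto simp: not_le[symmetric])
    qed simp
    have Euler: "mult_Euler_char R (right_module_via \<Z> \<epsilon>) M = (\<Prod>i\<le>d. of_nat (order (?T i)) powi ((-1) ^ i))"
      if "fg_projective_resolution R M d P \<delta> \<eta>" for d \<delta> \<eta> and P :: "nat \<Rightarrow> ('r, 'q) module"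
      unfolding mult_Euler_char_def
    proof (rule prod.mono_neutral_left)
      show "{i. order (?T i) \<noteq> 1} \<subseteq> {..d}"
        using order_one high[OF that] by (auto simp: not_le[symmetric])
    qed auto
    have exact: "exact_complex d (\<lambda>i. tensor R (rational_completed_ring_module p R) (P i))
            (\<lambda>i. tensor_map R (rational_completed_ring_module p R) (P i) (\<delta> i)) \<and>
          (n0 = 0 \<or> (\<lambda>x. [p] \<cdot>\<^bsub>M\<^esub> x) ` carrier M = carrier M \<longrightarrow>
           exact_complex d (\<lambda>i. tensor R (completed_ring_module p R) (P i))
             (\<lambda>i. tensor_map R (completed_ring_module p R) (P i) (\<delta> i)))"
      if res: "fg_projective_resolution R M d P \<delta> \<eta>" for d \<delta> \<eta> and P :: "nat \<Rightarrow> ('r, 'q) module"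
    proof -
      obtain P' \<delta>' J \<phi> where P': "based_resolution R M P' \<delta>' \<eta> J (\<lambda>_ x. x) \<phi>" "\<And>i. finite (J i)"
        "\<And>i. i \<le> d \<Longrightarrow> P' i = P i" "\<And>i. i < d \<Longrightarrow> \<delta>' i = \<delta> i"
        "\<And>i. d < i \<Longrightarrow> carrier (P' i) = {\<zero>\<^bsub>P' i\<^esub>}"
        by (rule fg_projective_resolution_extend[OF res assms(4)]) (rule that, assumption+)
      have bounded: "z [^]\<^bsub>tensor R A.A (P' i)\<^esub> ?q \<in> tensor_map R A.A (P' i) (\<delta>' i) ` carrier (tensor R A.A (P' (Suc i)))"
        if "z \<in> cycles (\<lambda>i. tensor R A.A (P' i)) (\<lambda>i. tensor_map R A.A (P' i) (\<delta>' i)) i" for i z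
        by (rule completed_ring_cycle_power[OF P'(1,2) \<psi> that])
      show ?thesis
      proof (intro conjI impI)
        show "exact_complex d (\<lambda>i. tensor R (rational_completed_ring_module p R) (P i))
            (\<lambda>i. tensor_map R (rational_completed_ring_module p R) (P i) (\<delta> i))"
        proof (rule exact_complex_of_extension[OF A.right_module_A_Q P'(1,3-5)])
          fix i z
          assume "z \<in> cycles (\<lambda>i. tensor R A.A_Q (P' i)) (\<lambda>i. tensor_map R A.A_Q (P' i) (\<delta>' i)) i"
          then show "z \<in> tensor_map R A.A_Q (P' i) (\<delta>' i) ` carrier (tensor R A.A_Q (P' (Suc i)))"
            by (rule rational_cycle_is_boundary[OF P'(1,2) q bounded, rotated])
        qed
        assume "n0 = 0 \<or> (\<lambda>x. [p] \<cdot>\<^bsub>M\<^esub> x) ` carrier M = carrier M"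
        then have all: "power_image p i ?G = power_image p 0 ?G" for i
        proof
          assume "n0 = 0"
          then show ?thesis using assms(6) by blast
        next
          assume "(\<lambda>x. [p] \<cdot>\<^bsub>M\<^esub> x) ` carrier M = carrier M"
          then have surj: "(\<lambda>x. x [^]\<^bsub>?G\<^esub> p) ` carrier M = carrier M" by (simp add: add_pow_def)
          have "power_image p i ?G = carrier M"
          proof (induction i)
            case (Suc i)
            have "power_image p (Suc i) ?G = (\<lambda>x. (x [^]\<^bsub>?G\<^esub> p) [^]\<^bsub>?G\<^esub> (p ^ i)) ` carrier M"
              using monoid.nat_pow_pow[OF M.a_monoid, of _ p "p ^ i"] by (simp add: power_image_def cong: image_cong)
            also have "\<dots> = (\<lambda>x. x [^]\<^bsub>?G\<^esub> (p ^ i)) ` (\<lambda>x. x [^]\<^bsub>?G\<^esub> p) ` carrier M"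
              by (simp only: image_image)
            also have "\<dots> = power_image p i ?G" unfolding surj by (simp add: power_image_def)
            finally show ?case using Suc by simp
          qed (auto simp: power_image_def)
          then show ?thesis by (auto simp: power_image_def)
        qed
        \<comment> \<open>As the multiples are stable from \<open>0\<close> on, \<open>q\<close> may be replaced by \<open>p ^ 0 = 1\<close>.\<close>
        obtain \<psi>0 where \<psi>0: "\<psi>0 \<in> linear_maps R M M"
          "\<And>x. x \<in> carrier M \<Longrightarrow> [(p ^ 0)] \<cdot>\<^bsub>M\<^esub> x = [(p ^ 0)] \<cdot>\<^bsub>M\<^esub> ([p] \<cdot>\<^bsub>M\<^esub> \<psi>0 x)"
          by (rule divided_projection[OF assms(4) all lim]) (rule that, assumption+)
        show "exact_complex d (\<lambda>i. tensor R (completed_ring_module p R) (P i))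
             (\<lambda>i. tensor_map R (completed_ring_module p R) (P i) (\<delta> i))"
        proof (rule exact_complex_of_extension[OF A.right_module_A P'(1,3-5)])
          let ?C = "\<lambda>i. tensor R (completed_ring_module p R) (P' i)"
            and ?D = "\<lambda>i. tensor_map R (completed_ring_module p R) (P' i) (\<delta>' i)"
          fix i z assume z: "z \<in> cycles ?C ?D i"
          interpret X: tensored_resolution R M P' \<delta>' \<eta> J "\<lambda>_ x. x" \<phi> "completed_ring_module p R"
            by (intro tensored_resolution.intro P'(1) A.right_module_A)
          have "z [^]\<^bsub>?C i\<^esub> (p ^ 0) = z"
            using monoid.nat_pow_eone[OF group.is_monoid[OF X.C_group] X.cycles_closed[OF z]] by simp
          moreover have "z [^]\<^bsub>?C i\<^esub> (p ^ 0) \<in> ?D i ` carrier (?C (Suc i))"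
            by (rule completed_ring_cycle_power[OF P'(1,2) \<psi>0 z])
          ultimately show "z \<in> ?D i ` carrier (?C (Suc i))" by simp
        qed
      qed
    qed
    show "?bc \<epsilon>"
      unfolding Let_def
    proof (intro conjI fin)
      show "\<forall>i. finite (carrier (?T i)) \<and> (\<forall>x\<in>carrier (?T i).
          (\<exists>k::nat. x [^]\<^bsub>?T i\<^esub> (p ^ k) = \<one>\<^bsub>?T i\<^esub>) \<longrightarrow> x [^]\<^bsub>?T i\<^esub> ?q = \<one>\<^bsub>?T i\<^esub>)"
        using fin_Tor Tor_torsion by blast
    qed (use high Euler exact in blast)+
  qed
qed

end
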